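(* Let $n\ge1$ and $p>n$. There exists a constant $C(n,p)>0$, depending only on $n$ and $p$, such that for every domain $\Omega\subset\mathbb{R}^n$ having finite volume $\mathcal{L}^n(\Omega)$ and satisfying $-\Delta d\ge0$ in $\Omega$ in the sense of distributions, and for all $u\in C_c^\infty(\Omega)$, $$\sup_{x\in\Omega}|u(x)|\le C(n,p)\,[\mathcal{L}^n(\Omega)]^{1/n-1/p}\left(\int_\Omega|\nabla u|^pdx-\Big(\frac{p-1}{p}\Big)^p\int_\Omega\frac{|u|^p}{d^p}dx\right)^{1/p}.$$
   Context: A domain is an open connected subset of $\mathbb{R}^n$; $\mathcal{L}^n$ is Lebesgue measure. $d=d(x):=\operatorname{dist}(x,\mathbb{R}^n\setminus\Omega)$. $-\Delta d\ge0$ in the sense of distributions means $-\int_\Omega d\,\Delta\phi\,dx\ge0$ for all $0\le\phi\in C_c^\infty(\Omega)$. *)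

theory Defs
  imports "HOL-Analysis.Analysis"
begin

definition partial_deriv :: "'n \<Rightarrow> (real ^ 'n \<Rightarrow> real) \<Rightarrow> real ^ 'n \<Rightarrow> real" where
  "partial_deriv i f x = frechet_derivative f (at x) (axis i 1)"

definition gradient :: "(real ^ 'n \<Rightarrow> real) \<Rightarrow> real ^ 'n \<Rightarrow> real ^ 'n" where
  "gradient f x = (\<chi> i. partial_deriv i f x)"

definition laplacian :: "(real ^ 'n \<Rightarrow> real) \<Rightarrow> real ^ 'n \<Rightarrow> real" where
  "laplacian f x = (\<Sum>i\<in>UNIV. partial_deriv i (partial_deriv i f) x)"

primrec Ck :: "nat \<Rightarrow> (real ^ 'n \<Rightarrow> real) \<Rightarrow> bool" where
  "Ck 0 f \<longleftrightarrow> continuous_on UNIV f"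
| "Ck (Suc k) f \<longleftrightarrow> f differentiable_on UNIV \<and> (\<forall>i. Ck k (partial_deriv i f))"

text \<open>
  A compactly supported smooth function on an open set is represented by its extension by zero
  to the whole space; the closure below is taken in the whole space.
\<close>

definition Cc_inf :: "(real ^ 'n) set \<Rightarrow> (real ^ 'n \<Rightarrow> real) set" where
  "Cc_inf \<Omega> = {f. (\<forall>k. Ck k f) \<and> compact (closure {x. f x \<noteq> 0}) \<and> closure {x. f x \<noteq> 0} \<subseteq> \<Omega>}"

definition domain :: "(real ^ 'n) set \<Rightarrow> bool" where
  "domain \<Omega> \<longleftrightarrow> open \<Omega> \<and> connected \<Omega> \<and> \<Omega> \<noteq> {}"

text \<open>
  Since \<^term>\<open>infdist x {} = 0\<close>, this is the intended distance only when the domain is not the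
  whole space, as is the case for domains of finite volume.
\<close>

definition bdist :: "(real ^ 'n) set \<Rightarrow> real ^ 'n \<Rightarrow> real" where
  "bdist \<Omega> x = infdist x (UNIV - \<Omega>)"

definition neg_laplacian_nonneg :: "(real ^ 'n) set \<Rightarrow> (real ^ 'n \<Rightarrow> real) \<Rightarrow> bool" where
  "neg_laplacian_nonneg \<Omega> g \<longleftrightarrow>
     (\<forall>\<phi>\<in>Cc_inf \<Omega>. (\<forall>x. 0 \<le> \<phi> x) \<longrightarrow> 0 \<le> - (LINT x:\<Omega>|lebesgue. g x * laplacian \<phi> x))"

definition hardy_difference :: "real \<Rightarrow> (real ^ 'n) set \<Rightarrow> (real ^ 'n \<Rightarrow> real) \<Rightarrow> real" where
  "hardy_difference p \<Omega> u =
     (LINT x:\<Omega>|lebesgue. norm (gradient u x) powr p)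
     - ((p - 1) / p) powr p * (LINT x:\<Omega>|lebesgue. \<bar>u x\<bar> powr p / bdist \<Omega> x powr p)"

end

(* Write d for the distance to the boundary, D for the radius of a ball of the volume of \<Omega>,
   e = p - n and s = (d/D)^e, which is at most 1.  Testing -\<Delta>d >= 0 with f(d) |u|^p, where
   f(t) = ((p-1)/p)^(p-1) t^(1-p) (1 - a (t/D)^e), and using |\<nabla>d| = 1, Young's inequality
   with a slightly reduced weight on |\<nabla>u|^p gives Hardy's inequality with the remainder
       c \<integral> s (|\<nabla>u|^p + |u|^p/d^p).
   On the ball of radius r = d(x)/2 about x the weight is at least (r/D)^(p-n), and the local Morrey
   estimate multiplies by r^(p-n); the powers of r cancel and leave |u(x)|^p <= C D^(p-n) I.

   Neither Rademacher's theorem nor weak derivatives are needed.  The distance is replaced by its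
   mollifications, which are smooth, superharmonic and 1-Lipschitz; their gradients have length
   close to 1 in the mean because d is touched from above by paraboloids with unit gradient. *)

theory Submission
  imports Defs
begin

section \<open>Integration of continuous functions with bounded support\<close>

text \<open>With H = (p-1)/p, the weight H^(p-1) t^(1-p) makes Young's inequality an equality at
  |\<nabla>u| = H |u|/d; this yields the sharp Hardy constant but no remainder. The factor 1 - a s
  adds a \<epsilon> s on the side of -f', while the first-order change it causes in Young's
  inequality cancels its other contribution (p-1) a s. What survives is linear in s; the errors are
  quadratic in a s. Quantitatively the volume enters only through d \<le> D, and D^((p-n)/p) is its
  power 1/n - 1/p up to a constant.

  The obstacle is the square of the gradient left by -\<Delta>w \<ge> 0: it multiplies the term to
  be kept, so |\<nabla>w| is needed from below, and near points with several nearest boundary points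
  it can be small. The deficit 1 - |\<nabla>w| is therefore estimated only in the mean. With kernel
  gradients of size \<eta>^(-n-1) it is bounded, up to O(\<eta>), by \<eta>^(-n-1) times the
  integral of second differences of d over |h| of order \<eta>; tested with a Lipschitz function
  these contribute \<eta>^n \<eta>^2, in total O(\<eta>).\<close>

lemma integrable_continuous_bounded_support:
  fixes f :: "'a::euclidean_space \<Rightarrow> 'b::{banach, second_countable_topology}"
  assumes "continuous_on UNIV f" "bounded {x. f x \<noteq> 0}"
  shows "integrable lborel f"
proof -
  have "integrable lborel (\<lambda>x. indicator (closure {x. f x \<noteq> 0}) x *\<^sub>R f x)"
    using assms by (intro borel_integrable_compact) (auto intro: continuous_on_subset)
  moreover have "indicator (closure {x. f x \<noteq> 0}) x *\<^sub>R f x = f x" for x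
    using closure_subset[of "{x. f x \<noteq> 0}"] by (cases "f x = 0") (auto simp: indicator_def)
  ultimately show ?thesis by simp
qed

text \<open>Parameter derivatives, parameter continuity and the swapping of integrals are taken from
  gauge integration over boxes; a support inside a box lets the Lebesgue integral over the whole
  space pass to that setting.\<close>

lemma integral_lborel_eq_integral_cbox:
  fixes f :: "'a::euclidean_space \<Rightarrow> 'b::euclidean_space"
  assumes "continuous_on UNIV f" "{x. f x \<noteq> 0} \<subseteq> cbox a b"
  shows "integral\<^sup>L lborel f = integral (cbox a b) f"
proof -
  have "bounded {x. f x \<noteq> 0}"
    using assms(2) bounded_cbox bounded_subset by blast
  then have i: "integrable lborel f"
    by (rule integrable_continuous_bounded_support[OF assms(1)])
  have "(\<lambda>x. if x \<in> cbox a b then f x else 0) = f"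
    using assms(2) by (intro ext) auto
  then have "integral (cbox a b) f = integral UNIV f"
    using integral_restrict_UNIV[of "cbox a b" f] by simp
  then show ?thesis
    using integral_lborel[OF i] by simp
qed

lemma lborel_integral_translate:
  fixes f :: "'a::euclidean_space \<Rightarrow> 'b::{banach, second_countable_topology}"
  assumes "f \<in> borel_measurable borel"
  shows "(\<integral>x. f (c + x) \<partial>lborel) = (\<integral>x. f x \<partial>lborel)"
  using integral_distr[of "\<lambda>x. c + x" lborel borel f] assms by (simp add: lborel_distr_plus)

lemma lborel_integral_affine:
  fixes f :: "'a::euclidean_space \<Rightarrow> 'b::{banach, second_countable_topology}"
  assumes [measurable]: "f \<in> borel_measurable borel" and r: "r > 0"
  shows "(\<integral>x. f x \<partial>lborel) = r ^ DIM('a) *\<^sub>R (\<integral>x. f (t + r *\<^sub>R x) \<partial>lborel)"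
proof -
  have "(\<integral>x. f x \<partial>lborel)
      = (\<integral>x. f x \<partial>(density (distr lborel borel (\<lambda>x. t + r *\<^sub>R x)) (\<lambda>_. ennreal (\<bar>r\<bar>^DIM('a)))))"
    using lborel_affine[of r t] r by (simp add: ennreal_power)
  also have "\<dots> = r ^ DIM('a) *\<^sub>R (\<integral>x. f (t + r *\<^sub>R x) \<partial>lborel)"
    using r by (subst integral_density) (auto simp: integral_distr)
  finally show ?thesis .
qed

section \<open>Differentiation of convolutions and integration by parts\<close>

lemma gradient_support_subset:
  fixes g :: "'a::euclidean_space \<Rightarrow> real"
  assumes "\<And>y. (g has_derivative (\<lambda>h. G y \<bullet> h)) (at y)"
  shows "{y. G y \<noteq> 0} \<subseteq> closure {y. g y \<noteq> 0}"
proof (rule subsetI, rule ccontr)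
  fix y assume "y \<in> {y. G y \<noteq> 0}" and y: "y \<notin> closure {y. g y \<noteq> 0}"
  have "((\<lambda>_. 0) has_derivative (\<lambda>h. G y \<bullet> h)) (at y)"
  proof (rule has_derivative_transform_within_open[OF assms, of "- closure {y. g y \<noteq> 0}"])
    show "g x = 0" if "x \<in> - closure {y. g y \<noteq> 0}" for x
      using that closure_subset[of "{y. g y \<noteq> 0}"] by auto
  qed (use y in auto)
  then have "(\<lambda>h. G y \<bullet> h) = (\<lambda>h. 0)"
    by (rule has_derivative_unique) auto
  then have "G y \<bullet> G y = 0" by metis
  then show False using \<open>y \<in> {y. G y \<noteq> 0}\<close> by simp
qed

text \<open>While x stays in a unit ball, all supports of \<open>g (y - x)\<close> lie in one box,
  and on a fixed box continuity in the parameter is available.\<close>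

lemma continuous_on_convolution:
  fixes k :: "'a::euclidean_space \<Rightarrow> real" and g :: "'a \<Rightarrow> 'b::euclidean_space"
  assumes k: "continuous_on UNIV k" and g: "continuous_on UNIV g" and b: "bounded {y. g y \<noteq> 0}"
  shows "continuous_on UNIV (\<lambda>x. \<integral>y. k y *\<^sub>R g (y - x) \<partial>lborel)"
proof -
  have "continuous_on (ball x0 1) (\<lambda>x. \<integral>y. k y *\<^sub>R g (y - x) \<partial>lborel)" for x0
  proof -
    obtain R where R: "\<And>y. g y \<noteq> 0 \<Longrightarrow> norm y \<le> R"
      using b by (auto simp: bounded_iff)
    obtain a where a: "cball 0 (R + norm x0 + 1) \<subseteq> cbox (-a) (a::'a)"
      using bounded_subset_cbox_symmetric bounded_cball by metis
    have eq: "(\<integral>y. k y *\<^sub>R g (y - x) \<partial>lborel) = integral (cbox (-a) a) (\<lambda>y. k y *\<^sub>R g (y - x))"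
      if "x \<in> ball x0 1" for x
    proof (rule integral_lborel_eq_integral_cbox)
      show "continuous_on UNIV (\<lambda>y. k y *\<^sub>R g (y - x))"
        by (intro continuous_intros k continuous_on_compose2[OF g]) auto
      have "norm y \<le> R + norm x0 + 1" if "g (y - x) \<noteq> 0" for y
        using R[OF that] norm_triangle_sub[of y x] norm_triangle_sub[of x x0] \<open>x \<in> ball x0 1\<close>
        by (simp add: dist_norm norm_minus_commute)
      then show "{y. k y *\<^sub>R g (y - x) \<noteq> 0} \<subseteq> cbox (-a) a"
        using a by auto
    qed
    have "continuous_on (ball x0 1) (\<lambda>x. integral (cbox (-a) a) (\<lambda>y. k y *\<^sub>R g (y - x)))"
      unfolding split_beta
      by (intro integral_continuous_on_param, unfold split_beta)
         (intro continuous_intros continuous_on_compose2[OF k] continuous_on_compose2[OF g]; simp)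
    then show ?thesis
      by (rule continuous_on_eq) (simp add: eq)
  qed
  then have "\<forall>x. continuous (at x) (\<lambda>x. \<integral>y. k y *\<^sub>R g (y - x) \<partial>lborel)"
    by (simp add: continuous_on_eq_continuous_at) (meson centre_in_ball zero_less_one)
  then show ?thesis
    by (simp add: continuous_on_eq_continuous_at)
qed

text \<open>The derivative falls on \<open>g\<close> alone and continuity of \<open>k\<close>
  suffices; this is what makes mollifications of the distance smooth. The minus sign comes from the
  argument \<open>y - x\<close>.\<close>

lemma convolution_has_derivative:
  fixes k g :: "'a::euclidean_space \<Rightarrow> real"
  assumes k: "continuous_on UNIV k" and g: "\<And>y. (g has_derivative (\<lambda>h. G y \<bullet> h)) (at y)"
    and G: "continuous_on UNIV G" and b: "bounded {y. g y \<noteq> 0}"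
  shows "((\<lambda>x. \<integral>y. k y * g (y - x) \<partial>lborel) has_derivative
          (\<lambda>h. (- (\<integral>y. k y *\<^sub>R G (y - x0) \<partial>lborel)) \<bullet> h)) (at x0)"
proof -
  have cg: "continuous_on UNIV g"
    using g by (auto intro!: has_derivative_continuous_on[of _ _ "\<lambda>y h. G y \<bullet> h"])
  have bG: "bounded {y. G y \<noteq> 0}"
    using gradient_support_subset[of g G, OF g] b by (meson bounded_closure bounded_subset)
  obtain R1 where R1: "\<And>y. g y \<noteq> 0 \<Longrightarrow> norm y \<le> R1"
    using b by (auto simp: bounded_iff)
  obtain R2 where R2: "\<And>y. G y \<noteq> 0 \<Longrightarrow> norm y \<le> R2"
    using bG by (auto simp: bounded_iff)
  define R where "R = max R1 R2"
  have R: "norm y \<le> R" if "g y \<noteq> 0 \<or> G y \<noteq> 0" for y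
    using R1[of y] R2[of y] that by (auto simp: R_def)
  obtain a where a: "cball 0 (R + norm x0 + 1) \<subseteq> cbox (-a) (a::'a)"
    using bounded_subset_cbox_symmetric bounded_cball by metis
  let ?B = "cbox (-a) a"
  have sub: "y \<in> ?B" if "g (y - x) \<noteq> 0 \<or> G (y - x) \<noteq> 0" "x \<in> ball x0 1" for x y
  proof -
    have "norm y \<le> R + norm x0 + 1"
      using R[OF that(1)] norm_triangle_sub[of y x] norm_triangle_sub[of x x0] \<open>x \<in> ball x0 1\<close>
      by (simp add: dist_norm norm_minus_commute)
    then show ?thesis using a by auto
  qed
  have eq: "(\<integral>y. k y * g (y - x) \<partial>lborel) = integral ?B (\<lambda>y. k y * g (y - x))"
    if "x \<in> ball x0 1" for x
    using sub that
    by (intro integral_lborel_eq_integral_cbox continuous_intros k continuous_on_compose2[OF cg]) auto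
  \<comment> \<open>The Leibniz rule expects the derivative as a bounded linear map; its integral is
    evaluated at a vector \<open>h\<close> afterwards.\<close>
  let ?f = "\<lambda>x y. (- k y) *\<^sub>R blinfun_inner_right (G (y - x))"
  have D: "((\<lambda>x. integral ?B (\<lambda>y. k y * g (y - x))) has_derivative integral ?B (?f x0))
      (at x0 within ball x0 1)"
  proof (rule leibniz_rule)
    show "((\<lambda>x. k y * g (y - x)) has_derivative blinfun_apply (?f x y)) (at x within ball x0 1)" for x y
    proof -
      have "((\<lambda>x. g (y - x)) has_derivative (\<lambda>h. G (y - x) \<bullet> (- h))) (at x within ball x0 1)"
        by (rule has_derivative_compose[OF _ g]) (auto intro!: derivative_eq_intros)
      then show ?thesis
        by (auto intro!: derivative_eq_intros
            simp: scaleR_blinfun.rep_eq uminus_blinfun.rep_eq fun_eq_iff)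
    qed
    show "(\<lambda>y. k y * g (y - x)) integrable_on ?B" for x
      by (intro integrable_continuous continuous_intros continuous_on_subset[OF k]
          continuous_on_compose2[OF cg]) auto
    show "continuous_on (ball x0 1 \<times> ?B) (\<lambda>(x, y). ?f x y)"
      unfolding split_beta
      by (intro continuous_intros bounded_linear.continuous_on[OF bounded_linear_blinfun_inner_right]
          continuous_on_compose2[OF k] continuous_on_compose2[OF G]) auto
  qed auto
  have cont: "continuous_on ?B (?f x0)"
    by (intro continuous_intros bounded_linear.continuous_on[OF bounded_linear_blinfun_inner_right]
          continuous_on_subset[OF k] continuous_on_compose2[OF G]) auto
  have "blinfun_apply (integral ?B (?f x0)) h = (- (\<integral>y. k y *\<^sub>R G (y - x0) \<partial>lborel)) \<bullet> h" for h
  proof -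
    have "blinfun_apply (integral ?B (?f x0)) h = integral ?B ((\<lambda>F. blinfun_apply F h) \<circ> (?f x0))"
      by (intro integral_linear[symmetric] integrable_continuous cont) (auto intro!: bounded_linear_intros)
    also have "\<dots> = integral ?B ((\<lambda>w. (- w) \<bullet> h) \<circ> (\<lambda>y. k y *\<^sub>R G (y - x0)))"
      by (intro arg_cong[where f="integral ?B"] ext)
         (simp add: o_def scaleR_blinfun.rep_eq uminus_blinfun.rep_eq)
    also have "\<dots> = (- integral ?B (\<lambda>y. k y *\<^sub>R G (y - x0))) \<bullet> h"
    proof (rule integral_linear)
      show "(\<lambda>y. k y *\<^sub>R G (y - x0)) integrable_on ?B"
        by (intro integrable_continuous continuous_intros continuous_on_subset[OF k]
            continuous_on_compose2[OF G]) auto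
      show "bounded_linear (\<lambda>w. - w \<bullet> h)"
        by (intro bounded_linear_intros bounded_linear_minus bounded_linear_ident)
    qed
    also have "integral ?B (\<lambda>y. k y *\<^sub>R G (y - x0)) = (\<integral>y. k y *\<^sub>R G (y - x0) \<partial>lborel)"
      using sub[of _ x0]
      by (intro integral_lborel_eq_integral_cbox[symmetric] continuous_intros k continuous_on_compose2[OF G]) auto
    finally show ?thesis .
  qed
  then have "blinfun_apply (integral ?B (?f x0)) = (\<lambda>h. (- (\<integral>y. k y *\<^sub>R G (y - x0) \<partial>lborel)) \<bullet> h)"
    by auto
  moreover have "at x0 within ball x0 1 = at x0"
    by (rule at_within_open) auto
  ultimately have "((\<lambda>x. integral ?B (\<lambda>y. k y * g (y - x))) has_derivative
      (\<lambda>h. (- (\<integral>y. k y *\<^sub>R G (y - x0) \<partial>lborel)) \<bullet> h)) (at x0)"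
    using D by simp
  then show ?thesis
    by (rule has_derivative_transform_within_open[of _ _ _ _ "ball x0 1"]) (auto simp: eq)
qed

text \<open>Convolving \<open>g\<close> with the constant 1 gives a constant, by translation
  invariance of Lebesgue measure; the derivative of this constant is minus the integral of
  \<open>G\<close>. The divergence theorem below rests on this.\<close>

lemma integral_gradient_zero:
  fixes g :: "'a::euclidean_space \<Rightarrow> real"
  assumes g: "\<And>y. (g has_derivative (\<lambda>h. G y \<bullet> h)) (at y)"
    and G: "continuous_on UNIV G" and b: "bounded {y. g y \<noteq> 0}"
  shows "(\<integral>y. G y \<partial>lborel) = 0"
proof -
  have "continuous_on UNIV g"
    using g by (auto intro!: has_derivative_continuous_on[of _ _ "\<lambda>y h. G y \<bullet> h"])
  then have m: "g \<in> borel_measurable borel"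
    by (rule borel_measurable_continuous_onI)
  have "((\<lambda>x. \<integral>y. 1 * g (y - x) \<partial>lborel) has_derivative
          (\<lambda>h. (- (\<integral>y. 1 *\<^sub>R G (y - 0) \<partial>lborel)) \<bullet> h)) (at 0)"
    by (rule convolution_has_derivative[OF _ g G b]) auto
  moreover have "(\<integral>y. g (y - x) \<partial>lborel) = (\<integral>y. g y \<partial>lborel)" for x
    using lborel_integral_translate[OF m, of "-x"] by simp
  ultimately have "((\<lambda>x. \<integral>y. g y \<partial>lborel) has_derivative
          (\<lambda>h. (- (\<integral>y. G y \<partial>lborel)) \<bullet> h)) (at 0)"
    by simp
  then have "(\<lambda>h. (- (\<integral>y. G y \<partial>lborel)) \<bullet> h) = (\<lambda>h. 0)"
    by (rule has_derivative_unique) auto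
  then have "(- (\<integral>y. G y \<partial>lborel)) \<bullet> (\<integral>y. G y \<partial>lborel) = 0"
    by metis
  then show ?thesis by simp
qed

section \<open>Smooth functions and mollifiers\<close>

lemma partial_deriv_eqI:
  fixes G :: "real ^ 'n"
  assumes "(f has_derivative (\<lambda>h. G \<bullet> h)) (at x)"
  shows "partial_deriv i f x = G $ i"
  unfolding partial_deriv_def frechet_derivative_at[OF assms, symmetric]
  by (simp add: inner_axis)

lemma gradient_eqI:
  fixes G :: "real ^ 'n"
  assumes "(f has_derivative (\<lambda>h. G \<bullet> h)) (at x)"
  shows "gradient f x = G"
  by (simp add: gradient_def partial_deriv_eqI[OF assms] vec_eq_iff)

lemma has_derivative_gradient:
  fixes f :: "real ^ 'n \<Rightarrow> real"
  assumes "f differentiable (at x)"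
  shows "(f has_derivative (\<lambda>h. gradient f x \<bullet> h)) (at x)"
proof -
  have D: "(f has_derivative frechet_derivative f (at x)) (at x)"
    using assms by (simp only: frechet_derivative_works)
  then have lin: "linear (frechet_derivative f (at x))"
    by (rule has_derivative_linear)
  have "frechet_derivative f (at x) h = gradient f x \<bullet> h" for h
  proof -
    have "frechet_derivative f (at x) h = frechet_derivative f (at x) (\<Sum>i\<in>UNIV. h $ i *\<^sub>R axis i 1)"
      by (simp add: basis_expansion flip: scalar_mult_eq_scaleR)
    also have "\<dots> = (\<Sum>i\<in>UNIV. h $ i * frechet_derivative f (at x) (axis i 1))"
      by (simp add: linear_sum[OF lin] linear_scale[OF lin])
    also have "\<dots> = gradient f x \<bullet> h"
      by (simp add: gradient_def partial_deriv_def inner_vec_def mult.commute)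
    finally show ?thesis .
  qed
  then have "frechet_derivative f (at x) = (\<lambda>h. gradient f x \<bullet> h)" by auto
  with D show ?thesis by simp
qed

lemma Ck_continuous: "Ck k f \<Longrightarrow> continuous_on UNIV f"
  by (cases k) (auto intro: differentiable_imp_continuous_on)

lemma Ck_Suc_has_derivative:
  "Ck (Suc k) f \<Longrightarrow> (f has_derivative (\<lambda>h. gradient f x \<bullet> h)) (at x)"
  by (rule has_derivative_gradient) (simp add: differentiable_on_def)

lemma Ck_Suc_continuous_gradient: "Ck (Suc k) f \<Longrightarrow> continuous_on UNIV (gradient f)"
  unfolding gradient_def[abs_def]
  by (intro continuous_on_vec_lambda) (use Ck_continuous in auto)

lemma partial_deriv_affine:
  fixes f :: "real ^ 'n \<Rightarrow> real"
  assumes "f differentiable_on UNIV"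
  shows "((\<lambda>y. c * f (a *\<^sub>R (y - x))) has_derivative (\<lambda>h. ((c * a) *\<^sub>R gradient f (a *\<^sub>R (y - x))) \<bullet> h)) (at y)"
    and "partial_deriv i (\<lambda>y. c * f (a *\<^sub>R (y - x))) = (\<lambda>y. (c * a) * partial_deriv i f (a *\<^sub>R (y - x)))"
proof -
  show D: "((\<lambda>y. c * f (a *\<^sub>R (y - x))) has_derivative (\<lambda>h. ((c * a) *\<^sub>R gradient f (a *\<^sub>R (y - x))) \<bullet> h)) (at y)" for y
  proof -
    have "((\<lambda>y. f (a *\<^sub>R (y - x))) has_derivative (\<lambda>h. gradient f (a *\<^sub>R (y - x)) \<bullet> (a *\<^sub>R h))) (at y)"
      by (rule has_derivative_compose[OF _ has_derivative_gradient])
         (use assms in \<open>auto intro!: derivative_eq_intros simp: differentiable_on_def\<close>)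
    then show ?thesis
      by (auto intro!: derivative_eq_intros simp: fun_eq_iff algebra_simps)
  qed
  show "partial_deriv i (\<lambda>y. c * f (a *\<^sub>R (y - x))) = (\<lambda>y. (c * a) * partial_deriv i f (a *\<^sub>R (y - x)))"
    by (rule ext) (simp add: partial_deriv_eqI[OF D] gradient_def)
qed

lemma Ck_affine: "Ck k f \<Longrightarrow> Ck k (\<lambda>y. c * f (a *\<^sub>R (y - x)))"
proof (induction k arbitrary: f c)
  case 0
  then show ?case
    by (auto intro!: continuous_intros continuous_on_compose2[of UNIV f])
next
  case (Suc k)
  then have d: "f differentiable_on UNIV" by simp
  show ?case
    unfolding Ck.simps partial_deriv_affine(2)[OF d]
    using partial_deriv_affine(1)[OF d, of c a x] Suc
    by (auto simp: differentiable_on_def differentiable_def)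
qed

text \<open>For m = 0 this is the classical function exp(-1/t), extended by 0. The powers in the
  denominator are there because differentiation produces them: the derivative of
  \<open>flat m\<close> is a combination of \<open>flat (m + 2)\<close> and
  \<open>flat (m + 1)\<close>.\<close>

definition flat :: "nat \<Rightarrow> real \<Rightarrow> real" where
  "flat m t = (if t > 0 then exp (- (1 / t)) / t ^ m else 0)"

lemma flat_tendsto_0: "((\<lambda>t. flat m t) \<longlongrightarrow> 0) (at_right 0)"
proof -
  have "((\<lambda>t. inverse t ^ m / exp (inverse t)) \<longlongrightarrow> 0) (at_right (0::real))"
    by (rule filterlim_compose[OF tendsto_power_div_exp_0 filterlim_inverse_at_top_right])
  then show ?thesis
    by (rule Lim_transform_eventually)
       (auto simp: flat_def eventually_at_right_less exp_minus field_simps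
         intro!: eventually_mono[OF eventually_at_right_less[of 0]])
qed

lemma flat_has_real_derivative:
  "(flat m has_real_derivative flat (m + 2) t - real m * flat (m + 1) t) (at t)"
proof -
  consider "t > 0" | "t < 0" | "t = 0" by linarith
  then show ?thesis
  proof cases
    case 1
    have "((\<lambda>t. exp (- (1 / t)) / t ^ m) has_real_derivative
        flat (m + 2) t - real m * flat (m + 1) t) (at t)"
    proof (cases m)
      case (Suc k)
      then show ?thesis
        using 1 by (auto intro!: derivative_eq_intros simp: flat_def field_simps power2_eq_square;
            metis power_eq_if One_nat_def)
    qed (use 1 in \<open>auto intro!: derivative_eq_intros simp: flat_def field_simps power2_eq_square\<close>)
    then show ?thesis
      by (rule has_field_derivative_transform_within_open[of _ _ _ "{0<..}"]) (use 1 in \<open>auto simp: flat_def\<close>)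
  next
    case 2
    have "((\<lambda>t. 0) has_real_derivative flat (m + 2) t - real m * flat (m + 1) t) (at t)"
      using 2 by (auto simp: flat_def)
    then show ?thesis
      by (rule has_field_derivative_transform_within_open[of _ _ _ "{..<0}"]) (use 2 in \<open>auto simp: flat_def\<close>)
  next
    case 3
    \<comment> \<open>To the right of 0 the difference quotient is \<open>flat (Suc m) h\<close>; to
      the left it vanishes.\<close>
    have "((\<lambda>h. flat m h / h) \<longlongrightarrow> 0) (at_right 0)"
      by (rule Lim_transform_eventually[OF flat_tendsto_0[of "Suc m"]])
         (auto simp: flat_def intro!: eventually_mono[OF eventually_at_right_less[of 0]])
    moreover have "((\<lambda>h. flat m h / h) \<longlongrightarrow> 0) (at_left 0)"
      by (rule Lim_transform_eventually[OF tendsto_const])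
         (auto simp: flat_def eventually_at_filter)
    ultimately have "((\<lambda>h. flat m h / h) \<longlongrightarrow> 0) (at 0)"
      by (simp add: filterlim_split_at)
    then show ?thesis
      using 3 by (simp add: DERIV_def flat_def)
  qed
qed

text \<open>A class that contains the bump \<open>flat 0 (1 - x \<bullet> x)\<close> and is closed
  under partial derivatives, so that membership gives every \<open>Ck k\<close> by one induction.
  Coordinates are generators because the chain rule produces the factor -2 x.\<close>

inductive flat_algebra :: "(real ^ 'n \<Rightarrow> real) \<Rightarrow> bool" where
  const: "flat_algebra (\<lambda>_. c)"
| coord: "flat_algebra (\<lambda>x. x $ i)"
| flat: "flat_algebra (\<lambda>x. flat m (1 - x \<bullet> x))"
| add: "flat_algebra f \<Longrightarrow> flat_algebra g \<Longrightarrow> flat_algebra (\<lambda>x. f x + g x)"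
| mult: "flat_algebra f \<Longrightarrow> flat_algebra g \<Longrightarrow> flat_algebra (\<lambda>x. f x * g x)"

lemma flat_algebra_gradient:
  assumes "flat_algebra (f :: real ^ 'n \<Rightarrow> real)"
  shows "\<exists>G. (\<forall>x. (f has_derivative (\<lambda>h. G x \<bullet> h)) (at x)) \<and> (\<forall>i. flat_algebra (\<lambda>x. G x $ i))"
  using assms
proof induction
  case (const c)
  have "\<forall>x. ((\<lambda>_. c) has_derivative (\<lambda>h. 0 \<bullet> h)) (at x)" by simp
  moreover have "\<forall>i. flat_algebra (\<lambda>x. (0::real^'n) $ i)" by (simp add: flat_algebra.const)
  ultimately show ?case by (intro exI[of _ "\<lambda>_. 0"]) auto
next
  case (coord j)
  have "\<forall>x. ((\<lambda>x. x $ j) has_derivative (\<lambda>h. axis j 1 \<bullet> h)) (at x)"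
    by (auto intro!: bounded_linear_imp_has_derivative bounded_linear_vec_nth simp: inner_axis')
  moreover have "\<forall>i. flat_algebra (\<lambda>x. (axis j 1::real^'n) $ i)" by (simp add: flat_algebra.const)
  ultimately show ?case by (intro exI[of _ "\<lambda>_. axis j 1"]) auto
next
  case (flat m)
  let ?G = "\<lambda>x::real^'n. ((flat (m + 2) (1 - x \<bullet> x) + (- real m) * flat (m + 1) (1 - x \<bullet> x)) * (- 2)) *\<^sub>R x"
  have "((\<lambda>x. flat m (1 - x \<bullet> x)) has_derivative (\<lambda>h. ?G x \<bullet> h)) (at x)" for x :: "real^'n"
  proof -
    have "((\<lambda>x. 1 - x \<bullet> x) has_derivative (\<lambda>h. - 2 * (x \<bullet> h))) (at x)"
      by (auto intro!: derivative_eq_intros simp: inner_commute)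
    from has_derivative_compose[OF this flat_has_real_derivative[of m "1 - x \<bullet> x", unfolded has_field_derivative_def]]
    show ?thesis by (simp add: algebra_simps)
  qed
  moreover have "flat_algebra (\<lambda>x. ?G x $ i)" for i
    by (simp only: vector_scaleR_component real_scaleR_def) (intro flat_algebra.intros)
  ultimately show ?case by (intro exI[of _ ?G]) auto
next
  case (add f g)
  then obtain F G where "\<forall>x. (f has_derivative (\<lambda>h. F x \<bullet> h)) (at x)" "\<forall>i. flat_algebra (\<lambda>x. F x $ i)"
    "\<forall>x. (g has_derivative (\<lambda>h. G x \<bullet> h)) (at x)" "\<forall>i. flat_algebra (\<lambda>x. G x $ i)" by blast
  then show ?case
    by (intro exI[of _ "\<lambda>x. F x + G x"])
       (auto intro!: flat_algebra.intros derivative_eq_intros simp: inner_add_left)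
next
  case (mult f g)
  then obtain F G where "\<forall>x. (f has_derivative (\<lambda>h. F x \<bullet> h)) (at x)" "\<forall>i. flat_algebra (\<lambda>x. F x $ i)"
    "\<forall>x. (g has_derivative (\<lambda>h. G x \<bullet> h)) (at x)" "\<forall>i. flat_algebra (\<lambda>x. G x $ i)" by blast
  with mult show ?case
    by (intro exI[of _ "\<lambda>x. f x *\<^sub>R G x + g x *\<^sub>R F x"])
       (auto intro!: flat_algebra.intros derivative_eq_intros simp: inner_add_left fun_eq_iff)
qed

lemma Ck_flat_algebra: "flat_algebra f \<Longrightarrow> Ck k f"
proof (induction k arbitrary: f)
  case 0
  obtain G where "\<forall>x. (f has_derivative (\<lambda>h. G x \<bullet> h)) (at x)"
    using flat_algebra_gradient[OF 0] by blast
  then show ?case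
    by (auto intro!: has_derivative_continuous_on[of _ _ "\<lambda>x h. G x \<bullet> h"])
next
  case (Suc k)
  obtain G where G: "\<And>x. (f has_derivative (\<lambda>h. G x \<bullet> h)) (at x)" "\<And>i. flat_algebra (\<lambda>x. G x $ i)"
    using flat_algebra_gradient[OF Suc.prems] by blast
  have "partial_deriv i f = (\<lambda>x. G x $ i)" for i
    using partial_deriv_eqI[OF G(1)] by auto
  then show ?case
    using Suc.IH[OF G(2)] G(1) by (auto simp: differentiable_on_def differentiable_def)
qed

section \<open>Mollifiers and their scaled copies\<close>

lemma mollifier_exists:
  "\<exists>\<rho> :: real ^ 'n \<Rightarrow> real. (\<forall>k. Ck k \<rho>) \<and> (\<forall>z. 0 \<le> \<rho> z) \<and> {z. \<rho> z \<noteq> 0} \<subseteq> ball 0 1 \<and>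
     (\<integral>z. \<rho> z \<partial>lborel) = 1"
proof -
  define r where "r = (\<lambda>x::real^'n. flat 0 (1 - x \<bullet> x))"
  have k: "Ck k r" for k
    unfolding r_def by (intro Ck_flat_algebra flat_algebra.flat)
  have nn: "0 \<le> r z" for z by (simp add: r_def flat_def)
  have s: "r z \<noteq> 0 \<longleftrightarrow> z \<in> ball 0 1" for z
    by (simp add: r_def flat_def dot_square_norm power2_eq_1_iff abs_square_less_1)
  have cont: "continuous_on UNIV r" by (rule Ck_continuous[OF k])
  have i: "integrable lborel r"
    using s by (intro integrable_continuous_bounded_support cont) (simp only: Collect_mem_eq bounded_ball)
  \<comment> \<open>A zero integral would make the non-negative \<open>r\<close> vanish almost
    everywhere; but \<open>r\<close> is nonzero exactly on the open unit ball, which is not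
    negligible.\<close>
  have "(\<integral>z. r z \<partial>lborel) > 0"
  proof (rule ccontr)
    assume "\<not> ?thesis"
    then have "(\<integral>z. r z \<partial>lborel) = 0"
      using Bochner_Integration.integral_nonneg[of lborel r] nn by (auto simp: not_less intro: antisym)
    then have "AE z in lborel. r z = 0"
      using integral_nonneg_eq_0_iff_AE[OF i] nn by simp
    then have "AE z in lborel. z \<notin> ball (0::real^'n) 1"
      by (simp only: s[symmetric] not_not)
    moreover have "{z. \<not> z \<notin> ball (0::real^'n) 1} = ball 0 1" by auto
    ultimately have "emeasure lborel (ball (0::real^'n) 1) = 0"
      using AE_iff_measurable[of "ball 0 1" lborel "\<lambda>z. z \<notin> ball (0::real^'n) 1"] by simp
    then have "negligible (ball (0::real^'n) 1)"
      by (simp add: negligible_iff_emeasure0)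
    then have "ball (0::real^'n) 1 = {}"
      using open_not_negligible by blast
    then show False by simp
  qed
  then obtain I where I: "I > 0" "(\<integral>z. r z \<partial>lborel) = I" by blast
  have "Ck k (\<lambda>z. (1 / I) * r z)" for k
    using Ck_affine[OF k, of k "1 / I" 1 0] by simp
  moreover have "{z. (1 / I) * r z \<noteq> 0} \<subseteq> ball 0 1"
    using s by auto
  ultimately show ?thesis
    using I nn by (intro exI[of _ "\<lambda>z. (1 / I) * r z"]) auto
qed

lemma bounded_continuous_bounded_support:
  fixes f :: "'a::euclidean_space \<Rightarrow> 'b::real_normed_vector"
  assumes "continuous_on UNIV f" "bounded {x. f x \<noteq> 0}"
  shows "\<exists>L>0. \<forall>x. norm (f x) \<le> L"
proof -
  have "compact (f ` closure {x. f x \<noteq> 0})"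
    using assms by (intro compact_continuous_image) (auto intro: continuous_on_subset)
  then obtain L where "L > 0" "\<And>x. x \<in> closure {x. f x \<noteq> 0} \<Longrightarrow> norm (f x) \<le> L"
    using bounded_pos[of "f ` closure {x. f x \<noteq> 0}"] by (auto dest: compact_imp_bounded)
  then show ?thesis
    using closure_subset[of "{x. f x \<noteq> 0}"] by (intro exI[of _ L]) (metis (mono_tags) less_imp_le mem_Collect_eq norm_zero subsetD)
qed

text \<open>\<open>L\<close> does not depend on \<eta>. The exponent n + 1 collects n from
  normalising the mass and 1 from the chain rule; the eikonal estimate relies on exactly this
  rate.\<close>

lemma scaled_mollifier_exists:
  "\<exists>L>0. \<forall>\<eta>>0. \<exists>\<kappa> :: real ^ 'n \<Rightarrow> real. (\<forall>k. Ck k \<kappa>) \<and> (\<forall>z. 0 \<le> \<kappa> z) \<and> {z. \<kappa> z \<noteq> 0} \<subseteq> ball 0 \<eta> \<and>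
     (\<integral>z. \<kappa> z \<partial>lborel) = 1 \<and> (\<forall>z. norm (gradient \<kappa> z) \<le> L / \<eta> ^ (CARD('n) + 1))"
proof -
  obtain \<rho> :: "real ^ 'n \<Rightarrow> real" where \<rho>: "\<And>k. Ck k \<rho>" "\<And>z. 0 \<le> \<rho> z" "{z. \<rho> z \<noteq> 0} \<subseteq> ball 0 1"
    "(\<integral>z. \<rho> z \<partial>lborel) = 1"
    using mollifier_exists by blast
  have diff: "\<rho> differentiable_on UNIV" using \<rho>(1)[of 1] by simp
  have b: "bounded {z. \<rho> z \<noteq> 0}" using \<rho>(3) bounded_subset[OF bounded_ball] by blast
  have "bounded {z. gradient \<rho> z \<noteq> 0}"
    using gradient_support_subset[OF Ck_Suc_has_derivative[OF \<rho>(1)]] b by (meson bounded_closure bounded_subset)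
  then obtain L where L: "L > 0" "\<And>z. norm (gradient \<rho> z) \<le> L"
    using bounded_continuous_bounded_support[OF Ck_Suc_continuous_gradient[OF \<rho>(1)]] by blast
  show ?thesis
  proof (rule exI[of _ L], intro conjI L(1) allI impI)
    fix \<eta> :: real assume \<eta>: "\<eta> > 0"
    let ?n = "CARD('n)"
    define \<kappa> where "\<kappa> = (\<lambda>y. (1 / \<eta> ^ ?n) * \<rho> ((1 / \<eta>) *\<^sub>R (y - 0)))"
    have "Ck k \<kappa>" for k unfolding \<kappa>_def by (rule Ck_affine[OF \<rho>(1)])
    moreover have "0 \<le> \<kappa> z" for z using \<rho>(2) \<eta> by (simp add: \<kappa>_def)
    moreover have "{z. \<kappa> z \<noteq> 0} \<subseteq> ball 0 \<eta>"
    proof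
      fix z assume "z \<in> {z. \<kappa> z \<noteq> 0}"
      then have "(1 / \<eta>) *\<^sub>R z \<in> ball 0 1" using \<rho>(3) by (auto simp: \<kappa>_def)
      then show "z \<in> ball 0 \<eta>" using \<eta> by (simp add: field_simps)
    qed
    moreover have "(\<integral>z. \<kappa> z \<partial>lborel) = 1"
    proof -
      have "\<kappa> \<in> borel_measurable borel"
        using Ck_continuous[OF \<open>Ck 0 \<kappa>\<close>] by (rule borel_measurable_continuous_onI)
      then have "(\<integral>z. \<kappa> z \<partial>lborel) = \<eta> ^ ?n *\<^sub>R (\<integral>z. \<kappa> (0 + \<eta> *\<^sub>R z) \<partial>lborel)"
        using lborel_integral_affine[OF _ \<eta>, of \<kappa> 0] by simp
      also have "\<dots> = 1"
        using \<eta> \<rho>(4) by (simp add: \<kappa>_def)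
      finally show ?thesis .
    qed
    moreover have "norm (gradient \<kappa> z) \<le> L / \<eta> ^ (?n + 1)" for z
    proof -
      have "gradient \<kappa> z = (1 / \<eta> ^ ?n * (1 / \<eta>)) *\<^sub>R gradient \<rho> ((1 / \<eta>) *\<^sub>R (z - 0))"
        unfolding \<kappa>_def by (rule gradient_eqI[OF partial_deriv_affine(1)[OF diff]])
      then show ?thesis
        using L(2)[of "(1 / \<eta>) *\<^sub>R (z - 0)"] \<eta> by (simp add: field_simps)
    qed
    ultimately show "\<exists>\<kappa> :: real ^ 'n \<Rightarrow> real. (\<forall>k. Ck k \<kappa>) \<and> (\<forall>z. 0 \<le> \<kappa> z) \<and> {z. \<kappa> z \<noteq> 0} \<subseteq> ball 0 \<eta> \<and>
     (\<integral>z. \<kappa> z \<partial>lborel) = 1 \<and> (\<forall>z. norm (gradient \<kappa> z) \<le> L / \<eta> ^ (?n + 1))"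
      by blast
  qed
qed

section \<open>The pointwise inequality\<close>

text \<open>This is the tangent inequality a^p \<ge> b^p + p b^(p-1) (a - b) of a convex function,
  rearranged. It serves Hardy's inequality, Bernoulli's inequality and Jensen's inequality
  alike.\<close>

lemma young_powr:
  fixes p :: real
  assumes p: "p > 1" and "a \<ge> 0" "b \<ge> 0"
  shows "p * a * b powr (p - 1) \<le> a powr p + (p - 1) * b powr p"
proof -
  have "a * b powr (p - 1) \<le> a powr p / p + (b powr (p - 1)) powr (p / (p - 1)) / (p / (p - 1))"
    using assms by (intro Youngs_inequality) (auto simp: field_simps)
  also have "(b powr (p - 1)) powr (p / (p - 1)) = b powr p"
    using p by (simp add: powr_powr)
  finally have "p * (a * b powr (p - 1)) \<le> p * (a powr p / p + b powr p / (p / (p - 1)))"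
    using p by (intro mult_left_mono) auto
  also have "\<dots> = a powr p + (p - 1) * b powr p"
    using p by (simp add: field_simps)
  finally show ?thesis by (simp add: mult.assoc)
qed

text \<open>Bernoulli gives (1 + x)^r \<ge> 1 + r x, and (1 - x)^r (1 + x)^r \<le> 1. Hence, with y
  = r x, the left side is at most 1/(1 + y), and (1 - y + y^2)(1 + y) = 1 + y^3 \<ge> 1.\<close>

lemma one_minus_powr_le_quadratic:
  fixes r x :: real
  assumes r: "r \<ge> 1" and x: "0 \<le> x" "x < 1"
  shows "(1 - x) powr r \<le> 1 - r * x + r\<^sup>2 * x\<^sup>2"
proof -
  have bernoulli: "1 + r * x \<le> (1 + x) powr r"
    using young_powr[of r "1 + x" 1] r x by (cases "r = 1") (auto simp: algebra_simps)
  have "(1 - x) powr r * (1 + x) powr r = (1 - x\<^sup>2) powr r"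
    using x by (simp add: powr_mult[symmetric] power2_eq_square algebra_simps)
  also have "\<dots> \<le> 1"
    using x r by (intro powr_le1) (auto simp: power2_eq_square mult_le_one)
  finally have "(1 - x) powr r * (1 + r * x) \<le> 1"
    using mult_left_mono[OF bernoulli, of "(1 - x) powr r"] by simp
  also have "1 \<le> (1 - r * x + r\<^sup>2 * x\<^sup>2) * (1 + r * x)"
  proof -
    have "0 \<le> (r * x) ^ 3" using r x by simp
    then show ?thesis by (simp add: power3_eq_cube power2_eq_square algebra_simps)
  qed
  finally show ?thesis
    using r x by (meson add_pos_nonneg mult_le_cancel_right_pos mult_nonneg_nonneg order_trans zero_le_one zero_less_one)
qed

text \<open>The weight \<open>(1 - a s) powr \<mu>\<close> put on the gradient is chosen so that the first-order loss in
  \<open>s\<close> from Young's inequality is at most half of the gain \<open>a \<epsilon> s\<close>, because \<open>\<mu>\<close> is small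
  compared with \<open>\<epsilon>\<close>.\<close>

lemma weighted_hardy_pointwise:
  fixes p \<epsilon> :: real
  assumes p: "p > 1" and \<epsilon>: "\<epsilon> > 0"
  defines "H \<equiv> (p - 1) / p"
  shows "\<exists>a c. 0 < a \<and> a < 1 \<and> 0 < c \<and> (\<forall>s V g. 0 \<le> s \<longrightarrow> s \<le> 1 \<longrightarrow> 0 \<le> V \<longrightarrow> 0 \<le> g \<longrightarrow>
    p * H powr (p - 1) * (1 - a * s) * V powr (p - 1) * g + (H powr p + c * s) * V powr p + c * s * g powr p
    \<le> g powr p + H powr (p - 1) * ((p - 1) * (1 - a * s) + a * \<epsilon> * s) * V powr p)"
proof -
  define \<mu> where "\<mu> = min 1 (\<epsilon> / 2)"
  define r where "r = (p - \<mu>) / (p - 1)"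
  \<comment> \<open>The gain \<open>a * \<epsilon> * s\<close> is divided up: at most one half pays
    for \<mu>, the second bound on \<open>a\<close> keeps the quadratic error below one quarter, and
    the last quarter, times \<open>K\<close>, bounds \<open>c\<close>.\<close>
  define a where "a = min (1 / 2) (\<epsilon> / (4 * ((p - 1) * H * r\<^sup>2)))"
  define K where "K = H powr (p - 1)"
  define c where "c = min (\<mu> * a) (K * (a * \<epsilon> / 4))"
  have H: "0 < H" "H < 1" using p by (auto simp: H_def field_simps)
  have \<mu>: "0 < \<mu>" "\<mu> \<le> 1" "\<mu> \<le> \<epsilon> / 2" using \<epsilon> by (auto simp: \<mu>_def)
  have r: "1 \<le> r" using p \<mu> by (auto simp: r_def field_simps)
  have K: "K > 0" using H by (simp add: K_def)
  have q: "0 < (p - 1) * H * r\<^sup>2" using p H r by simp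
  then have a: "0 < a" "a \<le> 1 / 2" using \<epsilon> by (auto simp: a_def)
  have "a \<le> \<epsilon> / (4 * ((p - 1) * H * r\<^sup>2))" by (simp add: a_def)
  then have aq: "(p - 1) * H * r\<^sup>2 * a \<le> \<epsilon> / 4" using q by (simp add: field_simps)
  have c: "0 < c" "c \<le> \<mu> * a" "c \<le> K * (a * \<epsilon> / 4)" using \<mu> a K \<epsilon> by (auto simp: c_def)
  have HK: "H powr p = H * K"
    using H by (simp add: K_def powr_diff)
  have main: "p * K * (1 - a * s) * V powr (p - 1) * g + (H powr p + c * s) * V powr p + c * s * g powr p
    \<le> g powr p + K * ((p - 1) * (1 - a * s) + a * \<epsilon> * s) * V powr p"
    if s: "0 \<le> s" "s \<le> 1" and V: "0 \<le> V" and g: "0 \<le> g" for s V g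
  proof -
    define k where "k = 1 - a * s"
    have as: "0 \<le> a * s" "a * s \<le> 1 / 2"
      using a s mult_mono[of a "1/2" s 1] by auto
    have k: "0 < k" using as by (simp add: k_def)
    \<comment> \<open>The factor k is shared between the arguments of Young's inequality as
      k^(\<mu>/p) and k^(1 - \<mu>/p). With this \<open>e\<close> the (p-1)-th power of the second
      argument carries the latter, and its p-th power carries k^r.\<close>
    define e where "e = (1 - \<mu> / p) / (p - 1)"
    have e: "e * (p - 1) = 1 - \<mu> / p" "e * p = r"
      using p by (auto simp: e_def r_def field_simps)
    have "p * (k powr (\<mu> / p) * g) * (H * k powr e * V) powr (p - 1)
        \<le> (k powr (\<mu> / p) * g) powr p + (p - 1) * (H * k powr e * V) powr p"
      using k H V g by (intro young_powr p) auto
    also have "(k powr (\<mu> / p) * g) powr p = k powr \<mu> * g powr p"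
      using k g p by (simp add: powr_mult powr_powr)
    also have "(H * k powr e * V) powr p = H powr p * k powr r * V powr p"
      using k H V e by (simp add: powr_mult powr_powr)
    also have "(H * k powr e * V) powr (p - 1) = K * k powr (1 - \<mu> / p) * V powr (p - 1)"
      using k H V e by (simp add: powr_mult powr_powr K_def)
    also have "p * (k powr (\<mu> / p) * g) * (K * k powr (1 - \<mu> / p) * V powr (p - 1))
        = p * K * (k powr (\<mu> / p) * k powr (1 - \<mu> / p)) * V powr (p - 1) * g"
      by (simp add: algebra_simps)
    also have "k powr (\<mu> / p) * k powr (1 - \<mu> / p) = k"
      using k by (simp flip: powr_add)
    finally have Y: "p * K * k * V powr (p - 1) * g
        \<le> k powr \<mu> * g powr p + (p - 1) * (H powr p * k powr r * V powr p)" .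
    have "k powr \<mu> * 1 powr (1 - \<mu>) \<le> \<mu> * k + (1 - \<mu>) * 1"
      using k \<mu> by (intro Youngs_inequality_0) auto
    then have "k powr \<mu> \<le> 1 - \<mu> * a * s" by (simp add: k_def algebra_simps)
    also have "\<dots> \<le> 1 - c * s" using c s by (simp add: mult_right_mono)
    finally have 1: "k powr \<mu> * g powr p \<le> (1 - c * s) * g powr p"
      by (intro mult_right_mono) auto
    have "(p - 1) * (H powr p * k powr r) + H powr p + c * s \<le> K * ((p - 1) * k + a * \<epsilon> * s)"
    proof -
      have "k powr r \<le> 1 - r * (a * s) + r\<^sup>2 * (a * s)\<^sup>2"
        unfolding k_def using r as by (intro one_minus_powr_le_quadratic) auto
      then have "(p - 1) * H * k powr r \<le> (p - 1) * H * (1 - r * (a * s) + r\<^sup>2 * (a * s)\<^sup>2)"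
        using p H by (intro mult_left_mono) auto
      also have "\<dots> = (p - 1) * H - (p - 1) * H * r * (a * s) + ((p - 1) * H * r\<^sup>2 * a) * (a * s\<^sup>2)"
        by (simp add: algebra_simps power2_eq_square)
      also have "((p - 1) * H * r\<^sup>2 * a) * (a * s\<^sup>2) \<le> \<epsilon> / 4 * (a * s)"
        using aq a s p H \<epsilon> by (intro mult_mono) (auto simp: power2_eq_square mult_left_le)
      \<comment> \<open>Since p H = p - 1, the first-order term from Young's inequality reproduces
        (p-1) a s, which cancels the same loss on the right-hand side; only H \<mu> a s is left to
        pay.\<close>
      also have "(p - 1) * H * r * (a * s) = (p - 1) * (a * s) - H * \<mu> * (a * s)"
      proof -
        have "(p - 1) * H * r = (p - 1) - H * \<mu>"
          using p by (simp add: r_def H_def field_simps)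
        then have "(p - 1) * H * r * (a * s) = ((p - 1) - H * \<mu>) * (a * s)" by simp
        then show ?thesis by (simp only: left_diff_distrib)
      qed
      also have "H * \<mu> * (a * s) \<le> \<epsilon> / 2 * (a * s)"
        using mult_mono[of H 1 \<mu> "\<epsilon> / 2"] H \<mu> as by (intro mult_right_mono) auto
      finally have b1: "(p - 1) * H * k powr r \<le> (p - 1) * H - (p - 1) * (a * s) + \<epsilon> / 2 * (a * s) + \<epsilon> / 4 * (a * s)"
        by simp
      have "(p - 1) * H + H = p - 1" using p by (simp add: H_def field_simps)
      with b1 have "(p - 1) * H * k powr r + H + a * \<epsilon> / 4 * s \<le> (p - 1) * k + a * \<epsilon> * s"
        by (simp add: k_def algebra_simps)
      then have "K * ((p - 1) * H * k powr r + H + a * \<epsilon> / 4 * s) \<le> K * ((p - 1) * k + a * \<epsilon> * s)"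
        using K by simp
      moreover have "c * s \<le> K * (a * \<epsilon> / 4) * s" using c s by (intro mult_right_mono) auto
      ultimately show ?thesis by (simp add: HK algebra_simps)
    qed
    then have "((p - 1) * (H powr p * k powr r) + H powr p + c * s) * V powr p
        \<le> K * ((p - 1) * k + a * \<epsilon> * s) * V powr p"
      by (intro mult_right_mono) auto
    with Y 1 show ?thesis by (simp add: k_def[symmetric] algebra_simps)
  qed
  show ?thesis
    using a c main unfolding K_def by (intro exI[of _ a] exI[of _ c]) auto
qed

section \<open>The eikonal equation in the mean\<close>

text \<open>Compare with a nearest point y: the distance at x + h is at most N = |x + h - y|, and N
  \<le> (N^2 + d^2)/(2d) replaces the cone by a paraboloid that touches it where N = d. The unit
  vector is (x - y)/d. The bound holds also at points where the distance is not
  differentiable.\<close>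

lemma infdist_touching_paraboloid:
  fixes x :: "'a::euclidean_space"
  assumes S: "closed S" "S \<noteq> {}" and x: "infdist x S > 0"
  shows "\<exists>e. norm e = 1 \<and> (\<forall>h. infdist (x + h) S \<le> infdist x S + e \<bullet> h + (norm h)\<^sup>2 / (2 * infdist x S))"
proof -
  obtain y where y: "y \<in> S" "infdist x S = dist x y"
    using infdist_attains_inf[OF S] by blast
  define d where "d = infdist x S"
  have d: "d > 0" "norm (x - y) = d" using x y by (auto simp: d_def dist_norm)
  define e where "e = (1 / d) *\<^sub>R (x - y)"
  have e: "norm e = 1" "x - y = d *\<^sub>R e" using d by (auto simp: e_def)
  have "infdist (x + h) S \<le> d + e \<bullet> h + (norm h)\<^sup>2 / (2 * d)" for h
  proof -
    let ?N = "norm (x + h - y)"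
    have "infdist (x + h) S \<le> ?N"
      using infdist_le[OF y(1)] by (simp add: dist_norm)
    also have "?N \<le> (?N\<^sup>2 + d\<^sup>2) / (2 * d)"
      using d sum_squares_bound[of ?N d] by (simp add: field_simps power2_eq_square)
    also have "?N\<^sup>2 = d\<^sup>2 + 2 * d * (e \<bullet> h) + (norm h)\<^sup>2"
    proof -
      have "x + h - y = d *\<^sub>R e + h" using e(2) by (simp add: algebra_simps)
      then show ?thesis
        using e(1) by (simp only: power2_norm_eq_inner)
          (simp add: inner_add_left inner_add_right inner_commute norm_eq_1 algebra_simps power2_eq_square)
    qed
    also have "(d\<^sup>2 + 2 * d * (e \<bullet> h) + (norm h)\<^sup>2 + d\<^sup>2) / (2 * d) = d + e \<bullet> h + (norm h)\<^sup>2 / (2 * d)"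
      using d by (simp add: field_simps power2_eq_square)
    finally show ?thesis .
  qed
  then show ?thesis using e(1) unfolding d_def by blast
qed

section \<open>Small symmetric cubes and the mollified gradient\<close>

lemma norm_le_of_mem_symmetric_cube:
  fixes h :: "'a::euclidean_space"
  assumes "h \<in> cbox (- (\<eta> *\<^sub>R One)) (\<eta> *\<^sub>R One)"
  shows "norm h \<le> \<eta> * DIM('a)"
proof -
  have "norm h \<le> (\<Sum>b\<in>Basis. \<bar>h \<bullet> b\<bar>)" by (rule norm_le_l1)
  also have "\<dots> \<le> (\<Sum>b\<in>(Basis::'a set). \<eta>)"
    using assms by (intro sum_mono) (auto simp: mem_box abs_le_iff)
  finally show ?thesis by (simp add: mult.commute)
qed

lemma cball_subset_symmetric_cube:
  "cball 0 \<eta> \<subseteq> cbox (- (\<eta> *\<^sub>R One)) (\<eta> *\<^sub>R One :: 'a::euclidean_space)"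
proof
  fix h :: 'a assume "h \<in> cball 0 \<eta>"
  then have "\<bar>h \<bullet> b\<bar> \<le> \<eta>" if "b \<in> Basis" for b
    using Basis_le_norm[OF that, of h] by auto
  then show "h \<in> cbox (- (\<eta> *\<^sub>R One)) (\<eta> *\<^sub>R One)"
    by (auto simp: mem_box abs_le_iff) (metis minus_le_iff)
qed

text \<open>Cubes replace balls in the averages over h: they fit gauge integration, are symmetric
  under reflection and have an explicit volume. The price is the factor \<open>DIM('a)\<close> in
  the bound on |h|.\<close>

lemma content_symmetric_cube:
  "\<eta> \<ge> 0 \<Longrightarrow> measure lborel (cbox (- (\<eta> *\<^sub>R One)) (\<eta> *\<^sub>R One :: 'a::euclidean_space)) = (2 * \<eta>) ^ DIM('a)"
  by (subst content_cbox) (auto simp: inner_diff_left inner_minus_left)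

text \<open>The touching paraboloid from above and its error \<open>R \<ge> 0\<close>: the mollified gradient of the
  paraboloid is almost the unit vector \<open>e\<close>, and the error is paid for by the second difference
  quotients of the distance.\<close>

lemma mollified_infdist_gradient_lower_bound:
  fixes x :: "'a::euclidean_space" and \<eta> :: real
  assumes S: "closed S" "S \<noteq> {}" and x: "infdist x S > 0"
    and \<kappa>: "\<And>y. (\<kappa> has_derivative (\<lambda>h. G y \<bullet> h)) (at y)" and G: "continuous_on UNIV G"
    and supp: "{z. \<kappa> z \<noteq> 0} \<subseteq> ball 0 \<eta>" and pos: "\<And>z. 0 \<le> \<kappa> z" and int: "(\<integral>z. \<kappa> z \<partial>lborel) = 1"
    and \<Lambda>: "\<And>z. norm (G z) \<le> \<Lambda>" and \<eta>: "\<eta> > 0"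
  shows "1 - norm (\<integral>y. infdist y S *\<^sub>R G (y - x) \<partial>lborel)
    \<le> \<eta> / infdist x S
      + \<Lambda> / 2 * (2 ^ DIM('a) * (DIM('a))\<^sup>2 * \<eta> ^ (DIM('a) + 2) / infdist x S
      + integral (cbox (- (\<eta> *\<^sub>R One)) (\<eta> *\<^sub>R One))
          (\<lambda>h. 2 * infdist x S - infdist (x + h) S - infdist (x - h) S))"
proof -
  define D where "D y = infdist y S" for y
  let ?Q = "cbox (- (\<eta> *\<^sub>R One)) (\<eta> *\<^sub>R One) :: 'a set"
  have D0: "D x > 0" using x by (simp add: D_def)
  have cD: "continuous_on UNIV D" unfolding D_def by (intro continuous_intros)
  have c\<kappa>: "continuous_on UNIV \<kappa>"
    using \<kappa> by (auto intro!: has_derivative_continuous_on[of _ _ "\<lambda>y h. G y \<bullet> h"])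
  obtain e where e: "norm e = 1" and touch: "\<And>h. D (x + h) \<le> D x + e \<bullet> h + (norm h)\<^sup>2 / (2 * D x)"
    using infdist_touching_paraboloid[OF S x] unfolding D_def by blast
  define P where "P h = D x + e \<bullet> h + (h \<bullet> h) / (2 * D x)" for h
  define R where "R h = P h - D (x + h)" for h
  have R: "R h \<ge> 0" for h using touch[of h] by (simp add: R_def P_def power2_norm_eq_inner)
  have cP: "continuous_on A P" for A unfolding P_def by (intro continuous_intros) (use D0 in auto)
  have cR: "continuous_on A R" for A
    unfolding R_def by (intro continuous_intros cP continuous_on_compose2[OF cD]) auto
  have b: "bounded {z. \<kappa> z \<noteq> 0}" using supp bounded_subset[OF bounded_ball] by blast
  have suppG: "{z. G z \<noteq> 0} \<subseteq> cball 0 \<eta>"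
    using gradient_support_subset[OF \<kappa>] closure_mono[OF supp] \<eta> by (auto simp: closure_ball)
  have bG: "bounded {z. G z \<noteq> 0}" using suppG bounded_subset[OF bounded_cball] by blast
  have intb: "integrable lborel (\<lambda>z. f z *\<^sub>R G z)" if "continuous_on UNIV f" for f :: "'a \<Rightarrow> real"
    using that by (intro integrable_continuous_bounded_support continuous_intros G)
      (auto intro: bounded_subset[OF bG])
  let ?g = "\<integral>y. D y *\<^sub>R G (y - x) \<partial>lborel"
  have "?g = (\<integral>h. D (x + h) *\<^sub>R G h \<partial>lborel)"
  proof -
    have "continuous_on UNIV (\<lambda>y. D y *\<^sub>R G (y - x))"
      by (intro continuous_intros cD continuous_on_compose2[OF G]) auto
    from lborel_integral_translate[OF borel_measurable_continuous_onI[OF this], of x]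
    show ?thesis by simp
  qed
  also have "\<dots> = (\<integral>h. P h *\<^sub>R G h \<partial>lborel) - (\<integral>h. R h *\<^sub>R G h \<partial>lborel)"
    using intb[OF cP] intb[OF cR]
    by (subst Bochner_Integration.integral_diff[symmetric]) (auto simp: R_def algebra_simps)
  finally have g: "?g = (\<integral>h. P h *\<^sub>R G h \<partial>lborel) - (\<integral>h. R h *\<^sub>R G h \<partial>lborel)" .
  define P' where "P' h = e + (1 / D x) *\<^sub>R h" for h
  have cP': "continuous_on A P'" for A unfolding P'_def by (intro continuous_intros)
  have i\<kappa>: "integrable lborel (\<lambda>h. \<kappa> h *\<^sub>R P' h)"
    by (intro integrable_continuous_bounded_support continuous_intros c\<kappa> cP') (auto intro: bounded_subset[OF b])
  \<comment> \<open>Integration by parts moves the gradient from \<kappa> to the paraboloid.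
    \<open>P'\<close> is the gradient of \<open>P\<close>: it equals e up to h/d, and |h| < \<eta>
    wherever \<kappa> is nonzero.\<close>
  have "(\<integral>h. P h *\<^sub>R G h + \<kappa> h *\<^sub>R P' h \<partial>lborel) = 0"
  proof (rule integral_gradient_zero)
    show "((\<lambda>h. P h * \<kappa> h) has_derivative (\<lambda>h. (P y *\<^sub>R G y + \<kappa> y *\<^sub>R P' y) \<bullet> h)) (at y)" for y
    proof -
      have "(P has_derivative (\<lambda>h. P' y \<bullet> h)) (at y)"
        unfolding P_def P'_def using D0
        by (auto intro!: derivative_eq_intros simp: fun_eq_iff inner_add_left inner_add_right inner_commute field_simps)
      from has_derivative_mult[OF this \<kappa>[of y]] show ?thesis
        by (simp add: inner_add_left algebra_simps)
    qed
    show "continuous_on UNIV (\<lambda>y. P y *\<^sub>R G y + \<kappa> y *\<^sub>R P' y)"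
      by (intro continuous_intros cP cP' G c\<kappa>)
    show "bounded {y. P y * \<kappa> y \<noteq> 0}" by (auto intro: bounded_subset[OF b])
  qed
  then have "(\<integral>h. P h *\<^sub>R G h \<partial>lborel) = - (\<integral>h. \<kappa> h *\<^sub>R P' h \<partial>lborel)"
    using intb[OF cP] i\<kappa> by (subst (asm) Bochner_Integration.integral_add) (auto simp: eq_neg_iff_add_eq_0)
  \<comment> \<open>\<open>?g\<close> is minus the gradient of the mollified distance, so its
    product with \<open>- e\<close> bounds the length of that gradient from below.\<close>
  then have "- (e \<bullet> ?g) = (\<integral>h. \<kappa> h * (e \<bullet> P' h) \<partial>lborel) + (\<integral>h. R h * (e \<bullet> G h) \<partial>lborel)"
    using intb[OF cR] i\<kappa> unfolding g by (simp add: inner_diff_right flip: integral_inner_right)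
  moreover have "(\<integral>h. \<kappa> h * (e \<bullet> P' h) \<partial>lborel) \<ge> (\<integral>h. \<kappa> h * (1 - \<eta> / D x) \<partial>lborel)"
  proof (rule integral_mono)
    show "integrable lborel (\<lambda>h. \<kappa> h * (1 - \<eta> / D x))"
      by (intro integrable_continuous_bounded_support continuous_intros c\<kappa>) (auto intro: bounded_subset[OF b])
    show "integrable lborel (\<lambda>h. \<kappa> h * (e \<bullet> P' h))"
      by (intro integrable_continuous_bounded_support continuous_intros c\<kappa> cP') (auto intro: bounded_subset[OF b])
    show "\<kappa> h * (1 - \<eta> / D x) \<le> \<kappa> h * (e \<bullet> P' h)" for h
    proof (cases "\<kappa> h = 0")
      case False
      then have "norm h < \<eta>" using supp by auto
      moreover have "\<bar>e \<bullet> h\<bar> \<le> norm h" using Cauchy_Schwarz_ineq2[of e h] e by simp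
      ultimately have "- \<eta> \<le> e \<bullet> h" by linarith
      then have "(- \<eta>) / D x \<le> (e \<bullet> h) / D x" using D0 by (intro divide_right_mono) auto
      then have "1 - \<eta> / D x \<le> 1 + (e \<bullet> h) / D x" by simp
      also have "\<dots> = e \<bullet> P' h" using e by (simp add: P'_def inner_add_right norm_eq_1)
      finally show ?thesis using pos by (intro mult_left_mono) auto
    qed simp
  qed
  \<comment> \<open>Because \<open>R\<close> has a sign, \<Lambda> can replace |e \<bullet> G|
    without absolute values around \<open>R\<close>; the second differences stay signed and can
    later be summed by parts.\<close>
  moreover have "(\<integral>h. R h * (e \<bullet> G h) \<partial>lborel) \<ge> - \<Lambda> * integral ?Q R"
  proof -
    have "h \<in> ?Q" if "e \<bullet> G h \<noteq> 0" for h
      using that suppG cball_subset_symmetric_cube[of \<eta>, where 'a='a] by (cases "G h = 0") auto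
    then have "(\<integral>h. R h * (e \<bullet> G h) \<partial>lborel) = integral ?Q (\<lambda>h. R h * (e \<bullet> G h))"
      by (intro integral_lborel_eq_integral_cbox continuous_intros cR G) auto
    also have "\<dots> \<ge> integral ?Q (\<lambda>h. - \<Lambda> * R h)"
    proof (rule integral_le)
      show "- \<Lambda> * R h \<le> R h * (e \<bullet> G h)" for h
      proof -
        have "\<bar>e \<bullet> G h\<bar> \<le> \<Lambda>" using Cauchy_Schwarz_ineq2[of e "G h"] e \<Lambda>[of h] by simp
        then show ?thesis using mult_left_mono[of "- \<Lambda>" "e \<bullet> G h" "R h"] R[of h] by (simp add: mult.commute)
      qed
    qed (auto intro!: integrable_continuous continuous_intros cR continuous_on_subset[OF G])
    finally show ?thesis by simp
  qed
  moreover have "integral ?Q R \<le> (2 ^ DIM('a) * (DIM('a))\<^sup>2 * \<eta> ^ (DIM('a) + 2) / D x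
      + integral ?Q (\<lambda>h. 2 * D x - D (x + h) - D (x - h))) / 2"
  proof -
    \<comment> \<open>In \<open>R h + R (- h)\<close> the linear parts of the paraboloid cancel;
      |h|^2/d and the second difference of the distance remain.\<close>
    have "integral ?Q R = integral ?Q (\<lambda>h. R (- h))"
      using Henstock_Kurzweil_Integration.integral_reflect[of "\<eta> *\<^sub>R One" "- (\<eta> *\<^sub>R One)" R] by simp
    then have "2 * integral ?Q R = integral ?Q (\<lambda>h. R h + R (- h))"
      by (subst Henstock_Kurzweil_Integration.integral_add)
         (auto intro!: integrable_continuous cR continuous_on_compose2[OF cR[of UNIV]] continuous_intros)
    also have "\<dots> \<le> integral ?Q (\<lambda>h. \<eta>\<^sup>2 * (DIM('a))\<^sup>2 / D x + (2 * D x - D (x + h) - D (x - h)))"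
    proof (rule integral_le)
      fix h assume "h \<in> ?Q"
      then have "(norm h)\<^sup>2 \<le> (\<eta> * DIM('a))\<^sup>2"
        by (intro power_mono norm_le_of_mem_symmetric_cube) auto
      then have "(norm h)\<^sup>2 / D x \<le> \<eta>\<^sup>2 * (DIM('a))\<^sup>2 / D x"
        using D0 by (simp add: power_mult_distrib divide_right_mono)
      then show "R h + R (- h) \<le> \<eta>\<^sup>2 * (DIM('a))\<^sup>2 / D x + (2 * D x - D (x + h) - D (x - h))"
        by (simp add: R_def P_def power2_norm_eq_inner)
    qed (use D0 in \<open>auto intro!: integrable_continuous continuous_intros cR continuous_on_compose2[OF cR[of UNIV]] continuous_on_compose2[OF cD]\<close>)
    also have "\<dots> = integral ?Q (\<lambda>h. \<eta>\<^sup>2 * (DIM('a))\<^sup>2 / D x) + integral ?Q (\<lambda>h. 2 * D x - D (x + h) - D (x - h))"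
      by (rule Henstock_Kurzweil_Integration.integral_add)
         (auto intro!: integrable_continuous continuous_intros continuous_on_compose2[OF cD])
    also have "integral ?Q (\<lambda>h. \<eta>\<^sup>2 * (DIM('a))\<^sup>2 / D x) = 2 ^ DIM('a) * (DIM('a))\<^sup>2 * \<eta> ^ (DIM('a) + 2) / D x"
      using \<eta> by (simp only: integral_const content_symmetric_cube less_imp_le)
        (simp add: power_mult_distrib power_add power2_eq_square)
    finally show ?thesis by simp
  qed
  moreover have "\<Lambda> \<ge> 0" using \<Lambda>[of 0] norm_ge_zero order_trans by blast
  moreover have "- (e \<bullet> ?g) \<le> norm ?g"
    using Cauchy_Schwarz_ineq2[of e ?g] e by simp
  moreover have "(\<integral>h. \<kappa> h * (1 - \<eta> / D x) \<partial>lborel) = 1 - \<eta> / D x"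
    using int by simp
  ultimately show ?thesis
    unfolding D_def[symmetric] by (smt (verit) mult_left_mono mult_minus_left times_divide_eq_left times_divide_eq_right)
qed

text \<open>Summation by parts: translating one of the two first differences by h turns the second
  difference of \<open>w\<close> into a product of first differences of \<psi> and \<open>w\<close>,
  bounded by M |h| and |h|. The product is supported in the enlarged ball, as |h| \<le> 1.\<close>

lemma integral_second_difference_le:
  fixes \<psi> w :: "'a::euclidean_space \<Rightarrow> real"
  assumes \<psi>: "\<And>x y. \<bar>\<psi> x - \<psi> y\<bar> \<le> M * dist x y" and w: "\<And>x y. \<bar>w x - w y\<bar> \<le> dist x y"
    and supp: "{x. \<psi> x \<noteq> 0} \<subseteq> cball 0 \<rho>" and h: "norm h \<le> 1"
    and c\<psi>: "continuous_on UNIV \<psi>" and cw: "continuous_on UNIV w"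
  shows "(\<integral>x. \<psi> x * (2 * w x - w (x + h) - w (x - h)) \<partial>lborel)
    \<le> M * (norm h)\<^sup>2 * measure lborel (cball (0::'a) (\<rho> + 1))"
proof -
  have b: "bounded {x. \<psi> x \<noteq> 0}" using supp bounded_subset[OF bounded_cball] by blast
  have s1: "x \<in> cball 0 (\<rho> + 1)" if "\<psi> x \<noteq> 0 \<or> \<psi> (x + h) \<noteq> 0" for x
  proof -
    have "norm x \<le> \<rho> \<or> norm (x + h) \<le> \<rho>" using that supp by auto
    then show ?thesis
      using h norm_triangle_ineq4[of "x + h" h] by auto
  qed
  have i1: "integrable lborel (\<lambda>x. \<psi> x * (w x - w (x + h)))"
    by (intro integrable_continuous_bounded_support continuous_intros c\<psi> cw continuous_on_compose2[OF cw])
       (auto intro: bounded_subset[OF b])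
  have c2: "continuous_on UNIV (\<lambda>x. \<psi> x * (w x - w (x - h)))"
    by (intro continuous_intros c\<psi> cw continuous_on_compose2[OF cw]) auto
  have i2: "integrable lborel (\<lambda>x. \<psi> x * (w x - w (x - h)))"
    by (intro integrable_continuous_bounded_support c2) (auto intro: bounded_subset[OF b])
  have i2': "integrable lborel (\<lambda>x. \<psi> (h + x) * (w (h + x) - w x))"
    by (intro integrable_continuous_bounded_support continuous_intros c\<psi> cw continuous_on_compose2[OF cw] continuous_on_compose2[OF c\<psi>])
       (use s1 in \<open>auto intro!: bounded_subset[OF bounded_cball[of 0 "\<rho> + 1"]] simp: add.commute\<close>)
  have "(\<integral>x. \<psi> x * (2 * w x - w (x + h) - w (x - h)) \<partial>lborel)
      = (\<integral>x. \<psi> x * (w x - w (x + h)) \<partial>lborel) + (\<integral>x. \<psi> x * (w x - w (x - h)) \<partial>lborel)"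
    using i1 i2 by (subst Bochner_Integration.integral_add[symmetric]) (auto simp: algebra_simps)
  also have "(\<integral>x. \<psi> x * (w x - w (x - h)) \<partial>lborel) = (\<integral>x. \<psi> (h + x) * (w (h + x) - w x) \<partial>lborel)"
    using lborel_integral_translate[OF borel_measurable_continuous_onI[OF c2], of h] by simp
  also have "(\<integral>x. \<psi> x * (w x - w (x + h)) \<partial>lborel) + \<dots> = (\<integral>x. (\<psi> (x + h) - \<psi> x) * (w (x + h) - w x) \<partial>lborel)"
    using i1 i2' by (subst Bochner_Integration.integral_add[symmetric]) (auto simp: algebra_simps)
  also have "\<dots> \<le> (\<integral>x. M * (norm h)\<^sup>2 * indicator (cball (0::'a) (\<rho> + 1)) x \<partial>lborel)"
  proof (rule integral_mono)
    show "integrable lborel (\<lambda>x. (\<psi> (x + h) - \<psi> x) * (w (x + h) - w x))"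
      by (intro integrable_continuous_bounded_support continuous_intros c\<psi> cw continuous_on_compose2[OF cw] continuous_on_compose2[OF c\<psi>])
         (use s1 in \<open>auto intro!: bounded_subset[OF bounded_cball[of 0 "\<rho> + 1"]]\<close>)
    show "integrable lborel (\<lambda>x::'a. M * (norm h)\<^sup>2 * indicator (cball 0 (\<rho> + 1)) x)"
      by (intro integrable_mult_right integrable_real_indicator emeasure_bounded_finite) auto
    show "(\<psi> (x + h) - \<psi> x) * (w (x + h) - w x) \<le> M * (norm h)\<^sup>2 * indicator (cball 0 (\<rho> + 1)) x" for x
    proof (cases "\<psi> x \<noteq> 0 \<or> \<psi> (x + h) \<noteq> 0")
      case True
      have "(\<psi> (x + h) - \<psi> x) * (w (x + h) - w x) \<le> \<bar>\<psi> (x + h) - \<psi> x\<bar> * \<bar>w (x + h) - w x\<bar>"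
        by (simp add: abs_mult[symmetric])
      also have "\<dots> \<le> (M * norm h) * norm h"
        using \<psi>[of "x + h" x] w[of "x + h" x] by (intro mult_mono) (auto simp: dist_norm)
      finally show ?thesis using s1[OF True] by (simp add: power2_eq_square mult.assoc)
    next
      case False
      have "M * norm h \<ge> 0" using \<psi>[of "x + h" x] by (auto simp: dist_norm intro: order_trans)
      then have "M * norm h * norm h \<ge> 0" by (rule mult_nonneg_nonneg) simp
      then show ?thesis using False by (simp add: power2_eq_square mult.assoc split: split_indicator)
    qed
  qed
  also have "\<dots> = M * (norm h)\<^sup>2 * measure lborel (cball (0::'a) (\<rho> + 1))" by simp
  finally show ?thesis .
qed

text \<open>Integrating in x before h gains a power of \<eta>: for a distance function the second
  difference can be as large as a multiple of |h| at a point with several nearest boundary points,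
  whereas its integral against \<psi> is O(|h|^2).\<close>

lemma integral_averaged_second_difference_le:
  fixes \<psi> w :: "'a::euclidean_space \<Rightarrow> real" and \<eta> :: real
  assumes \<psi>: "\<And>x y. \<bar>\<psi> x - \<psi> y\<bar> \<le> M * dist x y" and w: "\<And>x y. \<bar>w x - w y\<bar> \<le> dist x y"
    and supp: "{x. \<psi> x \<noteq> 0} \<subseteq> cball 0 \<rho>" and \<eta>: "0 < \<eta>" "\<eta> * DIM('a) \<le> 1"
    and c\<psi>: "continuous_on UNIV \<psi>" and cw: "continuous_on UNIV w"
  shows "(\<integral>x. \<psi> x * integral (cbox (- (\<eta> *\<^sub>R One)) (\<eta> *\<^sub>R One)) (\<lambda>h. 2 * w x - w (x + h) - w (x - h)) \<partial>lborel)
    \<le> (2 * \<eta>) ^ DIM('a) * (M * (\<eta> * DIM('a))\<^sup>2 * measure lborel (cball (0::'a) (\<rho> + 1)))"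
proof -
  let ?Q = "cbox (- (\<eta> *\<^sub>R One)) (\<eta> *\<^sub>R One) :: 'a set"
  let ?V = "measure lborel (cball (0::'a) (\<rho> + 1))"
  let ?F = "\<lambda>x h. \<psi> x * (2 * w x - w (x + h) - w (x - h))"
  obtain a :: 'a where a: "cball 0 \<rho> \<subseteq> cbox (- a) a"
    using bounded_subset_cbox_symmetric bounded_cball by metis
  have M: "M \<ge> 0"
  proof -
    obtain b :: 'a where "b \<in> Basis" using nonempty_Basis by blast
    then have "dist b 0 = 1" by simp
    then show ?thesis using \<psi>[of b 0] by auto
  qed
  have cF: "continuous_on A (\<lambda>z. ?F (fst z) (snd z))" for A
    by (intro continuous_intros continuous_on_compose2[OF c\<psi>] continuous_on_compose2[OF cw]) auto
  have cJ: "continuous_on UNIV (\<lambda>x. integral ?Q (?F x))"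
    using cF by (intro integral_continuous_on_param) (simp add: split_beta)
  have cFx: "continuous_on A (\<lambda>x. ?F x h)" for A h
    by (intro continuous_intros continuous_on_compose2[OF c\<psi>] continuous_on_compose2[OF cw]) auto
  have "(\<integral>x. \<psi> x * integral ?Q (\<lambda>h. 2 * w x - w (x + h) - w (x - h)) \<partial>lborel)
      = (\<integral>x. integral ?Q (?F x) \<partial>lborel)"
    by simp
  also have "\<dots> = integral (cbox (- a) a) (\<lambda>x. integral ?Q (?F x))"
    using supp a by (intro integral_lborel_eq_integral_cbox cJ) auto
  also have "\<dots> = integral ?Q (\<lambda>h. integral (cbox (- a) a) (\<lambda>x. ?F x h))"
    using cF by (intro integral_swap_continuous) (simp add: split_beta)
  also have "\<dots> \<le> integral ?Q (\<lambda>h. M * (\<eta> * DIM('a))\<^sup>2 * ?V)"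
  proof (rule integral_le)
    fix h assume "h \<in> ?Q"
    then have nh: "norm h \<le> \<eta> * DIM('a)" by (rule norm_le_of_mem_symmetric_cube)
    have "integral (cbox (- a) a) (\<lambda>x. ?F x h) = (\<integral>x. ?F x h \<partial>lborel)"
      using supp a by (intro integral_lborel_eq_integral_cbox[symmetric] cFx) auto
    also have "\<dots> \<le> M * (norm h)\<^sup>2 * ?V"
      using nh \<eta> by (intro integral_second_difference_le \<psi> w supp c\<psi> cw) auto
    also have "\<dots> \<le> M * (\<eta> * DIM('a))\<^sup>2 * ?V"
      using nh M by (intro mult_right_mono mult_left_mono power_mono) auto
    finally show "integral (cbox (- a) a) (\<lambda>x. ?F x h) \<le> M * (\<eta> * DIM('a))\<^sup>2 * ?V" .
  next
    have "continuous_on ?Q (\<lambda>h. integral (cbox (- a) a) (\<lambda>x. ?F x h))"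
      unfolding split_beta
      by (intro integral_continuous_on_param, unfold split_beta)
         (intro continuous_intros continuous_on_compose2[OF c\<psi>] continuous_on_compose2[OF cw]; simp)
    then show "(\<lambda>h. integral (cbox (- a) a) (\<lambda>x. ?F x h)) integrable_on ?Q"
      by (rule integrable_continuous)
  qed auto
  also have "\<dots> = (2 * \<eta>) ^ DIM('a) * (M * (\<eta> * DIM('a))\<^sup>2 * ?V)"
    using \<eta> by (simp only: integral_const content_symmetric_cube less_imp_le real_scaleR_def)
  finally show ?thesis .
qed

section \<open>Mollified superharmonic distance functions\<close>

text \<open>The difference quotient along \<open>G\<close> itself tends to |G|^2 and is at most L
  |G|. For G = 0 it remains to see that L is non-negative, which two points at distance 1
  show.\<close>

lemma norm_gradient_le_lipschitz:
  fixes w :: "'a::euclidean_space \<Rightarrow> real"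
  assumes D: "(w has_derivative (\<lambda>h. G \<bullet> h)) (at x)" and L: "\<And>x y. \<bar>w x - w y\<bar> \<le> L * dist x y"
  shows "norm G \<le> L"
proof (cases "G = 0")
  case True
  obtain b :: 'a where "b \<in> Basis" using nonempty_Basis by blast
  then have "dist b 0 = 1" by simp
  then show ?thesis using L[of b 0] True by auto
next
  case False
  have "((\<lambda>t. w (x + t *\<^sub>R G)) has_derivative (\<lambda>t. G \<bullet> (t *\<^sub>R G))) (at 0)"
    by (rule has_derivative_compose[of "\<lambda>t. x + t *\<^sub>R G" "\<lambda>t. t *\<^sub>R G" 0 UNIV w])
       (auto intro!: derivative_eq_intros D)
  then have "((\<lambda>t. w (x + t *\<^sub>R G)) has_real_derivative G \<bullet> G) (at 0)"
    by (simp add: has_field_derivative_def mult_commute_abs)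
  then have lim: "((\<lambda>t. (w (x + t *\<^sub>R G) - w x) / t) \<longlongrightarrow> G \<bullet> G) (at 0)"
    by (simp add: DERIV_def)
  have "G \<bullet> G \<le> L * norm G"
  proof (rule tendsto_upperbound[OF lim])
    have "(w (x + t *\<^sub>R G) - w x) / t \<le> L * norm G" if "t \<noteq> 0" for t
    proof -
      have "\<bar>(w (x + t *\<^sub>R G) - w x) / t\<bar> \<le> (L * (\<bar>t\<bar> * norm G)) / \<bar>t\<bar>"
        unfolding abs_divide using L[of "x + t *\<^sub>R G" x] by (intro divide_right_mono) (auto simp: dist_norm)
      also have "\<dots> = L * norm G" using that by simp
      finally show ?thesis by linarith
    qed
    then show "\<forall>\<^sub>F t in at 0. (w (x + t *\<^sub>R G) - w x) / t \<le> L * norm G"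
      by (auto simp: eventually_at_filter)
  qed simp
  then show ?thesis
    using False by (simp add: dot_square_norm power2_eq_square)
qed

text \<open>The i-th component of the gradient of \<Phi> times the i-th component of
  \<open>V\<close> has integral 0; add over i. \<open>HV i\<close> is the gradient of the i-th
  component of \<open>V\<close>, so the sum of its diagonal entries is the divergence of
  \<open>V\<close>.\<close>

lemma integral_divergence_zero:
  fixes \<Phi> :: "real ^ 'n \<Rightarrow> real" and V :: "real ^ 'n \<Rightarrow> real ^ 'n" and HV :: "'n \<Rightarrow> real ^ 'n \<Rightarrow> real ^ 'n"
  assumes \<Phi>: "\<And>x. (\<Phi> has_derivative (\<lambda>h. G x \<bullet> h)) (at x)" and G: "continuous_on UNIV G"
    and b: "bounded {x. \<Phi> x \<noteq> 0}"
    and V: "\<And>i x. ((\<lambda>x. V x $ i) has_derivative (\<lambda>h. HV i x \<bullet> h)) (at x)"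
    and HV: "\<And>i. continuous_on UNIV (HV i)"
  shows "(\<integral>x. G x \<bullet> V x + \<Phi> x * (\<Sum>i\<in>UNIV. HV i x $ i) \<partial>lborel) = 0"
proof -
  have c\<Phi>: "continuous_on UNIV \<Phi>"
    using \<Phi> by (auto intro!: has_derivative_continuous_on[of _ _ "\<lambda>y h. G y \<bullet> h"])
  have cV: "continuous_on UNIV (\<lambda>x. V x $ i)" for i
    using V by (auto intro!: has_derivative_continuous_on[of _ _ "\<lambda>y h. HV i y \<bullet> h"])
  let ?F = "\<lambda>i x. \<Phi> x *\<^sub>R HV i x + V x $ i *\<^sub>R G x"
  have D: "((\<lambda>x. \<Phi> x * V x $ i) has_derivative (\<lambda>h. ?F i x \<bullet> h)) (at x)" for i x
    using has_derivative_mult[OF \<Phi>[of x] V[of i x]] by (simp add: inner_add_left algebra_simps)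
  have cF: "continuous_on UNIV (?F i)" for i
    by (intro continuous_intros c\<Phi> cV G HV)
  have bF: "bounded {x. \<Phi> x * V x $ i \<noteq> 0}" for i
    by (rule bounded_subset[OF b]) auto
  have bF': "bounded {x. ?F i x \<noteq> 0}" for i
    using gradient_support_subset[OF D] bF by (meson bounded_closure bounded_subset)
  have int: "integrable lborel (?F i)" for i
    by (rule integrable_continuous_bounded_support[OF cF bF'])
  have "(\<integral>x. ?F i x \<partial>lborel) = 0" for i
    by (rule integral_gradient_zero[OF D cF bF])
  then have z: "(\<integral>x. ?F i x $ i \<partial>lborel) = 0" for i
    using integral_bounded_linear[OF bounded_linear_vec_nth int, of i i] by simp
  have "(\<integral>x. (\<Sum>i\<in>UNIV. ?F i x $ i) \<partial>lborel) = (\<Sum>i\<in>UNIV. \<integral>x. ?F i x $ i \<partial>lborel)"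
    by (intro Bochner_Integration.integral_sum integrable_bounded_linear[OF bounded_linear_vec_nth int])
  also have "\<dots> = 0" using z by simp
  also have "(\<lambda>x. \<Sum>i\<in>UNIV. ?F i x $ i) = (\<lambda>x. G x \<bullet> V x + \<Phi> x * (\<Sum>i\<in>UNIV. HV i x $ i))"
    by (simp add: fun_eq_iff inner_vec_def sum.distrib sum_distrib_left algebra_simps)
  finally show ?thesis .
qed

text \<open>The open sets \<open>U\<close> and \<open>- K\<close> cover the space, and
  \<open>g\<close> vanishes on the second. This serves products such as f(w) \<psi> and quotients
  such as |u|/d, which are under control only where w or d is positive but vanish off a compact
  set.\<close>

lemma continuous_on_zero_extension:
  fixes g :: "'a::topological_space \<Rightarrow> 'b::{topological_space, zero}"
  assumes "continuous_on U g" "open U" "closed K" "K \<subseteq> U" "\<And>x. x \<notin> K \<Longrightarrow> g x = 0"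
  shows "continuous_on UNIV g"
proof -
  have "continuous_on (- K) g"
    by (rule continuous_on_eq[OF continuous_on_const[of _ 0]]) (use assms in auto)
  then have "continuous_on (U \<union> - K) g"
    using assms by (intro continuous_on_open_Un) auto
  moreover have "U \<union> - K = UNIV" using assms by auto
  ultimately show ?thesis by simp
qed

lemma set_integral_lebesgue_eq_lborel:
  fixes F :: "'a::euclidean_space \<Rightarrow> real"
  assumes "F \<in> borel_measurable borel" "\<And>x. x \<notin> A \<Longrightarrow> F x = 0"
  shows "(LINT x:A|lebesgue. F x) = (\<integral>x. F x \<partial>lborel)"
proof -
  have "(\<lambda>x. indicator A x *\<^sub>R F x) = F"
    using assms(2) by (auto simp: fun_eq_iff indicator_def)
  then show ?thesis
    using assms(1) by (simp add: set_lebesgue_integral_def integral_completion)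
qed

section \<open>The distance to the complement and its mollification\<close>

lemma bdist_lipschitz: "\<bar>bdist \<Omega> x - bdist \<Omega> y\<bar> \<le> dist x y"
  unfolding bdist_def by (rule infdist_triangle_abs)

lemma continuous_on_bdist: "continuous_on A (bdist \<Omega>)"
  unfolding bdist_def[abs_def] by (intro continuous_intros)

lemma bdist_nonneg: "0 \<le> bdist \<Omega> x"
  unfolding bdist_def by (rule infdist_nonneg)

lemma bdist_outside: "x \<notin> \<Omega> \<Longrightarrow> bdist \<Omega> x = 0"
  unfolding bdist_def by simp

lemma bdist_pos:
  assumes "open \<Omega>" "\<Omega> \<noteq> UNIV" "x \<in> \<Omega>"
  shows "0 < bdist \<Omega> x"
  using assms infdist_pos_not_in_closed[of "UNIV - \<Omega>" x] by (auto simp: bdist_def open_closed Compl_eq_Diff_UNIV)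

lemma bounded_support_shift:
  fixes g :: "'a::real_normed_vector \<Rightarrow> 'b::zero"
  assumes "bounded {z. g z \<noteq> 0}"
  shows "bounded {y. g (y - x) \<noteq> 0}"
proof -
  have "{y. g (y - x) \<noteq> 0} \<subseteq> (\<lambda>z. x + z) ` {z. g z \<noteq> 0}"
    by (auto simp: image_iff intro!: exI[of _ "_ - x"])
  then show ?thesis
    using bounded_translation[OF assms] bounded_subset by blast
qed

text \<open>\<open>w\<close> averages translates of the distance with a probability density, so
  bounds and the Lipschitz constant carry over. The sum of the \<open>H i x $ i\<close> is the
  Laplacian of \<open>w\<close>; it is the integral of the distance against the Laplacian of
  \<kappa> translated to x. That translate is an admissible test function when the ball of radius
  \<eta> about x lies in \<Omega>, hence the condition
  \<open>\<eta> < bdist \<Omega> x\<close>.\<close>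

lemma mollified_superharmonic_distance:
  fixes \<Omega> :: "(real ^ 'n) set"
  assumes op: "open \<Omega>" "\<Omega> \<noteq> UNIV" and sup: "neg_laplacian_nonneg \<Omega> (bdist \<Omega>)"
    and k: "\<And>k. Ck k \<kappa>" and pos: "\<And>z. 0 \<le> \<kappa> z" and supp: "{z. \<kappa> z \<noteq> 0} \<subseteq> ball 0 \<eta>"
    and int: "(\<integral>z. \<kappa> z \<partial>lborel) = 1" and \<eta>: "\<eta> > 0"
  defines "w \<equiv> \<lambda>x. \<integral>y. bdist \<Omega> y * \<kappa> (y - x) \<partial>lborel"
    and "G \<equiv> \<lambda>x. - (\<integral>y. bdist \<Omega> y *\<^sub>R gradient \<kappa> (y - x) \<partial>lborel)"
  obtains H where
    "\<And>x. \<bar>w x - bdist \<Omega> x\<bar> \<le> \<eta>"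
    "\<And>x. (w has_derivative (\<lambda>h. G x \<bullet> h)) (at x)"
    "\<And>x. norm (G x) \<le> 1"
    "\<And>i x. ((\<lambda>x. G x $ i) has_derivative (\<lambda>h. H i x \<bullet> h)) (at x)"
    "\<And>i. continuous_on UNIV (H i)"
    "\<And>x. \<eta> < bdist \<Omega> x \<Longrightarrow> (\<Sum>i\<in>UNIV. H i x $ i) \<le> 0"
    "\<And>x D. (\<And>y. bdist \<Omega> y \<le> D) \<Longrightarrow> w x \<le> D"
proof -
  let ?d = "bdist \<Omega>"
  define H where "H i x = (\<integral>y. ?d y *\<^sub>R gradient (partial_deriv i \<kappa>) (y - x) \<partial>lborel)" for i x
  have kS: "Ck k (partial_deriv i \<kappa>)" for k i using k[of "Suc k"] by simp
  have D\<kappa>: "(\<kappa> has_derivative (\<lambda>h. gradient \<kappa> y \<bullet> h)) (at y)" for y by (rule Ck_Suc_has_derivative[OF k])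
  have Di\<kappa>: "(partial_deriv i \<kappa> has_derivative (\<lambda>h. gradient (partial_deriv i \<kappa>) y \<bullet> h)) (at y)" for i y
    by (rule Ck_Suc_has_derivative[OF kS])
  have c\<kappa>: "continuous_on UNIV \<kappa>" by (rule Ck_continuous[OF k])
  have cg: "continuous_on UNIV (gradient \<kappa>)" by (rule Ck_Suc_continuous_gradient[OF k])
  have cgi: "continuous_on UNIV (gradient (partial_deriv i \<kappa>))" for i by (rule Ck_Suc_continuous_gradient[OF kS])
  have b: "bounded {z. \<kappa> z \<noteq> 0}" using supp bounded_subset[OF bounded_ball] by blast
  have bg: "bounded {z. gradient \<kappa> z \<noteq> 0}"
    using gradient_support_subset[OF D\<kappa>] b by (meson bounded_closure bounded_subset)
  have bi: "bounded {z. partial_deriv i \<kappa> z \<noteq> 0}" for i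
    by (rule bounded_subset[OF bg]) (auto simp: gradient_def vec_eq_iff)
  have bgi: "bounded {z. gradient (partial_deriv i \<kappa>) z \<noteq> 0}" for i
    using gradient_support_subset[OF Di\<kappa>] bi by (meson bounded_closure bounded_subset)
  have ti: "integrable lborel (\<lambda>z. f z *\<^sub>R \<kappa> z)" if "continuous_on UNIV f" for f :: "real ^ 'n \<Rightarrow> real"
    by (intro integrable_continuous_bounded_support continuous_intros that c\<kappa>) (auto intro: bounded_subset[OF b])
  have wt: "w x = (\<integral>z. ?d (x + z) * \<kappa> z \<partial>lborel)" for x
  proof -
    have "continuous_on UNIV (\<lambda>y. ?d y * \<kappa> (y - x))"
      by (intro continuous_intros continuous_on_bdist continuous_on_compose2[OF c\<kappa>]) auto
    from lborel_integral_translate[OF borel_measurable_continuous_onI[OF this], of x]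
    show ?thesis by (simp add: w_def)
  qed
  have it: "integrable lborel (\<lambda>z. ?d (x + z) * \<kappa> z)" for x
    using ti[of "\<lambda>z. ?d (x + z)"] by (simp add: continuous_on_compose2[OF continuous_on_bdist[of UNIV]] continuous_intros)
  have i1: "integrable lborel (\<lambda>z. c * \<kappa> z)" for c
    using ti[of "\<lambda>_. c"] by simp
  have est: "\<bar>w x - c\<bar> \<le> B" if "\<And>z. norm z < \<eta> \<Longrightarrow> \<bar>?d (x + z) - c\<bar> \<le> B" for x c B
  proof -
    have "w x - c = (\<integral>z. ?d (x + z) * \<kappa> z - c * \<kappa> z \<partial>lborel)"
      using int by (subst Bochner_Integration.integral_diff[OF it i1]) (simp add: wt)
    also have "\<bar>\<dots>\<bar> \<le> (\<integral>z. B * \<kappa> z \<partial>lborel)"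
    proof (rule order_trans[OF integral_abs_bound integral_mono])
      show "integrable lborel (\<lambda>z. \<bar>?d (x + z) * \<kappa> z - c * \<kappa> z\<bar>)"
        by (intro integrable_abs Bochner_Integration.integrable_diff it i1)
      show "\<bar>?d (x + z) * \<kappa> z - c * \<kappa> z\<bar> \<le> B * \<kappa> z" for z
      proof (cases "\<kappa> z = 0")
        case False
        then have "\<bar>?d (x + z) - c\<bar> \<le> B" using supp by (intro that) auto
        then have "\<bar>?d (x + z) - c\<bar> * \<kappa> z \<le> B * \<kappa> z" using pos by (intro mult_right_mono) auto
        then show ?thesis using pos[of z] by (simp add: abs_mult left_diff_distrib[symmetric])
      qed simp
    qed (rule i1)
    finally show ?thesis using int by simp
  qed
  have "\<bar>w x - ?d x\<bar> \<le> \<eta>" for x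
    by (rule est, rule order_trans[OF bdist_lipschitz]) (simp add: dist_norm)
  moreover have Dw: "(w has_derivative (\<lambda>h. G x \<bullet> h)) (at x)" for x
    unfolding w_def G_def by (rule convolution_has_derivative[OF continuous_on_bdist D\<kappa> cg b])
  moreover have "norm (G x) \<le> 1" for x
  proof (rule norm_gradient_le_lipschitz[OF Dw])
    fix x y
    have "w x - w y = (\<integral>z. (?d (x + z) - ?d (y + z)) * \<kappa> z \<partial>lborel)"
      unfolding wt using it by (subst Bochner_Integration.integral_diff[symmetric]) (auto simp: left_diff_distrib)
    also have "\<bar>\<dots>\<bar> \<le> (\<integral>z. dist x y * \<kappa> z \<partial>lborel)"
    proof (rule order_trans[OF integral_abs_bound integral_mono])
      show "integrable lborel (\<lambda>z. \<bar>(?d (x + z) - ?d (y + z)) * \<kappa> z\<bar>)"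
        unfolding left_diff_distrib by (intro integrable_abs Bochner_Integration.integrable_diff it)
      show "\<bar>(?d (x + z) - ?d (y + z)) * \<kappa> z\<bar> \<le> dist x y * \<kappa> z" for z
        using bdist_lipschitz[of \<Omega> "x + z" "y + z"] pos[of z] by (simp add: abs_mult mult_right_mono)
    qed (rule i1)
    finally show "\<bar>w x - w y\<bar> \<le> 1 * dist x y" using int by simp
  qed
  moreover have Gi: "G x $ i = - (\<integral>y. ?d y * partial_deriv i \<kappa> (y - x) \<partial>lborel)" for x i
  proof -
    have "integrable lborel (\<lambda>y. ?d y *\<^sub>R gradient \<kappa> (y - x))"
      by (intro integrable_continuous_bounded_support continuous_intros continuous_on_bdist continuous_on_compose2[OF cg])
         (auto intro: bounded_subset[OF bounded_support_shift[OF bg]])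
    from integral_bounded_linear[OF bounded_linear_vec_nth this, of i]
    show ?thesis by (simp add: G_def gradient_def)
  qed
  moreover have "((\<lambda>x. G x $ i) has_derivative (\<lambda>h. H i x \<bullet> h)) (at x)" for i x
    using has_derivative_minus[OF convolution_has_derivative[OF continuous_on_bdist Di\<kappa> cgi bi]]
    unfolding Gi H_def by simp
  moreover have "continuous_on UNIV (H i)" for i
    unfolding H_def by (intro continuous_on_convolution continuous_on_bdist cgi bgi)
  moreover have "(\<Sum>i\<in>UNIV. H i x $ i) \<le> 0" if x: "\<eta> < ?d x" for x
  proof -
    \<comment> \<open>The factors 1 bring the translate into the shape of the rules for affine
      substitutions.\<close>
    define \<phi> where "\<phi> = (\<lambda>y. 1 * \<kappa> (1 *\<^sub>R (y - x)))"
    have p1: "partial_deriv i \<phi> = (\<lambda>y. (1 * 1) * partial_deriv i \<kappa> (1 *\<^sub>R (y - x)))" for i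
      unfolding \<phi>_def using k[of 1] by (intro partial_deriv_affine(2)) simp
    have p2: "partial_deriv i (partial_deriv i \<phi>) = (\<lambda>y. ((1 * 1) * 1) * partial_deriv i (partial_deriv i \<kappa>) (1 *\<^sub>R (y - x)))" for i
      unfolding p1 using kS[of 1] by (intro partial_deriv_affine(2)) simp
    have lap: "laplacian \<phi> y = (\<Sum>i\<in>UNIV. gradient (partial_deriv i \<kappa>) (y - x) $ i)" for y
      unfolding laplacian_def p2 by (simp add: gradient_def)
    have "{y. \<phi> y \<noteq> 0} \<subseteq> cball x \<eta>"
    proof
      fix y assume "y \<in> {y. \<phi> y \<noteq> 0}"
      then have "y - x \<in> ball 0 \<eta>" using supp by (auto simp: \<phi>_def)
      then show "y \<in> cball x \<eta>" by (simp add: dist_norm norm_minus_commute)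
    qed
    then have cl: "closure {y. \<phi> y \<noteq> 0} \<subseteq> cball x \<eta>"
      by (simp add: closure_minimal)
    moreover have "cball x \<eta> \<subseteq> \<Omega>"
    proof
      fix y assume y: "y \<in> cball x \<eta>"
      show "y \<in> \<Omega>"
      proof (rule ccontr)
        assume "y \<notin> \<Omega>"
        then have "?d x \<le> dist x y" unfolding bdist_def by (intro infdist_le) auto
        then show False using x y by auto
      qed
    qed
    moreover have "compact (closure {y. \<phi> y \<noteq> 0})"
      using cl bounded_subset[OF bounded_cball] by (auto simp: compact_eq_bounded_closed)
    moreover have "Ck k \<phi>" for k unfolding \<phi>_def by (rule Ck_affine[OF k])
    ultimately have "\<phi> \<in> Cc_inf \<Omega>" by (auto simp: Cc_inf_def)
    moreover have "\<forall>y. 0 \<le> \<phi> y" using pos by (simp add: \<phi>_def)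
    ultimately have "(LINT y:\<Omega>|lebesgue. ?d y * laplacian \<phi> y) \<le> 0"
      using sup by (auto simp: neg_laplacian_nonneg_def)
    also have "(LINT y:\<Omega>|lebesgue. ?d y * laplacian \<phi> y) = (\<integral>y. ?d y * laplacian \<phi> y \<partial>lborel)"
    proof (rule set_integral_lebesgue_eq_lborel)
      have "continuous_on UNIV (\<lambda>y. ?d y * laplacian \<phi> y)"
        unfolding lap by (intro continuous_intros continuous_on_bdist continuous_on_compose2[OF cgi]) auto
      then show "(\<lambda>y. ?d y * laplacian \<phi> y) \<in> borel_measurable borel"
        by (rule borel_measurable_continuous_onI)
    qed (simp add: bdist_outside)
    also have "\<dots> = (\<Sum>i\<in>UNIV. H i x $ i)"
    proof -
      have ii: "integrable lborel (\<lambda>y. ?d y *\<^sub>R gradient (partial_deriv i \<kappa>) (y - x))" for i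
        by (intro integrable_continuous_bounded_support continuous_intros continuous_on_bdist continuous_on_compose2[OF cgi])
           (auto intro: bounded_subset[OF bounded_support_shift[OF bgi]])
      have "(\<integral>y. ?d y * laplacian \<phi> y \<partial>lborel)
          = (\<integral>y. (\<Sum>i\<in>UNIV. (?d y *\<^sub>R gradient (partial_deriv i \<kappa>) (y - x)) $ i) \<partial>lborel)"
        by (simp add: lap sum_distrib_left)
      also have "\<dots> = (\<Sum>i\<in>UNIV. (\<integral>y. (?d y *\<^sub>R gradient (partial_deriv i \<kappa>) (y - x)) $ i \<partial>lborel))"
        by (intro Bochner_Integration.integral_sum integrable_bounded_linear[OF bounded_linear_vec_nth ii])
      also have "\<dots> = (\<Sum>i\<in>UNIV. H i x $ i)"
        unfolding H_def by (intro sum.cong refl integral_bounded_linear[OF bounded_linear_vec_nth ii])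
      finally show ?thesis .
    qed
    finally show ?thesis .
  qed
  moreover have "w x \<le> D" if "\<And>y. ?d y \<le> D" for x D
  proof -
    have "w x \<le> (\<integral>z. D * \<kappa> z \<partial>lborel)"
      unfolding wt by (intro integral_mono it i1 mult_right_mono that pos)
    then show ?thesis using int by simp
  qed
  ultimately show ?thesis using that[of H] by blast
qed

section \<open>The weak inequality for mollifications and its limit\<close>

lemma compact_support_bounded: "compact (closure {x. f x \<noteq> 0}) \<Longrightarrow> bounded {x. f x \<noteq> 0}"
  using closure_subset bounded_subset compact_imp_bounded by metis

lemma lipschitz_of_bounded_gradient:
  fixes \<psi> :: "'a::euclidean_space \<Rightarrow> real"
  assumes \<psi>: "\<And>x. (\<psi> has_derivative (\<lambda>h. G x \<bullet> h)) (at x)" and B: "\<And>x. norm (G x) \<le> M"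
  shows "\<bar>\<psi> x - \<psi> y\<bar> \<le> M * dist x y"
proof -
  have "norm (\<psi> x - \<psi> y) \<le> M * norm (x - y)"
  proof (rule differentiable_bound[of UNIV \<psi> "\<lambda>x h. G x \<bullet> h"])
    show "onorm (\<lambda>h. G x \<bullet> h) \<le> M" for x
      by (rule order_trans[OF onorm_le[of _ "norm (G x)"] B]) (simp add: Cauchy_Schwarz_ineq2)
  qed (use \<psi> in auto)
  then show ?thesis by (simp add: dist_norm)
qed

text \<open>Apply the divergence theorem to \<Phi> V with \<Phi> = f(w) \<psi>: the integral of
  \<nabla>\<Phi> \<bullet> V is minus that of \<Phi> div V, hence non-negative. Its terms are f(w)
  \<nabla>\<psi> \<bullet> V, at most f(w) |\<nabla>\<psi>| because |V| \<le> 1, and f'(w) \<psi>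
  |V|^2. The square is kept because a mollified gradient may be shorter than 1.\<close>

lemma mollified_weak_inequality:
  fixes \<psi> w :: "real ^ 'n \<Rightarrow> real"
  assumes f: "\<And>t. t > 0 \<Longrightarrow> (f has_real_derivative f' t) (at t)" "continuous_on {0<..} f'"
    and \<psi>: "\<And>x. (\<psi> has_derivative (\<lambda>h. G x \<bullet> h)) (at x)" "continuous_on UNIV G" "\<And>x. 0 \<le> \<psi> x"
      "compact (closure {x. \<psi> x \<noteq> 0})"
    and w: "\<And>x. (w has_derivative (\<lambda>h. V x \<bullet> h)) (at x)" "\<And>x. norm (V x) \<le> 1"
      "\<And>i x. ((\<lambda>x. V x $ i) has_derivative (\<lambda>h. H i x \<bullet> h)) (at x)"
      "\<And>i. continuous_on UNIV (H i)"
    and wpos: "\<And>x. x \<in> closure {x. \<psi> x \<noteq> 0} \<Longrightarrow> 0 < w x"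
    and fpos: "\<And>x. x \<in> closure {x. \<psi> x \<noteq> 0} \<Longrightarrow> 0 \<le> f (w x)"
    and sup: "\<And>x. x \<in> closure {x. \<psi> x \<noteq> 0} \<Longrightarrow> (\<Sum>i\<in>UNIV. H i x $ i) \<le> (0::real)"
  shows "integrable lborel (\<lambda>x. f' (w x) * \<psi> x)"
    and "integrable lborel (\<lambda>x. f' (w x) * \<psi> x * (norm (V x))\<^sup>2)"
    and "integrable lborel (\<lambda>x. f (w x) * norm (G x))"
    and "(\<integral>x. - f' (w x) * \<psi> x * (norm (V x))\<^sup>2 \<partial>lborel) \<le> (\<integral>x. f (w x) * norm (G x) \<partial>lborel)"
proof -
  define K where "K = closure {x. \<psi> x \<noteq> 0}"
  have K: "closed K" "\<And>x. x \<notin> K \<Longrightarrow> \<psi> x = 0" "\<And>x. x \<notin> K \<Longrightarrow> G x = 0" and bK: "bounded K"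
    using closure_subset[of "{x. \<psi> x \<noteq> 0}"] gradient_support_subset[OF \<psi>(1)] \<psi>(4)
    by (auto simp: K_def compact_imp_bounded)
  have cw: "continuous_on A w" for A
    by (rule has_derivative_continuous_on[OF has_derivative_at_withinI[OF w(1)]])
  have c\<psi>: "continuous_on A \<psi>" for A
    by (rule has_derivative_continuous_on[OF has_derivative_at_withinI[OF \<psi>(1)]])
  have cVi: "continuous_on A (\<lambda>x. V x $ i)" for A i
    by (rule has_derivative_continuous_on[OF has_derivative_at_withinI[OF w(3)]])
  have cV: "continuous_on A V" for A
    using continuous_on_vec_lambda[of A "\<lambda>i x. V x $ i", OF cVi] by simp
  have cG: "continuous_on A G" for A by (rule continuous_on_subset[OF \<psi>(2)]) simp
  define U where "U = {x. 0 < w x}"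
  have U: "open U" "K \<subseteq> U" "w ` U \<subseteq> {0<..}"
    using wpos by (auto simp: U_def K_def intro!: open_Collect_less cw)
  have cf: "continuous_on {0<..} f"
    using f(1) by (intro continuous_at_imp_continuous_on ballI DERIV_isCont) auto
  have cfw: "continuous_on U (\<lambda>x. f (w x))" "continuous_on U (\<lambda>x. f' (w x))"
    using U by (auto intro!: continuous_on_compose2[OF cf cw] continuous_on_compose2[OF f(2) cw])
  have c1: "continuous_on UNIV (\<lambda>x. f' (w x) * \<psi> x)"
    by (rule continuous_on_zero_extension[OF _ U(1) K(1) U(2)]) (auto intro!: continuous_intros cfw c\<psi> simp: K(2))
  have c2: "continuous_on UNIV (\<lambda>x. f (w x) * norm (G x))"
    by (rule continuous_on_zero_extension[OF _ U(1) K(1) U(2)]) (auto intro!: continuous_intros cfw cG simp: K(3))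
  have c3: "continuous_on UNIV (\<lambda>x. f (w x) *\<^sub>R G x)"
    by (rule continuous_on_zero_extension[OF _ U(1) K(1) U(2)]) (auto intro!: continuous_intros cfw cG simp: K(3))
  have c4: "continuous_on UNIV (\<lambda>x. f (w x) * \<psi> x)"
    by (rule continuous_on_zero_extension[OF _ U(1) K(1) U(2)]) (auto intro!: continuous_intros cfw c\<psi> simp: K(2))
  have supp: "bounded {x. F x \<noteq> 0}" if "\<And>x. x \<notin> K \<Longrightarrow> F x = 0" for F :: "real ^ 'n \<Rightarrow> real"
    by (rule bounded_subset[OF bK]) (use that in auto)
  show "integrable lborel (\<lambda>x. f' (w x) * \<psi> x)"
    by (intro integrable_continuous_bounded_support c1 supp) (simp add: K)
  show i1: "integrable lborel (\<lambda>x. f' (w x) * \<psi> x * (norm (V x))\<^sup>2)"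
    by (intro integrable_continuous_bounded_support continuous_intros c1 cV supp) (simp add: K)
  show i2: "integrable lborel (\<lambda>x. f (w x) * norm (G x))"
    by (intro integrable_continuous_bounded_support c2 supp) (simp add: K)
  define \<Phi> where "\<Phi> x = f (w x) * \<psi> x" for x
  define D\<Phi> where "D\<Phi> x = f (w x) *\<^sub>R G x + (f' (w x) * \<psi> x) *\<^sub>R V x" for x
  \<comment> \<open>Off \<open>K\<close> nothing ensures that w is positive, so f(w) need not be
    differentiable; there \<Phi> vanishes on a whole neighbourhood.\<close>
  have D\<Phi>: "(\<Phi> has_derivative (\<lambda>h. D\<Phi> x \<bullet> h)) (at x)" for x
  proof (cases "x \<in> K")
    case True
    then have "w x > 0" using U by (auto simp: U_def)
    from has_derivative_compose[OF w(1)[of x] f(1)[OF this, unfolded has_field_derivative_def]]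
    have "((\<lambda>x. f (w x)) has_derivative (\<lambda>h. f' (w x) * (V x \<bullet> h))) (at x)" .
    from has_derivative_mult[OF this \<psi>(1)[of x]]
    show ?thesis unfolding \<Phi>_def D\<Phi>_def by (simp add: inner_add_left algebra_simps)
  next
    case False
    have "((\<lambda>_. 0) has_derivative (\<lambda>h. D\<Phi> x \<bullet> h)) (at x)"
      using False by (simp add: D\<Phi>_def K)
    then show ?thesis
      by (rule has_derivative_transform_within_open[of _ _ _ _ "- K"]) (use False K in \<open>auto simp: \<Phi>_def\<close>)
  qed
  have cD\<Phi>: "continuous_on UNIV D\<Phi>"
    unfolding D\<Phi>_def by (intro continuous_intros c1 c3 cV)
  have c\<Phi>: "continuous_on UNIV \<Phi>" unfolding \<Phi>_def by (rule c4)
  have i3: "integrable lborel (\<lambda>x. D\<Phi> x \<bullet> V x)"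
    by (intro integrable_continuous_bounded_support continuous_intros cD\<Phi> cV supp) (simp add: K D\<Phi>_def)
  have i4: "integrable lborel (\<lambda>x. \<Phi> x * (\<Sum>i\<in>UNIV. H i x $ i))"
    by (intro integrable_continuous_bounded_support continuous_intros c\<Phi> w(4) supp) (simp add: K \<Phi>_def)
  have "(\<integral>x. D\<Phi> x \<bullet> V x + \<Phi> x * (\<Sum>i\<in>UNIV. H i x $ i) \<partial>lborel) = 0"
    by (rule integral_divergence_zero[OF D\<Phi> cD\<Phi> supp w(3,4)]) (simp add: K \<Phi>_def)
  then have "(\<integral>x. D\<Phi> x \<bullet> V x \<partial>lborel) = (\<integral>x. - (\<Phi> x * (\<Sum>i\<in>UNIV. H i x $ i)) \<partial>lborel)"
    using i3 i4 by simp
  also have "\<dots> \<ge> 0"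
  proof (rule Bochner_Integration.integral_nonneg)
    show "0 \<le> - (\<Phi> x * (\<Sum>i\<in>UNIV. H i x $ i))" for x
    proof (cases "x \<in> K")
      case True
      then have "0 \<le> \<Phi> x" using fpos \<psi>(3) by (simp add: \<Phi>_def K_def)
      then show ?thesis using sup True by (simp add: K_def mult_nonneg_nonpos)
    qed (simp add: \<Phi>_def K)
  qed
  finally have nonneg: "0 \<le> (\<integral>x. D\<Phi> x \<bullet> V x \<partial>lborel)" .
  also have "\<dots> \<le> (\<integral>x. f (w x) * norm (G x) + f' (w x) * \<psi> x * (norm (V x))\<^sup>2 \<partial>lborel)"
  proof (rule integral_mono[OF i3 Bochner_Integration.integrable_add[OF i2 i1]])
    show "D\<Phi> x \<bullet> V x \<le> f (w x) * norm (G x) + f' (w x) * \<psi> x * (norm (V x))\<^sup>2" for x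
    proof (cases "x \<in> K")
      case True
      have "G x \<bullet> V x \<le> norm (G x) * norm (V x)" by (rule norm_cauchy_schwarz)
      also have "\<dots> \<le> norm (G x)" using w(2)[of x] by (simp add: mult_left_le)
      finally have "f (w x) * (G x \<bullet> V x) \<le> f (w x) * norm (G x)"
        using fpos True by (intro mult_left_mono) (auto simp: K_def)
      then show ?thesis by (simp add: D\<Phi>_def inner_add_left dot_square_norm)
    qed (simp add: D\<Phi>_def K)
  qed
  finally show "(\<integral>x. - f' (w x) * \<psi> x * (norm (V x))\<^sup>2 \<partial>lborel) \<le> (\<integral>x. f (w x) * norm (G x) \<partial>lborel)"
    using i1 i2 by simp
qed

text \<open>Mollify the distance. Superharmonicity gives the inequality with the square of the mollified
  gradient on the left; this square tends to 1 in the mean because the distance satisfies the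
  eikonal equation and its second differences integrate to \<open>O(\<eta>\<^sup>2)\<close>.\<close>

lemma superharmonic_distance_weak_inequality:
  fixes \<Omega> :: "(real ^ 'n) set"
  assumes op: "open \<Omega>" "\<Omega> \<noteq> UNIV" and sup: "neg_laplacian_nonneg \<Omega> (bdist \<Omega>)"
    and f: "\<And>t. t > 0 \<Longrightarrow> (f has_real_derivative f' t) (at t)" "continuous_on {0<..} f'"
      "\<And>t. t > 0 \<Longrightarrow> t \<le> D \<Longrightarrow> 0 \<le> f t"
    and D: "\<And>x. bdist \<Omega> x \<le> D"
    and \<psi>: "\<And>x. (\<psi> has_derivative (\<lambda>h. G x \<bullet> h)) (at x)" "continuous_on UNIV G" "\<And>x. 0 \<le> \<psi> x"
      "compact (closure {x. \<psi> x \<noteq> 0})" "closure {x. \<psi> x \<noteq> 0} \<subseteq> \<Omega>"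
  shows "(\<integral>x. - f' (bdist \<Omega> x) * \<psi> x \<partial>lborel) \<le> (\<integral>x. f (bdist \<Omega> x) * norm (G x) \<partial>lborel)"
proof -
  let ?d = "bdist \<Omega>" and ?n = "CARD('n)"
  define K where "K = closure {x. \<psi> x \<noteq> 0}"
  have K: "closed K" "compact K" "\<And>x. x \<notin> K \<Longrightarrow> \<psi> x = 0" "\<And>x. x \<notin> K \<Longrightarrow> G x = 0" "K \<subseteq> \<Omega>"
    using closure_subset[of "{x. \<psi> x \<noteq> 0}"] gradient_support_subset[OF \<psi>(1)] \<psi>(4,5)
    by (auto simp: K_def)
  have b\<psi>: "bounded {x. \<psi> x \<noteq> 0}" by (rule compact_support_bounded[OF \<psi>(4)])
  have bG: "bounded {x. G x \<noteq> 0}"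
    by (rule bounded_subset[OF compact_imp_bounded[OF K(2)]]) (use K in auto)
  have c\<psi>: "continuous_on UNIV \<psi>"
    using \<psi>(1) by (auto intro!: has_derivative_continuous_on[of _ _ "\<lambda>y h. G y \<bullet> h"])
  have i\<psi>: "integrable lborel \<psi>" by (rule integrable_continuous_bounded_support[OF c\<psi> b\<psi>])
  have iG: "integrable lborel (\<lambda>x. norm (G x))"
    by (rule integrable_norm[OF integrable_continuous_bounded_support[OF \<psi>(2) bG]])
  \<comment> \<open>The factor 2 leaves room: for \<eta> \<le> \<delta> the mollified distance is at
    least \<delta> on \<open>K\<close>, and \<open>K\<close> keeps the distance from the boundary
    that superharmonicity of the mollification requires.\<close>
  obtain \<delta> where \<delta>: "\<delta> > 0" "\<And>x. x \<in> K \<Longrightarrow> 2 * \<delta> \<le> ?d x"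
  proof (cases "K = {}")
    case False
    then obtain x0 where x0: "x0 \<in> K" "\<And>x. x \<in> K \<Longrightarrow> ?d x0 \<le> ?d x"
      using continuous_attains_inf[OF K(2) False continuous_on_bdist] by blast
    then show ?thesis using that[of "?d x0 / 2"] bdist_pos[OF op, of x0] K(5) by auto
  qed (use that[of 1] in auto)
  have "bounded (?d ` K)"
    by (intro compact_imp_bounded compact_continuous_image continuous_on_bdist K)
  then obtain B where B: "\<And>x. x \<in> K \<Longrightarrow> ?d x \<le> B"
    unfolding bounded_iff by (metis abs_le_D1 imageI real_norm_def)
  \<comment> \<open>A compact interval containing the values on \<open>K\<close> of the distance and
    of all its mollifications. The bound \<open>M\<close> of f and f' on it later supplies the
    dominating functions.\<close>
  define I where "I = {\<delta>..B + \<delta>}"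
  have I: "compact I" "I \<subseteq> {0<..}" using \<delta> by (auto simp: I_def)
  have cf: "continuous_on {0<..} f"
    using f(1) by (intro continuous_at_imp_continuous_on ballI DERIV_isCont) auto
  obtain M where M: "M > 0" "\<And>t. t \<in> I \<Longrightarrow> \<bar>f t\<bar> \<le> M" "\<And>t. t \<in> I \<Longrightarrow> \<bar>f' t\<bar> \<le> M"
  proof -
    have "bounded (f ` I)" "bounded (f' ` I)"
      by (intro compact_imp_bounded compact_continuous_image I continuous_on_subset[OF cf] continuous_on_subset[OF f(2)])+
    then obtain M1 M2 where "\<And>t. t \<in> I \<Longrightarrow> \<bar>f t\<bar> \<le> M1" "\<And>t. t \<in> I \<Longrightarrow> \<bar>f' t\<bar> \<le> M2"
      unfolding bounded_iff by (metis imageI real_norm_def)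
    then show ?thesis by (intro that[of "max 1 (max M1 M2)"]) (auto simp: le_max_iff_disj)
  qed
  obtain L where L: "L > 0" and moll: "\<And>\<eta>. \<eta> > 0 \<Longrightarrow> \<exists>\<kappa> :: real ^ 'n \<Rightarrow> real. (\<forall>k. Ck k \<kappa>) \<and> (\<forall>z. 0 \<le> \<kappa> z) \<and>
     {z. \<kappa> z \<noteq> 0} \<subseteq> ball 0 \<eta> \<and> (\<integral>z. \<kappa> z \<partial>lborel) = 1 \<and> (\<forall>z. norm (gradient \<kappa> z) \<le> L / \<eta> ^ (?n + 1))"
    using scaled_mollifier_exists by metis
  obtain N where N: "\<And>x. norm (G x) \<le> N"
    using bounded_continuous_bounded_support[OF \<psi>(2) bG] by blast
  note lip = lipschitz_of_bounded_gradient[OF \<psi>(1) N]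
  obtain \<rho> where "\<And>x. \<psi> x \<noteq> 0 \<Longrightarrow> norm x \<le> \<rho>"
    using b\<psi> by (auto simp: bounded_iff)
  then have \<rho>: "{x. \<psi> x \<noteq> 0} \<subseteq> cball 0 \<rho>" by auto
  \<comment> \<open>The first summand collects \<eta>/d and the curvature of the paraboloid, with d
    \<ge> 2 \<delta> on \<open>K\<close>; the second comes from the averaged second differences,
    where the powers of \<eta> combine to \<eta>^(-n-1) \<eta>^n \<eta>^2 = \<eta>.\<close>
  define C where "C = (1 + L * 2 ^ ?n * ?n\<^sup>2 / 2) / (2 * \<delta>) * (\<integral>x. \<psi> x \<partial>lborel)
      + L * 2 ^ ?n / 2 * (N * ?n\<^sup>2 * measure lborel (cball (0::real^'n) (\<rho> + 1)))"
  have step: "\<exists>w. (\<forall>x. \<bar>w x - ?d x\<bar> \<le> \<eta>) \<and> continuous_on UNIV w \<and>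
      (\<integral>x. - f' (w x) * \<psi> x \<partial>lborel) \<le> (\<integral>x. f (w x) * norm (G x) \<partial>lborel) + 2 * M * C * \<eta>"
    if \<eta>: "\<eta> > 0" "\<eta> \<le> \<delta>" "\<eta> * ?n \<le> 1" for \<eta>
  proof -
    obtain \<kappa> :: "real ^ 'n \<Rightarrow> real" where \<kappa>: "\<And>k. Ck k \<kappa>" "\<And>z. 0 \<le> \<kappa> z"
     "{z. \<kappa> z \<noteq> 0} \<subseteq> ball 0 \<eta>" "(\<integral>z. \<kappa> z \<partial>lborel) = 1" "\<And>z. norm (gradient \<kappa> z) \<le> L / \<eta> ^ (?n + 1)"
      using moll[OF \<eta>(1)] by blast
    define w where "w x = (\<integral>y. ?d y * \<kappa> (y - x) \<partial>lborel)" for x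
    define V where "V x = - (\<integral>y. ?d y *\<^sub>R gradient \<kappa> (y - x) \<partial>lborel)" for x
    obtain H where H: "\<And>x. \<bar>w x - ?d x\<bar> \<le> \<eta>"
      "\<And>x. (w has_derivative (\<lambda>h. V x \<bullet> h)) (at x)"
      "\<And>x. norm (V x) \<le> 1"
      "\<And>i x. ((\<lambda>x. V x $ i) has_derivative (\<lambda>h. H i x \<bullet> h)) (at x)"
      "\<And>i. continuous_on UNIV (H i)"
      "\<And>x. \<eta> < ?d x \<Longrightarrow> (\<Sum>i\<in>UNIV. H i x $ i) \<le> 0"
      "\<And>x D. (\<And>y. ?d y \<le> D) \<Longrightarrow> w x \<le> D"
      using mollified_superharmonic_distance[OF op sup \<kappa>(1-4) \<eta>(1)] unfolding w_def V_def by blast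
    have cw: "continuous_on UNIV w"
      using H(2) by (auto intro!: has_derivative_continuous_on[of _ _ "\<lambda>y h. V y \<bullet> h"])
    have wI: "w x \<in> I" if "x \<in> K" for x
      using \<delta>(2)[OF that] B[OF that] H(1)[of x] \<eta> by (auto simp: I_def)
    have wpos: "0 < w x" if "x \<in> closure {x. \<psi> x \<noteq> 0}" for x
      using wI[of x] I that by (auto simp: K_def)
    have fpos: "0 \<le> f (w x)" if "x \<in> closure {x. \<psi> x \<noteq> 0}" for x
      using f(3)[OF wpos[OF that]] H(7)[OF D] by blast
    have Hneg: "(\<Sum>i\<in>UNIV. H i x $ i) \<le> 0" if "x \<in> closure {x. \<psi> x \<noteq> 0}" for x
      using \<delta>(2)[of x] that \<eta> \<delta>(1) by (intro H(6)) (auto simp: K_def)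
    note mw = mollified_weak_inequality[OF f(1,2) \<psi>(1-4) H(2-5) wpos fpos Hneg]
    have cV: "continuous_on UNIV V"
      using continuous_on_vec_lambda[of UNIV "\<lambda>i x. V x $ i"] H(4)
      by (auto intro!: has_derivative_continuous_on[of _ _ "\<lambda>y h. H _ y \<bullet> h"])
    define J where "J x = integral (cbox (- (\<eta> *\<^sub>R One)) (\<eta> *\<^sub>R One)) (\<lambda>h. 2 * ?d x - ?d (x + h) - ?d (x - h))" for x
    have cJ: "continuous_on UNIV J"
      unfolding J_def
      by (intro integral_continuous_on_param, unfold split_beta)
         (intro continuous_intros continuous_on_compose2[OF continuous_on_bdist[of UNIV]]; simp)
    have i\<psi>J: "integrable lborel (\<lambda>x. \<psi> x * J x)"
      by (intro integrable_continuous_bounded_support continuous_intros c\<psi> cJ) (auto intro: bounded_subset[OF b\<psi>])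
    have i\<psi>V: "integrable lborel (\<lambda>x. \<psi> x * (1 - norm (V x)))"
      by (intro integrable_continuous_bounded_support continuous_intros c\<psi> cV) (auto intro: bounded_subset[OF b\<psi>])
    have \<psi>J: "(\<integral>x. \<psi> x * J x \<partial>lborel) \<le> (2 * \<eta>) ^ ?n * (N * (\<eta> * ?n)\<^sup>2 * measure lborel (cball (0::real^'n) (\<rho> + 1)))"
      using integral_averaged_second_difference_le[OF lip bdist_lipschitz[of \<Omega>] \<rho> \<eta>(1) _ c\<psi> continuous_on_bdist] \<eta>(3)
      by (simp add: J_def)
    have "(\<integral>x. \<psi> x * (1 - norm (V x)) \<partial>lborel)
      \<le> (\<integral>x. \<eta> * ((1 + L * 2 ^ ?n * ?n\<^sup>2 / 2) / (2 * \<delta>)) * \<psi> x + L / (2 * \<eta> ^ (?n + 1)) * (\<psi> x * J x) \<partial>lborel)"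
    proof (rule integral_mono[OF i\<psi>V])
      show "integrable lborel (\<lambda>x. \<eta> * ((1 + L * 2 ^ ?n * ?n\<^sup>2 / 2) / (2 * \<delta>)) * \<psi> x + L / (2 * \<eta> ^ (?n + 1)) * (\<psi> x * J x))"
        by (intro Bochner_Integration.integrable_add integrable_mult_right i\<psi> i\<psi>J)
      fix x
      show "\<psi> x * (1 - norm (V x)) \<le> \<eta> * ((1 + L * 2 ^ ?n * ?n\<^sup>2 / 2) / (2 * \<delta>)) * \<psi> x + L / (2 * \<eta> ^ (?n + 1)) * (\<psi> x * J x)"
      proof (cases "x \<in> K")
        case True
        then have d: "2 * \<delta> \<le> ?d x" by (rule \<delta>)
        have S: "closed (UNIV - \<Omega>)" "UNIV - \<Omega> \<noteq> {}" using op by auto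
        have "1 - norm (V x) \<le> \<eta> / ?d x + L / \<eta> ^ (?n + 1) / 2 * (2 ^ ?n * ?n\<^sup>2 * \<eta> ^ (?n + 2) / ?d x + J x)"
          using mollified_infdist_gradient_lower_bound[OF S _ Ck_Suc_has_derivative[OF \<kappa>(1)]
              Ck_Suc_continuous_gradient[OF \<kappa>(1)] \<kappa>(3,2,4,5) \<eta>(1), of x] d \<delta>(1)
          by (simp add: V_def J_def bdist_def)
        also have "\<dots> = \<eta> * (1 + L * 2 ^ ?n * ?n\<^sup>2 / 2) / ?d x + L / (2 * \<eta> ^ (?n + 1)) * J x"
          using \<eta>(1) d \<delta>(1) by (simp add: field_simps power_add power2_eq_square)
        also have "\<dots> \<le> \<eta> * (1 + L * 2 ^ ?n * ?n\<^sup>2 / 2) / (2 * \<delta>) + L / (2 * \<eta> ^ (?n + 1)) * J x"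
          using \<eta>(1) d \<delta>(1) L by (intro add_right_mono divide_left_mono mult_nonneg_nonneg add_nonneg_nonneg) auto
        finally have "\<psi> x * (1 - norm (V x)) \<le> \<psi> x * (\<eta> * (1 + L * 2 ^ ?n * ?n\<^sup>2 / 2) / (2 * \<delta>) + L / (2 * \<eta> ^ (?n + 1)) * J x)"
          using \<psi>(3) by (rule mult_left_mono)
        then show ?thesis by (simp add: algebra_simps)
      qed (simp add: K)
    qed
    also have "\<dots> = \<eta> * ((1 + L * 2 ^ ?n * ?n\<^sup>2 / 2) / (2 * \<delta>)) * (\<integral>x. \<psi> x \<partial>lborel) + L / (2 * \<eta> ^ (?n + 1)) * (\<integral>x. \<psi> x * J x \<partial>lborel)"
      by (subst Bochner_Integration.integral_add) (use i\<psi> i\<psi>J in auto)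
    also have "\<dots> \<le> \<eta> * ((1 + L * 2 ^ ?n * ?n\<^sup>2 / 2) / (2 * \<delta>)) * (\<integral>x. \<psi> x \<partial>lborel) + L / (2 * \<eta> ^ (?n + 1)) *
        ((2 * \<eta>) ^ ?n * (N * (\<eta> * ?n)\<^sup>2 * measure lborel (cball (0::real^'n) (\<rho> + 1))))"
      using L \<eta>(1) \<psi>J by (intro add_left_mono mult_left_mono) auto
    also have "\<dots> = C * \<eta>"
    proof -
      have "L / (2 * \<eta> ^ (?n + 1)) * ((2 * \<eta>) ^ ?n * (N * (\<eta> * ?n)\<^sup>2 * v)) = L * 2 ^ ?n / 2 * (N * ?n\<^sup>2 * v) * \<eta>" for v
        using \<eta>(1) by (simp add: field_simps power_add power2_eq_square power_mult_distrib)
      then show ?thesis by (simp only:) (simp add: C_def algebra_simps)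
    qed
    finally have eik: "(\<integral>x. \<psi> x * (1 - norm (V x)) \<partial>lborel) \<le> C * \<eta>" .
    have "(\<integral>x. - f' (w x) * \<psi> x \<partial>lborel)
        \<le> (\<integral>x. - f' (w x) * \<psi> x * (norm (V x))\<^sup>2 + 2 * M * (\<psi> x * (1 - norm (V x))) \<partial>lborel)"
    proof (rule integral_mono)
      show "integrable lborel (\<lambda>x. - f' (w x) * \<psi> x)" using mw(1) by simp
      show "integrable lborel (\<lambda>x. - f' (w x) * \<psi> x * (norm (V x))\<^sup>2 + 2 * M * (\<psi> x * (1 - norm (V x))))"
        using mw(2) i\<psi>V by (intro Bochner_Integration.integrable_add integrable_mult_right) auto
      show "- f' (w x) * \<psi> x \<le> - f' (w x) * \<psi> x * (norm (V x))\<^sup>2 + 2 * M * (\<psi> x * (1 - norm (V x)))" for x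
      proof (cases "x \<in> K")
        case True
        have v: "0 \<le> norm (V x)" "norm (V x) \<le> 1" using H(3) by auto
        have "- f' (w x) * (1 - (norm (V x))\<^sup>2) \<le> M * (1 - (norm (V x))\<^sup>2)"
          using M(3)[OF wI[OF True]] v by (intro mult_right_mono) (auto simp: power_le_one)
        \<comment> \<open>By 1 - v^2 \<le> 2 (1 - v), a mean bound on 1 - |V| is enough to replace
          the square by 1.\<close>
        also have "\<dots> \<le> M * (2 * (1 - norm (V x)))"
          using M(1) sum_squares_bound[of 1 "norm (V x)"] by (intro mult_left_mono) auto
        finally have "\<psi> x * (- f' (w x) * (1 - (norm (V x))\<^sup>2)) \<le> \<psi> x * (M * (2 * (1 - norm (V x))))"
          using \<psi>(3) by (rule mult_left_mono)
        then show ?thesis by (simp add: algebra_simps)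
      qed (simp add: K)
    qed
    also have "\<dots> = (\<integral>x. - f' (w x) * \<psi> x * (norm (V x))\<^sup>2 \<partial>lborel) + 2 * M * (\<integral>x. \<psi> x * (1 - norm (V x)) \<partial>lborel)"
      using mw(2) i\<psi>V by (subst Bochner_Integration.integral_add) auto
    also have "\<dots> \<le> (\<integral>x. f (w x) * norm (G x) \<partial>lborel) + 2 * M * (C * \<eta>)"
      using mw(4) eik M(1) by (intro add_mono mult_left_mono) auto
    finally show ?thesis using H(1) cw by (intro exI[of _ w]) (simp add: mult.assoc)
  qed
  define \<eta> where "\<eta> m = min \<delta> (1 / ?n) / Suc m" for m
  have \<eta>: "\<eta> m > 0" "\<eta> m \<le> \<delta>" "\<eta> m * ?n \<le> 1" for m
  proof -
    have m: "0 < min \<delta> (1 / ?n)" using \<delta>(1) by simp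
    then show "\<eta> m > 0" by (simp add: \<eta>_def)
    have le: "\<eta> m \<le> min \<delta> (1 / ?n)" 
      using divide_left_mono[of 1 "real (Suc m)" "min \<delta> (1 / ?n)"] m by (simp only: \<eta>_def) simp
    then show "\<eta> m \<le> \<delta>" by simp
    have "\<eta> m \<le> 1 / ?n" using le by simp
    then show "\<eta> m * ?n \<le> 1" by (simp add: field_simps)
  qed
  have \<eta>0: "\<eta> \<longlonglongrightarrow> 0"
    unfolding \<eta>_def by (rule LIMSEQ_Suc[OF lim_const_over_n])
  have "\<forall>m. \<exists>w. (\<forall>x. \<bar>w x - ?d x\<bar> \<le> \<eta> m) \<and> continuous_on UNIV w \<and>
      (\<integral>x. - f' (w x) * \<psi> x \<partial>lborel) \<le> (\<integral>x. f (w x) * norm (G x) \<partial>lborel) + 2 * M * C * \<eta> m"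
    by (rule allI, rule step[OF \<eta>])
  from choice[OF this] obtain w where w: "\<And>m x. \<bar>w m x - ?d x\<bar> \<le> \<eta> m" "\<And>m. continuous_on UNIV (w m)"
    "\<And>m. (\<integral>x. - f' (w m x) * \<psi> x \<partial>lborel) \<le> (\<integral>x. f (w m x) * norm (G x) \<partial>lborel) + 2 * M * C * \<eta> m"
    by auto
  have wlim: "(\<lambda>m. w m x) \<longlonglongrightarrow> ?d x" for x
    by (rule LIM_zero_cancel, rule Lim_null_comparison[OF _ \<eta>0]) (use w(1) in auto)
  have wI: "w m x \<in> I" "?d x \<in> I" if "x \<in> K" for m x
    using \<delta>(2)[OF that] \<delta>(1) B[OF that] w(1)[of m x] \<eta>(2)[of m] by (auto simp: I_def)
  have meas: "(\<lambda>x. F (v x) * g x) \<in> borel_measurable lborel"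
    if "continuous_on {0<..} F" "continuous_on UNIV v" "\<And>x. x \<in> K \<Longrightarrow> v x \<in> I" "continuous_on UNIV g" "\<And>x. x \<notin> K \<Longrightarrow> g x = 0"
    for F and v g :: "real ^ 'n \<Rightarrow> real"
  proof -
    have "continuous_on UNIV (\<lambda>x. F (v x) * g x)"
    proof (rule continuous_on_zero_extension[of "{x. 0 < v x}" _ K])
      show "continuous_on {x. 0 < v x} (\<lambda>x. F (v x) * g x)"
        by (intro continuous_intros continuous_on_compose2[OF that(1)] continuous_on_subset[OF that(2)] continuous_on_subset[OF that(4)]) auto
      show "open {x. 0 < v x}" by (intro open_Collect_less that(2) continuous_intros)
      show "K \<subseteq> {x. 0 < v x}" using that(3) I(2) by fastforce
    qed (use that K I in auto)
    then show ?thesis using borel_measurable_continuous_onI by auto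
  qed
  \<comment> \<open>Only the values of the mollifications pass to the limit; their gradients have
    already been removed by the eikonal estimate.\<close>
  have lim1: "(\<lambda>m. \<integral>x. - f' (w m x) * \<psi> x \<partial>lborel) \<longlonglongrightarrow> (\<integral>x. - f' (?d x) * \<psi> x \<partial>lborel)"
  proof (rule integral_dominated_convergence[where w="\<lambda>x. M * \<psi> x"])
    show "(\<lambda>x. - f' (?d x) * \<psi> x) \<in> borel_measurable lborel"
      by (rule meas[of "\<lambda>t. - f' t"]) (auto intro!: continuous_intros f(2) continuous_on_bdist wI c\<psi> K)
    show "(\<lambda>x. - f' (w m x) * \<psi> x) \<in> borel_measurable lborel" for m
      by (rule meas[of "\<lambda>t. - f' t"]) (auto intro!: continuous_intros f(2) w(2) wI c\<psi> K)
    show "integrable lborel (\<lambda>x. M * \<psi> x)" using i\<psi> by simp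
    show "AE x in lborel. (\<lambda>m. - f' (w m x) * \<psi> x) \<longlonglongrightarrow> - f' (?d x) * \<psi> x"
    proof (rule AE_I2)
      fix x
      show "(\<lambda>m. - f' (w m x) * \<psi> x) \<longlonglongrightarrow> - f' (?d x) * \<psi> x"
      proof (cases "x \<in> K")
        case True
        have "(\<lambda>m. f' (w m x)) \<longlonglongrightarrow> f' (?d x)"
          using wI[OF True] I by (intro continuous_on_tendsto_compose[OF f(2) wlim]) (auto intro!: always_eventually)
        then show ?thesis by (intro tendsto_intros)
      qed (simp add: K)
    qed
    show "AE x in lborel. norm (- f' (w m x) * \<psi> x) \<le> M * \<psi> x" for m
    proof (rule AE_I2)
      fix x show "norm (- f' (w m x) * \<psi> x) \<le> M * \<psi> x"
        using M(3)[OF wI(1)[of x m]] \<psi>(3)[of x] by (cases "x \<in> K") (auto simp: abs_mult K intro: mult_right_mono)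
    qed
  qed
  have lim2: "(\<lambda>m. \<integral>x. f (w m x) * norm (G x) \<partial>lborel) \<longlonglongrightarrow> (\<integral>x. f (?d x) * norm (G x) \<partial>lborel)"
  proof (rule integral_dominated_convergence[where w="\<lambda>x. M * norm (G x)"])
    show "(\<lambda>x. f (?d x) * norm (G x)) \<in> borel_measurable lborel"
      by (rule meas) (auto intro!: continuous_intros cf continuous_on_bdist wI \<psi>(2) simp: K)
    show "(\<lambda>x. f (w m x) * norm (G x)) \<in> borel_measurable lborel" for m
      by (rule meas) (auto intro!: continuous_intros cf w(2) wI \<psi>(2) simp: K)
    show "integrable lborel (\<lambda>x. M * norm (G x))" using iG by simp
    show "AE x in lborel. (\<lambda>m. f (w m x) * norm (G x)) \<longlonglongrightarrow> f (?d x) * norm (G x)"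
    proof (rule AE_I2)
      fix x
      show "(\<lambda>m. f (w m x) * norm (G x)) \<longlonglongrightarrow> f (?d x) * norm (G x)"
      proof (cases "x \<in> K")
        case True
        have "(\<lambda>m. f (w m x)) \<longlonglongrightarrow> f (?d x)"
          using wI[OF True] I by (intro continuous_on_tendsto_compose[OF cf wlim]) (auto intro!: always_eventually)
        then show ?thesis by (intro tendsto_intros)
      qed (simp add: K)
    qed
    show "AE x in lborel. norm (f (w m x) * norm (G x)) \<le> M * norm (G x)" for m
    proof (rule AE_I2)
      fix x show "norm (f (w m x) * norm (G x)) \<le> M * norm (G x)"
        using M(2)[OF wI(1)[of x m]] by (cases "x \<in> K") (auto simp: abs_mult K intro: mult_right_mono)
    qed
  qed
  have "(\<lambda>m. (\<integral>x. f (w m x) * norm (G x) \<partial>lborel) + 2 * M * C * \<eta> m) \<longlonglongrightarrow>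
      (\<integral>x. f (?d x) * norm (G x) \<partial>lborel) + 2 * M * C * 0"
    by (intro tendsto_intros lim2 \<eta>0)
  with lim1 have "(\<integral>x. - f' (?d x) * \<psi> x \<partial>lborel) \<le> (\<integral>x. f (?d x) * norm (G x) \<partial>lborel) + 2 * M * C * 0"
    by (rule LIMSEQ_le) (use w(3) in auto)
  then show ?thesis by simp
qed

section \<open>Hardy's inequality with a weighted remainder\<close>

lemma continuous_on_abs_powr:
  fixes q :: real
  assumes "continuous_on S f" "q > 0"
  shows "continuous_on S (\<lambda>x. \<bar>f x\<bar> powr q)"
  using assms by (intro continuous_on_powr' continuous_intros) auto

lemma continuous_on_sgn_abs_powr:
  fixes q :: real
  assumes q: "q > 0"
  shows "continuous_on UNIV (\<lambda>t::real. sgn t * \<bar>t\<bar> powr q)"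
proof (intro continuous_at_imp_continuous_on ballI)
  fix t :: real
  have c: "isCont (\<lambda>t. \<bar>t\<bar> powr q) t" for t :: real
    using continuous_on_abs_powr[OF continuous_on_id q, of UNIV] by (simp add: continuous_on_eq_continuous_at)
  show "isCont (\<lambda>t. sgn t * \<bar>t\<bar> powr q) t"
  proof (cases "t = 0")
    case True
    have "(\<lambda>t. sgn t * \<bar>t\<bar> powr q) \<midarrow>0\<rightarrow> 0"
    proof (rule Lim_null_comparison)
      show "(\<lambda>t::real. \<bar>t\<bar> powr q) \<midarrow>0\<rightarrow> 0"
        using c[of 0] q by (simp add: isCont_def)
      show "\<forall>\<^sub>F t in at 0. norm (sgn t * \<bar>t\<bar> powr q) \<le> \<bar>t\<bar> powr q"
        by (rule always_eventually) (auto simp: abs_mult sgn_if)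
    qed
    then show ?thesis using True q by (simp add: isCont_def)
  next
    case False
    then show ?thesis by (intro continuous_intros c) auto
  qed
qed

text \<open>At 0 the difference quotient is sgn h |h|^(p-1), which tends to 0 since p > 1. Thus
  |u|^p is continuously differentiable across the zeros of u and admissible in the weak inequality,
  which is stated for C^1 test functions.\<close>

lemma has_real_derivative_abs_powr:
  fixes p :: real
  assumes p: "p > 1"
  shows "((\<lambda>t. \<bar>t\<bar> powr p) has_real_derivative p * (sgn t * \<bar>t\<bar> powr (p - 1))) (at t)"
proof -
  consider "t > 0" | "t < 0" | "t = 0" by linarith
  then show ?thesis
  proof cases
    case 1
    have "((\<lambda>t. t powr p) has_real_derivative p * (sgn t * \<bar>t\<bar> powr (p - 1))) (at t)"
      using 1 by (auto intro!: derivative_eq_intros)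
    then show ?thesis
      by (rule has_field_derivative_transform_within_open[of _ _ _ "{0<..}"]) (use 1 in auto)
  next
    case 2
    have "((\<lambda>t. (- t) powr p) has_real_derivative p * (sgn t * \<bar>t\<bar> powr (p - 1))) (at t)"
      using 2 by (auto intro!: derivative_eq_intros)
    then show ?thesis
      by (rule has_field_derivative_transform_within_open[of _ _ _ "{..<0}"]) (use 2 in auto)
  next
    case 3
    have "isCont (\<lambda>t. sgn t * \<bar>t\<bar> powr (p - 1)) 0"
      using continuous_on_sgn_abs_powr[of "p - 1"] p by (simp add: continuous_on_eq_continuous_at)
    then have "(\<lambda>t. sgn t * \<bar>t\<bar> powr (p - 1)) \<midarrow>0\<rightarrow> 0"
      using p by (simp add: isCont_def)
    moreover have "\<forall>\<^sub>F h in at 0. sgn h * \<bar>h\<bar> powr (p - 1) = \<bar>h\<bar> powr p / h" for h :: real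
      by (auto simp: eventually_at_filter sgn_if powr_diff)
    ultimately have "(\<lambda>h::real. \<bar>h\<bar> powr p / h) \<midarrow>0\<rightarrow> 0"
      by (rule Lim_transform_eventually)
    then show ?thesis
      using 3 p by (simp add: DERIV_def)
  qed
qed

lemma Cc_infD:
  assumes "u \<in> Cc_inf \<Omega>"
  shows "Ck k u" "compact (closure {x. u x \<noteq> 0})" "closure {x. u x \<noteq> 0} \<subseteq> \<Omega>"
  using assms by (auto simp: Cc_inf_def)

text \<open>The constant comes from a pointwise inequality in p and \<epsilon> alone, hence is
  independent of \<Omega>, \<open>D\<close> and u. Integrability belongs to the claim because a
  Bochner integral defaults to 0 otherwise, and the later comparison with integrals over balls could
  not use it.\<close>

lemma hardy_with_weighted_remainder:
  fixes p \<epsilon> :: real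
  assumes p: "p > 1" and \<epsilon>: "\<epsilon> > 0"
  shows "\<exists>c>0. \<forall>(\<Omega> :: (real ^ 'n) set) D. open \<Omega> \<longrightarrow> \<Omega> \<noteq> UNIV \<longrightarrow> neg_laplacian_nonneg \<Omega> (bdist \<Omega>) \<longrightarrow>
    D > 0 \<longrightarrow> (\<forall>x. bdist \<Omega> x \<le> D) \<longrightarrow> (\<forall>u\<in>Cc_inf \<Omega>.
      integrable lborel (\<lambda>x. (bdist \<Omega> x / D) powr \<epsilon> * (norm (gradient u x) powr p + \<bar>u x\<bar> powr p / bdist \<Omega> x powr p)) \<and>
      c * (\<integral>x. (bdist \<Omega> x / D) powr \<epsilon> * (norm (gradient u x) powr p + \<bar>u x\<bar> powr p / bdist \<Omega> x powr p) \<partial>lborel)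
        \<le> hardy_difference p \<Omega> u)"
proof -
  define h where "h = (p - 1) / p"
  obtain a c where a: "0 < a" "a < 1" and c: "0 < c"
    and pw: "\<And>s V g. 0 \<le> s \<Longrightarrow> s \<le> 1 \<Longrightarrow> 0 \<le> V \<Longrightarrow> 0 \<le> g \<Longrightarrow>
    p * h powr (p - 1) * (1 - a * s) * V powr (p - 1) * g + (h powr p + c * s) * V powr p + c * s * g powr p
    \<le> g powr p + h powr (p - 1) * ((p - 1) * (1 - a * s) + a * \<epsilon> * s) * V powr p"
    using weighted_hardy_pointwise[OF p \<epsilon>] unfolding h_def by blast
  have "integrable lborel (\<lambda>x. (bdist \<Omega> x / D) powr \<epsilon> * (norm (gradient u x) powr p + \<bar>u x\<bar> powr p / bdist \<Omega> x powr p)) \<and>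
      c * (\<integral>x. (bdist \<Omega> x / D) powr \<epsilon> * (norm (gradient u x) powr p + \<bar>u x\<bar> powr p / bdist \<Omega> x powr p) \<partial>lborel)
        \<le> hardy_difference p \<Omega> u"
    if op: "open \<Omega>" "\<Omega> \<noteq> UNIV" and sup: "neg_laplacian_nonneg \<Omega> (bdist \<Omega>)"
      and D: "D > 0" "\<And>x. bdist \<Omega> x \<le> D" and u: "u \<in> Cc_inf \<Omega>"
    for \<Omega> :: "(real ^ 'n) set" and D u
  proof -
    let ?d = "bdist \<Omega>"
    define K where "K = closure {x. u x \<noteq> 0}"
    define q where "q = h powr (p - 1)"
    have Du: "(u has_derivative (\<lambda>h. gradient u x \<bullet> h)) (at x)" for x
      by (rule Ck_Suc_has_derivative[OF Cc_infD(1)[OF u]])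
    have cu: "continuous_on A u" for A
      by (rule continuous_on_subset[OF Ck_continuous[OF Cc_infD(1)[OF u, of 0]]]) simp
    have cg: "continuous_on A (gradient u)" for A
      by (rule continuous_on_subset[OF Ck_Suc_continuous_gradient[OF Cc_infD(1)[OF u, of "Suc 0"]]]) simp
    have K: "closed K" "bounded K" "K \<subseteq> \<Omega>" "\<And>x. x \<notin> K \<Longrightarrow> u x = 0" "\<And>x. x \<notin> K \<Longrightarrow> gradient u x = 0"
      using Cc_infD(2,3)[OF u] closure_subset[of "{x. u x \<noteq> 0}"] gradient_support_subset[OF Du]
      by (auto simp: K_def compact_imp_bounded)
    have dpos: "?d x > 0" if "x \<in> \<Omega>" for x by (rule bdist_pos[OF op that])
    have cont: "continuous_on UNIV F" if "continuous_on \<Omega> F" "\<And>x. x \<notin> K \<Longrightarrow> F x = 0" for F :: "real ^ 'n \<Rightarrow> real"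
      by (rule continuous_on_zero_extension[OF that(1) op(1) K(1,3) that(2)])
    have int: "integrable lborel F" if "continuous_on \<Omega> F" "\<And>x. x \<notin> K \<Longrightarrow> F x = 0" for F :: "real ^ 'n \<Rightarrow> real"
      by (rule integrable_continuous_bounded_support[OF cont[OF that] bounded_subset[OF K(2)]]) (use that(2) in auto)
    define s where "s x = (?d x / D) powr \<epsilon>" for x
    define V where "V x = \<bar>u x\<bar> / ?d x" for x
    define g where "g x = norm (gradient u x)" for x
    have s: "0 \<le> s x" "s x \<le> 1" for x
      using D(1) D(2)[of x] bdist_nonneg[of \<Omega> x] \<epsilon> by (auto simp: s_def intro!: powr_le1)
    have V: "0 \<le> V x" "V x powr p = \<bar>u x\<bar> powr p / ?d x powr p"
      "V x powr (p - 1) = \<bar>u x\<bar> powr (p - 1) / ?d x powr (p - 1)" for x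
      using bdist_nonneg[of \<Omega> x] by (auto simp: V_def powr_divide)
    have cs: "continuous_on \<Omega> s"
      unfolding s_def using D(1) \<epsilon>
      by (intro continuous_on_powr' continuous_intros continuous_on_bdist) (auto simp: bdist_nonneg)
    have cV: "continuous_on \<Omega> V"
      unfolding V_def by (intro continuous_intros cu continuous_on_bdist) (use dpos in force)
    have cVp: "continuous_on \<Omega> (\<lambda>x. V x powr r)" if "r > 0" for r
      using continuous_on_abs_powr[OF cV that] V(1) by simp
    have cgp: "continuous_on \<Omega> (\<lambda>x. g x powr p)"
      using continuous_on_abs_powr[of \<Omega> g p] p by (simp add: g_def continuous_on_norm[OF cg])
    have cg': "continuous_on \<Omega> g" unfolding g_def by (intro continuous_intros cg)
    have zero: "V x powr r = 0" "g x = 0" if "x \<notin> K" for x r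
      using that K(4,5) by (auto simp: V_def g_def)
    define f where "f t = q * t powr (1 - p) * (1 - a * (t / D) powr \<epsilon>)" for t
    define f' where "f' t = - q * ((p - 1) * (1 - a * (t / D) powr \<epsilon>) + a * \<epsilon> * (t / D) powr \<epsilon>) * t powr (- p)" for t
    have weak: "(\<integral>x. - f' (?d x) * \<bar>u x\<bar> powr p \<partial>lborel)
        \<le> (\<integral>x. f (?d x) * norm ((p * (sgn (u x) * \<bar>u x\<bar> powr (p - 1))) *\<^sub>R gradient u x) \<partial>lborel)"
    proof (rule superharmonic_distance_weak_inequality[OF op sup _ _ _ D(2)])
      show "(f has_real_derivative f' t) (at t)" if "t > 0" for t
      proof -
        have 1: "((\<lambda>t. (t / D) powr \<epsilon>) has_real_derivative \<epsilon> * (t / D) powr \<epsilon> / t) (at t)"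
          using that D(1) by (auto intro!: derivative_eq_intros simp: powr_diff field_simps)
        have 2: "((\<lambda>t. t powr (1 - p)) has_real_derivative (1 - p) * t powr (- p)) (at t)"
          using has_real_derivative_powr[OF that, of "1 - p"] by simp
        have 3: "t powr (1 - p) = t * t powr (- p)"
          using that by (simp add: powr_mult_base)
        show ?thesis
          unfolding f_def f'_def
          by (rule DERIV_cong[OF DERIV_mult[OF DERIV_cmult[OF 2] DERIV_diff[OF DERIV_const DERIV_cmult[OF 1]]]])
             (use that in \<open>simp add: 3 algebra_simps\<close>)
      qed
      show "continuous_on {0<..} f'"
        unfolding f'_def using D(1) by (intro continuous_intros) auto
      show "0 \<le> f t" if "t > 0" "t \<le> D" for t
      proof -
        have "(t / D) powr \<epsilon> \<le> 1" using that D(1) \<epsilon> by (intro powr_le1) auto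
        then have "a * (t / D) powr \<epsilon> \<le> 1 * 1" using a by (intro mult_mono) auto
        then show ?thesis by (simp add: f_def q_def)
      qed
      show "((\<lambda>x. \<bar>u x\<bar> powr p) has_derivative
          (\<lambda>h. ((p * (sgn (u x) * \<bar>u x\<bar> powr (p - 1))) *\<^sub>R gradient u x) \<bullet> h)) (at x)" for x
        using has_derivative_compose[OF Du has_real_derivative_abs_powr[OF p, unfolded has_field_derivative_def]]
        by simp
      show "continuous_on UNIV (\<lambda>x. (p * (sgn (u x) * \<bar>u x\<bar> powr (p - 1))) *\<^sub>R gradient u x)"
        using p by (intro continuous_intros cg continuous_on_compose2[OF continuous_on_sgn_abs_powr cu]) auto
      have "{x. \<bar>u x\<bar> powr p \<noteq> 0} = {x. u x \<noteq> 0}" by auto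
      then show "compact (closure {x. \<bar>u x\<bar> powr p \<noteq> 0})" "closure {x. \<bar>u x\<bar> powr p \<noteq> 0} \<subseteq> \<Omega>"
        using Cc_infD(2,3)[OF u] by simp_all
    qed simp
    \<comment> \<open>Off \<Omega> both sides vanish along with u, so this identity and the next
      hold at every x.\<close>
    have lhs: "- f' (?d x) * \<bar>u x\<bar> powr p = q * ((p - 1) * (1 - a * s x) + a * \<epsilon> * s x) * V x powr p" for x
      by (simp add: f'_def s_def V(2) powr_minus divide_inverse)
    have rhs: "f (?d x) * norm ((p * (sgn (u x) * \<bar>u x\<bar> powr (p - 1))) *\<^sub>R gradient u x)
        = p * q * (1 - a * s x) * V x powr (p - 1) * g x" for x
    proof (cases "u x = 0")
      case False
      have "?d x powr (1 - p) = 1 / ?d x powr (p - 1)" by (simp add: powr_minus_divide[symmetric])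
      then show ?thesis using False p
        by (simp add: f_def s_def V(3) g_def abs_mult abs_sgn_eq)
    qed (simp add: V_def)
    define F where "F x = q * ((p - 1) * (1 - a * s x) + a * \<epsilon> * s x) * V x powr p" for x
    define E where "E x = p * q * (1 - a * s x) * V x powr (p - 1) * g x" for x
    define W where "W x = s x * (g x powr p + V x powr p)" for x
    have iF: "integrable lborel F" unfolding F_def using p by (intro int continuous_intros cs cVp) (auto simp: zero)
    have iE: "integrable lborel E" unfolding E_def using p by (intro int continuous_intros cs cVp cg') (auto simp: zero)
    have iW: "integrable lborel W" unfolding W_def using p by (intro int continuous_intros cs cVp cgp) (auto simp: zero)
    have ig: "integrable lborel (\<lambda>x. g x powr p)" by (intro int cgp) (auto simp: zero)
    have iV: "integrable lborel (\<lambda>x. V x powr p)" using p by (intro int cVp) (auto simp: zero)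
    \<comment> \<open>The weak inequality says that the integral of \<open>F\<close> is at most that
      of \<open>E\<close>, so both drop out and the Hardy difference bounds the integral of
      \<open>c * W x\<close>.\<close>
    have "(\<integral>x. E x + h powr p * V x powr p + c * W x \<partial>lborel) \<le> (\<integral>x. g x powr p + F x \<partial>lborel)"
    proof (rule integral_mono)
      show "E x + h powr p * V x powr p + c * W x \<le> g x powr p + F x" for x
        using pw[OF s V(1), of "g x" x x] by (simp add: E_def F_def W_def q_def g_def algebra_simps)
    qed (use iE iV iW ig iF in \<open>auto intro!: Bochner_Integration.integrable_add\<close>)
    then have "(\<integral>x. E x \<partial>lborel) + h powr p * (\<integral>x. V x powr p \<partial>lborel) + c * (\<integral>x. W x \<partial>lborel)
        \<le> (\<integral>x. g x powr p \<partial>lborel) + (\<integral>x. F x \<partial>lborel)"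
      using iE iV iW ig iF by simp
    moreover have "(\<integral>x. F x \<partial>lborel) \<le> (\<integral>x. E x \<partial>lborel)"
      using weak unfolding lhs rhs F_def E_def .
    moreover have "(LINT x:\<Omega>|lebesgue. norm (gradient u x) powr p) = (\<integral>x. g x powr p \<partial>lborel)"
      unfolding g_def[symmetric]
      by (rule set_integral_lebesgue_eq_lborel[OF borel_measurable_continuous_onI[OF cont[OF cgp]]])
         (use zero K(3) in auto)
    moreover have "(LINT x:\<Omega>|lebesgue. \<bar>u x\<bar> powr p / ?d x powr p) = (\<integral>x. V x powr p \<partial>lborel)"
      unfolding V(2)[symmetric] using p
      by (intro set_integral_lebesgue_eq_lborel borel_measurable_continuous_onI cont cVp)
         (use zero K(3) in auto)
    ultimately have "c * (\<integral>x. W x \<partial>lborel) \<le> hardy_difference p \<Omega> u"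
      by (simp add: hardy_difference_def h_def)
    then show ?thesis
      using iW by (simp add: W_def[abs_def] s_def g_def V(2))
  qed
  then show ?thesis
    using c by (intro exI[of _ c]) blast
qed

section \<open>A local Morrey estimate\<close>

text \<open>Jensen by the tangent at the mean m: integrate p m^(p-1) F \<le> F^p + (p-1) m^p against
  \<rho>, which has mass 1.\<close>

lemma mollifier_jensen:
  fixes \<rho> F :: "'a::euclidean_space \<Rightarrow> real" and p :: real
  assumes \<rho>: "continuous_on UNIV \<rho>" "\<And>z. 0 \<le> \<rho> z" "bounded {z. \<rho> z \<noteq> 0}" "(\<integral>z. \<rho> z \<partial>lborel) = 1"
    and F: "continuous_on UNIV F" "\<And>z. 0 \<le> F z" and p: "p > 1"
  shows "(\<integral>z. \<rho> z * F z \<partial>lborel) powr p \<le> (\<integral>z. \<rho> z * F z powr p \<partial>lborel)"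
proof -
  have int: "integrable lborel (\<lambda>z. \<rho> z * f z)" if "continuous_on UNIV f" for f
    by (intro integrable_continuous_bounded_support continuous_intros \<rho>(1) that) (auto intro: bounded_subset[OF \<rho>(3)])
  have cFp: "continuous_on UNIV (\<lambda>z. F z powr p)"
    using continuous_on_abs_powr[OF F(1), of p] F(2) p by simp
  define m where "m = (\<integral>z. \<rho> z * F z \<partial>lborel)"
  have m: "m \<ge> 0" unfolding m_def using \<rho>(2) F(2) by simp
  have "p * m * m powr (p - 1) = (\<integral>z. p * m powr (p - 1) * (\<rho> z * F z) \<partial>lborel)"
    by (simp add: m_def)
  also have "\<dots> \<le> (\<integral>z. \<rho> z * F z powr p + (p - 1) * m powr p * \<rho> z \<partial>lborel)"
  proof (rule integral_mono)
    show "p * m powr (p - 1) * (\<rho> z * F z) \<le> \<rho> z * F z powr p + (p - 1) * m powr p * \<rho> z" for z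
      using mult_left_mono[OF young_powr[OF p F(2)[of z] m] \<rho>(2)[of z]] by (simp add: algebra_simps)
  qed (use int[OF F(1)] int[OF cFp] int[of "\<lambda>_. 1"] in auto)
  also have "\<dots> = (\<integral>z. \<rho> z * F z powr p \<partial>lborel) + (p - 1) * m powr p"
    using int[OF cFp] int[of "\<lambda>_. 1"] \<rho>(4) by simp
  also have "p * m * m powr (p - 1) = p * m powr p"
    using m by (simp add: powr_diff)
  finally show ?thesis unfolding m_def[symmetric] by (simp add: algebra_simps)
qed

text \<open>Substituting y = x0 + \<tau> z produces the negative power of \<tau> and moves the
  support into the ball of radius \<tau> \<le> r. The integral on the right does not involve \<tau>,
  so that power is the whole dependence on the scale.\<close>

lemma mollified_average_le:
  fixes \<rho> F :: "'a::euclidean_space \<Rightarrow> real"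
  assumes \<rho>: "continuous_on UNIV \<rho>" "\<And>z. 0 \<le> \<rho> z" "{z. \<rho> z \<noteq> 0} \<subseteq> ball 0 1" "\<And>z. \<rho> z \<le> L"
    and F: "continuous_on UNIV F" "\<And>z. 0 \<le> F z" and \<tau>: "0 < \<tau>" "\<tau> \<le> r"
  shows "(\<integral>z. \<rho> z * F (x0 + \<tau> *\<^sub>R z) \<partial>lborel)
    \<le> L * \<tau> powr (- real DIM('a)) * (\<integral>y. indicator (ball x0 r) y * F y \<partial>lborel)"
proof -
  let ?f = "\<lambda>y. \<rho> ((1 / \<tau>) *\<^sub>R (y - x0)) * F y"
  have cf: "continuous_on UNIV ?f"
    by (intro continuous_intros continuous_on_compose2[OF \<rho>(1)] F) auto
  have sub: "y \<in> ball x0 r" if "\<rho> ((1 / \<tau>) *\<^sub>R (y - x0)) \<noteq> 0" for y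
  proof -
    have "(1 / \<tau>) *\<^sub>R (y - x0) \<in> ball 0 1" using \<rho>(3) that by blast
    then have "norm (y - x0) < \<tau>" using \<tau> by (simp add: divide_simps)
    then show ?thesis using \<tau> by (simp add: dist_norm norm_minus_commute)
  qed
  have "\<tau> ^ DIM('a) * (\<integral>z. \<rho> z * F (x0 + \<tau> *\<^sub>R z) \<partial>lborel) = (\<integral>y. ?f y \<partial>lborel)"
    using lborel_integral_affine[OF borel_measurable_continuous_onI[OF cf] \<tau>(1), of x0] \<tau> by simp
  also have "\<dots> \<le> (\<integral>y. L * (indicator (ball x0 r) y * F y) \<partial>lborel)"
  proof (rule integral_mono)
    show "integrable lborel ?f"
      by (rule integrable_continuous_bounded_support[OF cf bounded_subset[OF bounded_ball[of x0 r]]]) (use sub in auto)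
    have "integrable lborel (\<lambda>y. indicator (ball x0 r) y *\<^sub>R (indicator (cball x0 r) y *\<^sub>R F y))"
      by (intro integrable_mult_indicator borel_integrable_compact continuous_on_subset[OF F(1)]) auto
    also have "(\<lambda>y. indicator (ball x0 r) y *\<^sub>R (indicator (cball x0 r) y *\<^sub>R F y)) = (\<lambda>y. indicator (ball x0 r) y * F y)"
      by (auto simp: indicator_def fun_eq_iff)
    finally show "integrable lborel (\<lambda>y. L * (indicator (ball x0 r) y * F y))"
      by (rule integrable_mult_right)
    show "?f y \<le> L * (indicator (ball x0 r) y * F y)" for y
    proof (cases "\<rho> ((1 / \<tau>) *\<^sub>R (y - x0)) = 0")
      case True
      have "0 \<le> L" using \<rho>(2,4) order_trans by blast
      then show ?thesis using True F(2)[of y] by simp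
    next
      case False
      then show ?thesis using sub[OF False] \<rho>(4) F(2)[of y] by (simp add: mult_right_mono)
    qed
  qed
  finally show ?thesis
    using \<tau>(1) by (simp add: powr_minus powr_realpow field_simps)
qed

text \<open>The mean \<open>A t\<close> of \<open>u\<close> over the ball of radius \<open>t r\<close> has derivative
  \<open>O(t powr (- n / p))\<close>, which is integrable at 0 precisely because \<open>p > n\<close>.\<close>

lemma morrey_ball_estimate:
  fixes p :: real
  assumes p: "p > real CARD('n)"
  shows "\<exists>C>0. \<forall>(u :: real ^ 'n \<Rightarrow> real) x0 r. Ck 1 u \<longrightarrow> r > 0 \<longrightarrow>
    \<bar>u x0\<bar> powr p \<le> C * (r powr (p - CARD('n)) * (\<integral>y. indicator (ball x0 r) y * norm (gradient u y) powr p \<partial>lborel)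
      + r powr (- real CARD('n)) * (\<integral>y. indicator (ball x0 r) y * \<bar>u y\<bar> powr p \<partial>lborel))"
proof -
  let ?n = "real CARD('n)"
  have n: "?n \<ge> 1" by (simp add: Suc_leI)
  have p1: "p > 1" using p n by linarith
  obtain \<rho> :: "real ^ 'n \<Rightarrow> real" where \<rho>: "\<And>k. Ck k \<rho>" "\<And>z. 0 \<le> \<rho> z" "{z. \<rho> z \<noteq> 0} \<subseteq> ball 0 1"
    "(\<integral>z. \<rho> z \<partial>lborel) = 1"
    using mollifier_exists by blast
  have c\<rho>: "continuous_on UNIV \<rho>" by (rule Ck_continuous[OF \<rho>(1)])
  have b\<rho>: "bounded {z. \<rho> z \<noteq> 0}" using \<rho>(3) bounded_subset[OF bounded_ball] by blast
  obtain L where L: "L > 0" "\<And>z. \<rho> z \<le> L"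
    using bounded_continuous_bounded_support[OF c\<rho> b\<rho>] by (metis abs_le_D1 real_norm_def)
  define \<theta> where "\<theta> = 1 - ?n / p"
  have \<theta>: "\<theta> > 0" using p n by (simp add: \<theta>_def)
  \<comment> \<open>2^p comes from splitting the p-th power of a sum of two terms; the maximum
    merges the factors of the two integrals.\<close>
  define C where "C = 2 powr p * L * max 1 (1 / \<theta> powr p)"
  have "\<bar>u x0\<bar> powr p \<le> C * (r powr (p - ?n) * (\<integral>y. indicator (ball x0 r) y * norm (gradient u y) powr p \<partial>lborel)
      + r powr (- ?n) * (\<integral>y. indicator (ball x0 r) y * \<bar>u y\<bar> powr p \<partial>lborel))"
    if u: "Ck 1 u" and r: "r > 0" for u :: "real ^ 'n \<Rightarrow> real" and x0 r
  proof -
    define g where "g = gradient u"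
    have Du: "(u has_derivative (\<lambda>h. g x \<bullet> h)) (at x)" for x
      unfolding g_def using u by (intro Ck_Suc_has_derivative[of 0]) simp
    have cu: "continuous_on A u" for A by (rule continuous_on_subset[OF Ck_continuous[OF u]]) simp
    have cg: "continuous_on A g" for A
      unfolding g_def using u by (intro continuous_on_subset[OF Ck_Suc_continuous_gradient[of 0 u]]) simp_all
    define E where "E = (\<integral>y. indicator (ball x0 r) y * norm (g y) powr p \<partial>lborel)"
    define U where "U = (\<integral>y. indicator (ball x0 r) y * \<bar>u y\<bar> powr p \<partial>lborel)"
    have E: "E \<ge> 0" and U: "U \<ge> 0" by (auto simp: E_def U_def intro!: Bochner_Integration.integral_nonneg)
    have cgp: "continuous_on UNIV (\<lambda>y. norm (g y) powr p)"
      using continuous_on_abs_powr[OF continuous_on_norm[OF cg], of p UNIV] p1 by simp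
    have cup: "continuous_on UNIV (\<lambda>y. \<bar>u y\<bar> powr p)"
      using continuous_on_abs_powr[OF cu, of p UNIV] p1 by simp
    let ?Q = "cbox (- (1 *\<^sub>R One)) (1 *\<^sub>R One) :: (real ^ 'n) set"
    have Q: "{z. \<rho> z \<noteq> 0} \<subseteq> ?Q"
      using \<rho>(3) cball_subset_symmetric_cube[of 1] ball_subset_cball by blast
    \<comment> \<open>Scaling puts the radius into the argument of \<open>u\<close>: density and
      domain stay fixed, and the derivative in t passes under the integral.\<close>
    define A where "A t = (\<integral>z. \<rho> z * u (x0 + (t * r) *\<^sub>R z) \<partial>lborel)" for t
    define A' where "A' t = (\<integral>z. \<rho> z * (g (x0 + (t * r) *\<^sub>R z) \<bullet> (r *\<^sub>R z)) \<partial>lborel)" for t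
    have Aeq: "A t = integral ?Q (\<lambda>z. \<rho> z * u (x0 + (t * r) *\<^sub>R z))" for t
      unfolding A_def using Q
      by (intro integral_lborel_eq_integral_cbox continuous_intros c\<rho> continuous_on_compose2[OF cu[of UNIV]]) auto
    have A'eq: "A' t = integral ?Q (\<lambda>z. \<rho> z * (g (x0 + (t * r) *\<^sub>R z) \<bullet> (r *\<^sub>R z)))" for t
      unfolding A'_def using Q
      by (intro integral_lborel_eq_integral_cbox continuous_intros c\<rho> continuous_on_compose2[OF cg[of UNIV]]) auto
    have DA: "(A has_real_derivative A' t) (at t)" for t
      unfolding Aeq A'eq
    proof (rule leibniz_rule_field_derivative[of UNIV, simplified])
      show "((\<lambda>t. \<rho> z * u (x0 + (t * r) *\<^sub>R z)) has_real_derivative \<rho> z * (g (x0 + (t * r) *\<^sub>R z) \<bullet> (r *\<^sub>R z))) (at t)" for t z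
      proof -
        have "((\<lambda>t. u (x0 + (t * r) *\<^sub>R z)) has_derivative (\<lambda>s. g (x0 + (t * r) *\<^sub>R z) \<bullet> ((s * r) *\<^sub>R z))) (at t)"
          by (rule has_derivative_compose[OF _ Du]) (auto intro!: derivative_eq_intros)
        then have "((\<lambda>t. u (x0 + (t * r) *\<^sub>R z)) has_real_derivative (g (x0 + (t * r) *\<^sub>R z) \<bullet> (r *\<^sub>R z))) (at t)"
          by (simp add: has_field_derivative_def mult_commute_abs mult.assoc mult.left_commute)
        then show ?thesis by (rule DERIV_cmult)
      qed
      show "(\<lambda>z. \<rho> z * u (x0 + (t * r) *\<^sub>R z)) integrable_on ?Q" for t
        by (intro integrable_continuous continuous_intros continuous_on_subset[OF c\<rho>] continuous_on_compose2[OF cu[of UNIV]]) auto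
      show "continuous_on (UNIV \<times> ?Q) (\<lambda>(t, z). \<rho> z * (g (x0 + (t * r) *\<^sub>R z) \<bullet> (r *\<^sub>R z)))"
        unfolding split_beta
        by (intro continuous_intros continuous_on_compose2[OF c\<rho>] continuous_on_compose2[OF cg[of UNIV]]) auto
    qed
    define M where "M = r * (L * r powr (- ?n) * E) powr (1 / p)"
    have M: "M \<ge> 0" using r by (simp add: M_def)
    have A'le: "\<bar>A' t\<bar> \<le> M * t powr (- (?n / p))" if t: "0 < t" "t < 1" for t
    proof -
      have tr: "0 < t * r" "t * r \<le> r" using t r by (auto simp: mult_le_cancel_right1)
      let ?N = "\<lambda>z. norm (g (x0 + (t * r) *\<^sub>R z))"
      have cN: "continuous_on UNIV ?N"
        by (intro continuous_intros continuous_on_compose2[OF cg[of UNIV]]) auto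
      define m where "m = (\<integral>z. \<rho> z * ?N z \<partial>lborel)"
      have m: "m \<ge> 0" using \<rho>(2) by (simp add: m_def)
      have iN: "integrable lborel (\<lambda>z. \<rho> z * ?N z)"
        by (intro integrable_continuous_bounded_support continuous_intros c\<rho> cN) (auto intro: bounded_subset[OF b\<rho>])
      have iA: "integrable lborel (\<lambda>z. \<rho> z * (g (x0 + (t * r) *\<^sub>R z) \<bullet> (r *\<^sub>R z)))"
        by (intro integrable_continuous_bounded_support continuous_intros c\<rho> continuous_on_compose2[OF cg[of UNIV]])
           (auto intro: bounded_subset[OF b\<rho>])
      have "\<bar>A' t\<bar> \<le> (\<integral>z. r * (\<rho> z * ?N z) \<partial>lborel)"
        unfolding A'_def
      proof (rule order_trans[OF integral_abs_bound integral_mono])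
        show "\<bar>\<rho> z * (g (x0 + (t * r) *\<^sub>R z) \<bullet> (r *\<^sub>R z))\<bar> \<le> r * (\<rho> z * ?N z)" for z
        proof (cases "\<rho> z = 0")
          case False
          then have z: "norm z < 1" using \<rho>(3) by auto
          have "\<bar>g (x0 + (t * r) *\<^sub>R z) \<bullet> (r *\<^sub>R z)\<bar> \<le> ?N z * norm (r *\<^sub>R z)"
            by (rule Cauchy_Schwarz_ineq2)
          also have "\<dots> \<le> ?N z * r" using r z by (intro mult_left_mono) auto
          finally have "\<rho> z * \<bar>g (x0 + (t * r) *\<^sub>R z) \<bullet> (r *\<^sub>R z)\<bar> \<le> \<rho> z * (?N z * r)"
            using \<rho>(2) by (rule mult_left_mono)
          then show ?thesis using \<rho>(2)[of z] by (simp add: abs_mult mult_ac)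
        qed simp
      qed (use iN iA in auto)
      then have A'm: "\<bar>A' t\<bar> \<le> r * m" by (simp add: m_def)
      have "m powr p \<le> L * (t * r) powr (- ?n) * E"
      proof -
        have "m powr p \<le> (\<integral>z. \<rho> z * ?N z powr p \<partial>lborel)"
          unfolding m_def by (rule mollifier_jensen[OF c\<rho> \<rho>(2) b\<rho> \<rho>(4) cN _ p1]) simp
        also have "\<dots> \<le> L * (t * r) powr (- ?n) * E"
          unfolding E_def
          using mollified_average_le[OF c\<rho> \<rho>(2,3) L(2) cgp _ tr, of x0] by simp
        finally show ?thesis .
      qed
      then have "m \<le> (L * (t * r) powr (- ?n) * E) powr (1 / p)"
        using powr_mono2[of "1 / p" "m powr p"] m p1 by (simp add: powr_powr)
      also have "\<dots> = (L * r powr (- ?n) * E) powr (1 / p) * t powr (- (?n / p))"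
        using t r L(1) E by (simp add: powr_mult powr_powr)
      finally have "r * m \<le> M * t powr (- (?n / p))"
        using r by (simp add: M_def mult.assoc)
      with A'm show ?thesis by simp
    qed
    \<comment> \<open>The majorant is continuous up to 0 although the formula for its derivative is
      unbounded there; this mean value inequality asks for derivatives only in the open
      interval.\<close>
    have "norm (A 1 - A 0) \<le> M * 1 powr \<theta> / \<theta> - M * 0 powr \<theta> / \<theta>"
    proof (rule differentiable_bound_general[of 0 1 A "\<lambda>t. M * t powr \<theta> / \<theta>" A' "\<lambda>t. M * t powr (- (?n / p))"])
      show "continuous_on {0..1} A"
        using DA by (meson DERIV_continuous_on DERIV_subset subset_UNIV)
      show "continuous_on {0..1} (\<lambda>t. M * t powr \<theta> / \<theta>)"
        using \<theta> by (intro continuous_intros continuous_on_powr') auto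
      show "(A has_vector_derivative A' t) (at t)" for t
        using DA by (simp add: has_real_derivative_iff_has_vector_derivative)
      show "((\<lambda>t. M * t powr \<theta> / \<theta>) has_vector_derivative M * t powr (- (?n / p))) (at t)" if "0 < t" for t
        unfolding has_real_derivative_iff_has_vector_derivative[symmetric]
        using that \<theta> by (auto intro!: derivative_eq_intros simp: \<theta>_def)
      show "norm (A' t) \<le> M * t powr (- (?n / p))" if "0 < t" "t < 1" for t
        using A'le[OF that] by simp
    qed simp
    moreover have "A 0 = u x0" using \<rho>(4) by (simp add: A_def)
    ultimately have "\<bar>u x0\<bar> \<le> \<bar>A 1\<bar> + M / \<theta>" by simp
    also have "\<dots> \<le> 2 * max \<bar>A 1\<bar> (M / \<theta>)" by simp
    finally have "\<bar>u x0\<bar> powr p \<le> (2 * max \<bar>A 1\<bar> (M / \<theta>)) powr p"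
      using p1 by (intro powr_mono2) auto
    also have "\<dots> = 2 powr p * max \<bar>A 1\<bar> (M / \<theta>) powr p"
      by (simp add: powr_mult)
    also have "\<dots> \<le> 2 powr p * (\<bar>A 1\<bar> powr p + (M / \<theta>) powr p)"
      by (intro mult_left_mono) (auto simp: max_def)
    also have "\<bar>A 1\<bar> powr p \<le> L * r powr (- ?n) * U"
    proof -
      let ?N = "\<lambda>z. \<bar>u (x0 + r *\<^sub>R z)\<bar>"
      have cN: "continuous_on UNIV ?N"
        by (intro continuous_intros continuous_on_compose2[OF cu[of UNIV]]) auto
      have "\<bar>A 1\<bar> \<le> (\<integral>z. \<bar>\<rho> z * u (x0 + r *\<^sub>R z)\<bar> \<partial>lborel)"
        unfolding A_def by simp
      also have "\<dots> = (\<integral>z. \<rho> z * ?N z \<partial>lborel)" using \<rho>(2) by (simp add: abs_mult)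
      finally have "\<bar>A 1\<bar> powr p \<le> (\<integral>z. \<rho> z * ?N z \<partial>lborel) powr p"
        using p1 by (intro powr_mono2) auto
      also have "\<dots> \<le> (\<integral>z. \<rho> z * ?N z powr p \<partial>lborel)"
        by (rule mollifier_jensen[OF c\<rho> \<rho>(2) b\<rho> \<rho>(4) cN _ p1]) simp
      also have "\<dots> \<le> L * r powr (- ?n) * U"
        unfolding U_def
        using mollified_average_le[OF c\<rho> \<rho>(2,3) L(2) cup _ r order_refl, of x0] by simp
      finally show ?thesis .
    qed
    also have "(M / \<theta>) powr p = L * (1 / \<theta> powr p) * (r powr (p - ?n) * E)"
    proof -
      have "M powr p = r powr p * (L * r powr (- ?n) * E)"
        unfolding M_def using r L(1) E p1 by (simp add: powr_mult powr_powr)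
      also have "\<dots> = L * (r powr (p - ?n) * E)"
        using r by (simp add: powr_diff powr_minus divide_inverse)
      finally show ?thesis using M \<theta> by (simp add: powr_divide)
    qed
    also have "2 powr p * (L * r powr (- ?n) * U + L * (1 / \<theta> powr p) * (r powr (p - ?n) * E))
        = 2 powr p * L * (1 * (r powr (- ?n) * U) + (1 / \<theta> powr p) * (r powr (p - ?n) * E))"
      by (simp add: algebra_simps)
    also have "\<dots> \<le> 2 powr p * L * (max 1 (1 / \<theta> powr p) * (r powr (- ?n) * U) + max 1 (1 / \<theta> powr p) * (r powr (p - ?n) * E))"
      using L(1) E U by (intro mult_left_mono add_mono mult_right_mono) auto
    also have "\<dots> = C * (r powr (p - ?n) * E + r powr (- ?n) * U)"
      by (simp add: C_def algebra_simps)
    finally show ?thesis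
      by (simp add: E_def U_def g_def)
  qed
  moreover have "C > 0" using L(1) by (simp add: C_def)
  ultimately show ?thesis by blast
qed

section \<open>The Hardy-Morrey inequality\<close>

text \<open>The ball about x of radius d(x) lies in \<Omega>, so its volume is at most that of
  \<Omega>.\<close>

lemma bdist_le_volume_radius:
  fixes \<Omega> :: "(real ^ 'n) set"
  assumes op: "open \<Omega>" and fin: "emeasure lebesgue \<Omega> < \<infinity>"
  shows "bdist \<Omega> x \<le> (measure lebesgue \<Omega> / unit_ball_vol CARD('n)) powr (1 / CARD('n))"
proof (cases "x \<in> \<Omega> \<and> \<Omega> \<noteq> UNIV")
  \<comment> \<open>Here d(x) = 0, either because x lies outside \<Omega> or by the convention
    \<open>infdist x {} = 0\<close>.\<close>
  case False
  then have "bdist \<Omega> x = 0" by (cases "\<Omega> = UNIV") (simp_all add: bdist_outside, simp add: bdist_def infdist_def)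
  then show ?thesis by simp
next
  case True
  define d where "d = bdist \<Omega> x"
  have d: "d > 0" using bdist_pos[OF op] True by (simp add: d_def)
  have "ball x d \<subseteq> \<Omega>"
  proof
    fix y assume y: "y \<in> ball x d"
    show "y \<in> \<Omega>"
    proof (rule ccontr)
      assume "y \<notin> \<Omega>"
      then have "d \<le> dist x y" unfolding d_def bdist_def by (intro infdist_le) auto
      then show False using y by simp
    qed
  qed
  then have "measure lebesgue (ball x d) \<le> measure lebesgue \<Omega>"
    using op fin by (intro measure_mono_fmeasurable) (auto simp: fmeasurable_def)
  moreover have "measure lebesgue (ball x d) = unit_ball_vol CARD('n) * d ^ CARD('n)"
    using content_ball[of d x] d by simp
  ultimately have "d ^ CARD('n) \<le> measure lebesgue \<Omega> / unit_ball_vol CARD('n)"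
    by (simp add: field_simps)
  then have "(d ^ CARD('n)) powr (1 / CARD('n)) \<le> (measure lebesgue \<Omega> / unit_ball_vol CARD('n)) powr (1 / CARD('n))"
    using d by (intro powr_mono2) auto
  also have "(d ^ CARD('n)) powr (1 / CARD('n)) = d"
    using d by (simp add: powr_realpow[symmetric] powr_powr)
  finally show ?thesis by (simp add: d_def)
qed

lemma emeasure_lebesgue_finite_imp_not_UNIV:
  "emeasure lebesgue \<Omega> < \<infinity> \<Longrightarrow> \<Omega> \<noteq> (UNIV :: 'a::euclidean_space set)"
  using emeasure_lborel_UNIV by auto

text \<open>The p-th root has its usual meaning only for a non-negative Hardy difference, so the
  sign is asserted together with the bound.\<close>

theorem mainTheorem9:
  fixes p :: real
  assumes "p > real CARD('n::finite)"
  shows "\<exists>C>0. \<forall>\<Omega> :: (real ^ 'n) set.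
    domain \<Omega> \<longrightarrow> emeasure lebesgue \<Omega> < \<infinity> \<longrightarrow> neg_laplacian_nonneg \<Omega> (bdist \<Omega>) \<longrightarrow>
    (\<forall>u\<in>Cc_inf \<Omega>.
      0 \<le> hardy_difference p \<Omega> u \<and>
      (SUP x\<in>\<Omega>. \<bar>u x\<bar>)
        \<le> C * measure lebesgue \<Omega> powr (1 / real CARD('n) - 1 / p)
            * hardy_difference p \<Omega> u powr (1 / p))"
proof -
  let ?n = "real CARD('n)" and ?\<omega> = "unit_ball_vol (real CARD('n))"
  have n: "?n \<ge> 1" by (simp add: Suc_leI)
  then have p: "p > 1" and \<epsilon>: "p - ?n > 0" using assms by linarith+
  have \<omega>: "?\<omega> > 0" by simp
  obtain c where c: "c > 0" and hardy: "\<forall>(\<Omega> :: (real ^ 'n) set) D. open \<Omega> \<longrightarrow> \<Omega> \<noteq> UNIV \<longrightarrow>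
    neg_laplacian_nonneg \<Omega> (bdist \<Omega>) \<longrightarrow> D > 0 \<longrightarrow> (\<forall>x. bdist \<Omega> x \<le> D) \<longrightarrow> (\<forall>u\<in>Cc_inf \<Omega>.
      integrable lborel (\<lambda>x. (bdist \<Omega> x / D) powr (p - ?n) * (norm (gradient u x) powr p + \<bar>u x\<bar> powr p / bdist \<Omega> x powr p)) \<and>
      c * (\<integral>x. (bdist \<Omega> x / D) powr (p - ?n) * (norm (gradient u x) powr p + \<bar>u x\<bar> powr p / bdist \<Omega> x powr p) \<partial>lborel)
        \<le> hardy_difference p \<Omega> u)"
    using hardy_with_weighted_remainder[OF p \<epsilon>, where 'n='n] by blast
  obtain C where C: "C > 0" and morrey: "\<forall>(u :: real ^ 'n \<Rightarrow> real) x0 r. Ck 1 u \<longrightarrow> r > 0 \<longrightarrow>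
    \<bar>u x0\<bar> powr p \<le> C * (r powr (p - ?n) * (\<integral>y. indicator (ball x0 r) y * norm (gradient u y) powr p \<partial>lborel)
      + r powr (- ?n) * (\<integral>y. indicator (ball x0 r) y * \<bar>u y\<bar> powr p \<partial>lborel))"
    using morrey_ball_estimate[OF assms] by blast
  \<comment> \<open>\<open>C\<close> is the Morrey constant and \<open>c\<close> the one of the
    Hardy remainder; 1 belongs to the gradient term, 4^p to |u|^p \<le> (4 r)^p |u|^p/d^p on the
    ball.\<close>
  define Z where "Z = C * (1 + 4 powr p) / c"
  define B where "B = Z powr (1 / p) / ?\<omega> powr (1 / ?n - 1 / p)"
  have Z: "Z > 0"
    unfolding Z_def using C c by (intro divide_pos_pos mult_pos_pos add_pos_nonneg) auto
  then have B: "B > 0"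
    unfolding B_def using \<omega> by (intro divide_pos_pos) (simp_all only: powr_gt_zero)
  have main: "0 \<le> hardy_difference p \<Omega> u \<and>
      (SUP x\<in>\<Omega>. \<bar>u x\<bar>) \<le> B * measure lebesgue \<Omega> powr (1 / ?n - 1 / p) * hardy_difference p \<Omega> u powr (1 / p)"
    if dom: "domain \<Omega>" and fin: "emeasure lebesgue \<Omega> < \<infinity>"
      and sup: "neg_laplacian_nonneg \<Omega> (bdist \<Omega>)" and u: "u \<in> Cc_inf \<Omega>"
    for \<Omega> :: "(real ^ 'n) set" and u
  proof -
    let ?d = "bdist \<Omega>" and ?I = "hardy_difference p \<Omega> u"
    have op: "open \<Omega>" "\<Omega> \<noteq> UNIV" and ne: "\<Omega> \<noteq> {}"
      using dom emeasure_lebesgue_finite_imp_not_UNIV[OF fin] by (auto simp: domain_def)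
    define D where "D = (measure lebesgue \<Omega> / ?\<omega>) powr (1 / ?n)"
    have D: "?d x \<le> D" for x unfolding D_def by (rule bdist_le_volume_radius[OF op(1) fin])
    obtain y where "y \<in> \<Omega>" using ne by blast
    with bdist_pos[OF op this] D[of y] have D0: "D > 0" by linarith
    define W where "W x = (?d x / D) powr (p - ?n) * (norm (gradient u x) powr p + \<bar>u x\<bar> powr p / ?d x powr p)" for x
    have iW: "integrable lborel W" and WI: "c * (\<integral>x. W x \<partial>lborel) \<le> ?I"
      using hardy[rule_format, OF op sup D0 D u] by (simp_all add: W_def[abs_def])
    have W0: "0 \<le> W x" for x by (auto simp: W_def)
    have W1: "(\<integral>x. W x \<partial>lborel) \<le> ?I / c" using WI c by (simp add: field_simps)
    have I0: "0 \<le> ?I" using WI c W0 by (meson Bochner_Integration.integral_nonneg less_imp_le mult_nonneg_nonneg order_trans)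
    have pt: "\<bar>u x0\<bar> \<le> B * measure lebesgue \<Omega> powr (1 / ?n - 1 / p) * ?I powr (1 / p)" if x0: "x0 \<in> \<Omega>" for x0
    proof -
      \<comment> \<open>Half the distance makes d comparable to r on the whole ball, so that d can
        be exchanged for r both in the weight and in |u|^p/d^p.\<close>
      define r where "r = ?d x0 / 2"
      have r: "r > 0" using bdist_pos[OF op x0] by (simp add: r_def)
      have dr: "r \<le> ?d y" "?d y \<le> 4 * r" if "y \<in> ball x0 r" for y
        using bdist_lipschitz[of \<Omega> x0 y] that by (auto simp: r_def)
      define \<sigma> where "\<sigma> = (r / D) powr (p - ?n)"
      have \<sigma>: "\<sigma> > 0" using r D0 by (simp add: \<sigma>_def)
      \<comment> \<open>Both integrals of the Morrey estimate are compared with that of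
        \<open>W\<close>, whose weight is at least \<sigma> on the ball; \<open>k\<close> is 1 for
        the gradient and (4 r)^p for |u|^p.\<close>
      have bound: "(\<integral>y. indicator (ball x0 r) y * F y \<partial>lborel) \<le> k * (?I / c / \<sigma>)"
        if F: "\<And>y. y \<in> ball x0 r \<Longrightarrow> F y \<le> k * (norm (gradient u y) powr p + \<bar>u y\<bar> powr p / ?d y powr p)"
          and k: "k > 0" for F k
      proof -
        have "(\<integral>y. indicator (ball x0 r) y * F y \<partial>lborel) \<le> (\<integral>y. k / \<sigma> * W y \<partial>lborel)"
        proof (rule integral_mono')
          show "integrable lborel (\<lambda>y. k / \<sigma> * W y)" using iW by simp
          show "indicator (ball x0 r) y * F y \<le> k / \<sigma> * W y" for y
          proof (cases "y \<in> ball x0 r")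
            case True
            let ?X = "norm (gradient u y) powr p + \<bar>u y\<bar> powr p / ?d y powr p"
            have "\<sigma> \<le> (?d y / D) powr (p - ?n)"
              unfolding \<sigma>_def using dr(1)[OF True] r D0 \<epsilon> by (intro powr_mono2 divide_right_mono) auto
            then have "\<sigma> * ?X \<le> W y" unfolding W_def by (intro mult_right_mono) auto
            then have "k / \<sigma> * (\<sigma> * ?X) \<le> k / \<sigma> * W y" using k \<sigma> by (intro mult_left_mono) auto
            then show ?thesis using F[OF True] True \<sigma> by simp
          next
            case False
            then show ?thesis using k \<sigma> W0[of y] by simp
          qed
          show "0 \<le> k / \<sigma> * W y" for y using k \<sigma> W0[of y] by simp
        qed
        also have "\<dots> = k / \<sigma> * (\<integral>y. W y \<partial>lborel)" by simp
        also have "\<dots> \<le> k / \<sigma> * (?I / c)" using W1 k \<sigma> by (intro mult_left_mono) auto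
        finally show ?thesis by (simp add: field_simps)
      qed
      have b1: "(\<integral>y. indicator (ball x0 r) y * norm (gradient u y) powr p \<partial>lborel) \<le> 1 * (?I / c / \<sigma>)"
        by (rule bound) auto
      have b2: "(\<integral>y. indicator (ball x0 r) y * \<bar>u y\<bar> powr p \<partial>lborel) \<le> (4 * r) powr p * (?I / c / \<sigma>)"
      proof (rule bound)
        fix y assume y: "y \<in> ball x0 r"
        have d: "0 < ?d y" using dr(1)[OF y] r by linarith
        have "\<bar>u y\<bar> powr p = ?d y powr p * (\<bar>u y\<bar> powr p / ?d y powr p)" using d by simp
        also have "\<dots> \<le> (4 * r) powr p * (\<bar>u y\<bar> powr p / ?d y powr p)"
          using dr(2)[OF y] d p by (intro mult_right_mono powr_mono2) auto
        also have "\<dots> \<le> (4 * r) powr p * (norm (gradient u y) powr p + \<bar>u y\<bar> powr p / ?d y powr p)"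
          by (intro mult_left_mono) auto
        finally show "\<bar>u y\<bar> powr p \<le> (4 * r) powr p * (norm (gradient u y) powr p + \<bar>u y\<bar> powr p / ?d y powr p)" .
      qed (use r in auto)
      have "\<bar>u x0\<bar> powr p \<le> C * (r powr (p - ?n) * (1 * (?I / c / \<sigma>)) + r powr (- ?n) * ((4 * r) powr p * (?I / c / \<sigma>)))"
        using C b1 b2 by (intro order_trans[OF morrey[rule_format, OF Cc_infD(1)[OF u] r, of x0]] mult_left_mono add_mono) auto
      also have "r powr (- ?n) * ((4 * r) powr p * (?I / c / \<sigma>)) = 4 powr p * (r powr (p - ?n) * (?I / c / \<sigma>))"
        using r by (simp add: powr_mult powr_diff powr_minus field_simps)
      also have "r powr (p - ?n) * (1 * (?I / c / \<sigma>)) = D powr (p - ?n) * (?I / c)"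
        using r D0 by (simp add: \<sigma>_def powr_divide)
      also have "r powr (p - ?n) * (?I / c / \<sigma>) = D powr (p - ?n) * (?I / c)"
        using r D0 by (simp add: \<sigma>_def powr_divide)
      also have "C * (D powr (p - ?n) * (?I / c) + 4 powr p * (D powr (p - ?n) * (?I / c))) = Z * D powr (p - ?n) * ?I"
        using c by (simp add: Z_def field_simps)
      finally have up: "\<bar>u x0\<bar> powr p \<le> Z * D powr (p - ?n) * ?I" .
      have "\<bar>u x0\<bar> = (\<bar>u x0\<bar> powr p) powr (1 / p)" using p by (simp add: powr_powr)
      also have "\<dots> \<le> (Z * D powr (p - ?n) * ?I) powr (1 / p)"
        using up p by (intro powr_mono2) auto
      also have "\<dots> = Z powr (1 / p) * D powr ((p - ?n) / p) * ?I powr (1 / p)"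
        using Z D0 I0 by (simp add: powr_mult powr_powr)
      also have "D powr ((p - ?n) / p) = (measure lebesgue \<Omega> / ?\<omega>) powr (1 / ?n - 1 / p)"
      proof -
        have "1 / ?n * ((p - ?n) / p) = 1 / ?n - 1 / p" using n p by (simp add: field_simps)
        then show ?thesis unfolding D_def powr_powr by simp
      qed
      also have "\<dots> = measure lebesgue \<Omega> powr (1 / ?n - 1 / p) / ?\<omega> powr (1 / ?n - 1 / p)"
        using \<omega> by (simp add: powr_divide)
      finally show ?thesis by (simp add: B_def)
    qed
    show ?thesis
      using I0 pt ne by (auto intro!: cSUP_least)
  qed
  show ?thesis
    using B main by (intro exI[of _ B]) blast
qed

end
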